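(* Let $\mu$ be a probability measure on $\mathbb{T}$ with Verblunsky coefficients $\{\alpha_n\}_{n=0}^N$, $N\le\infty$, and let $f$ be the Schur function associated with $\mu$. For $k\ge1$ ($k<N$ if $N$ is finite) let $\mathcal{T}^{(k)}(\{\alpha_n\}_{n=0}^N)$ and $\widetilde{\mathcal{T}}^{(k)}(\{\alpha_n\}_{n=0}^N)$ be the matrices obtained by deleting the first $k$ rows and columns from the truncated CMV matrices $\mathcal{T}(\{\alpha_n\}_{n=0}^N)$ and $\widetilde{\mathcal{T}}(\{\alpha_n\}_{n=0}^N)$, respectively. Then $\mathcal{T}^{(k)}$ and $\widetilde{\mathcal{T}}^{(k)}$ are completely nonunitary contractions with rank one defects, and for $m=1,2,\ldots$ $$\mathcal{T}^{(2m-1)}(\{\alpha_n\}_{n=0}^N)=\widetilde{\mathcal{T}}(\{\alpha_n\}_{n=2m-1}^N),\qquad \mathcal{T}^{(2m)}(\{\alpha_n\}_{n=0}^N)=\mathcal{T}(\{\alpha_n\}_{n=2m}^N).$$ Consequently the characteristic function of $\mathcal{T}^{(k)}(\{\alpha_n\}_{n=0}^N)$ agrees with the $k$-th Schur iterate of $f$.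
   Context: $\mathbb{D}$ is the open unit disk, $\mathbb{T}$ the unit circle. For a contraction $T$ on a Hilbert space, $D_T=(I-T^*T)^{1/2}$, $D_{T^*}=(I-TT^* )^{1/2}$, $\mathfrak{D}_T=\overline{\mathrm{ran}}\,D_T$, $\mathfrak{D}_{T^*}=\overline{\mathrm{ran}}\,D_{T^*}$. $T$ has rank one defects if $\dim\mathfrak{D}_T=\dim\mathfrak{D}_{T^*}=1$; $T$ is completely nonunitary if no nonzero subspace reduces $T$ to a unitary operator. The characteristic function of $T$ is $\Theta_T(z)=\bigl(-T+zD_{T^*}(I-zT^* )^{-1}D_T\bigr)|_{\mathfrak{D}_T}:\mathfrak{D}_T\to\mathfrak{D}_{T^*}$, $z\in\mathbb{D}$. It agrees with a scalar function $g$ if $V\Theta_T(z)W=g(z)$, $z\in\mathbb{D}$, for some unitary $W:\mathbb{C}\to\mathfrak{D}_T$, $V:\mathfrak{D}_{T^*}\to\mathbb{C}$. Verblunsky coefficients of $\mu$: $\alpha_n=-\overline{\Phi_{n+1}(0)}$, where $\Phi_n$ is the monic polynomial of degree $n$ orthogonal in $L^2(\mathbb{T},d\mu)$ to $1,\dots,\zeta^{n-1}$. If $\mu$ has infinite support, $N=\infty$ and all $\alpha_n\in\mathbb{D}$; if $\mu$ is supported on exactly $N+1$ points, then $\alpha_0,\dots,\alpha_{N-1}\in\mathbb{D}$ and $|\alpha_N|=1$. The Schur function associated with $\mu$ is $f(z)=\frac1z\frac{F(z)-1}{F(z)+1}$ with $F(z)=\int_{\mathbb{T}}\frac{\zeta+z}{\zeta-z}d\mu(\zeta)$.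 Its Schur iterates are $f_0=f$, $f_{n+1}(z)=\dfrac{f_n(z)-\gamma_n}{z(1-\bar\gamma_nf_n(z))}$, $\gamma_n=f_n(0)$. Truncated CMV matrices. Let $\{\alpha_n\}_{n=0}^N$ be either an infinite sequence of numbers in $\mathbb{D}$ ($N=\infty$), or a finite sequence of complex numbers with $\alpha_0,\dots,\alpha_{N-1}\in\mathbb{D}$ and $|\alpha_N|=1$ ($N<\infty$), and let $\rho_n=\sqrt{1-|\alpha_n|^2}$. The truncated CMV matrix $\mathcal{T}(\{\alpha_n\}_{n=0}^N)=(t_{ij})$, $i,j\ge1$ ($i,j\le N$ if $N<\infty$), has entries $t_{m,m}=-\bar\alpha_m\alpha_{m-1}$; for $m$ odd: $t_{m+1,m}=\bar\alpha_{m+1}\rho_m$, $t_{m,m+1}=-\alpha_{m-1}\rho_m$, $t_{m+2,m}=\rho_m\rho_{m+1}$, $t_{m,m+2}=0$; for $m$ even: $t_{m+1,m}=-\alpha_{m-1}\rho_m$, $t_{m,m+1}=\bar\alpha_{m+1}\rho_m$, $t_{m+2,m}=0$, $t_{m,m+2}=\rho_m\rho_{m+1}$; all other entries are $0$. $\widetilde{\mathcal{T}}(\{\alpha_n\})$ is the transpose of $\mathcal{T}(\{\alpha_n\})$. $\mathcal{T}(\{\alpha_n\}_{n=k}^N)$ denotes $\mathcal{T}(\{\beta_n\}_{n=0}^{N-k})$ with $\beta_n=\alpha_{n+k}$, and similarly for $\widetilde{\mathcal{T}}$. *)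

theory Defs
  imports "HOL-Complex_Analysis.Complex_Analysis" "HOL-Probability.Probability"
    "HOL-Library.Extended_Nat"
begin

section \<open>Complex Hilbert spaces\<close>

text \<open>
  Inner products are linear in the first argument.
\<close>

class complex_inner = real_inner +
  fixes scaleC :: "complex \<Rightarrow> 'a \<Rightarrow> 'a" (infixr "*\<^sub>C" 75)
    and cinner :: "'a \<Rightarrow> 'a \<Rightarrow> complex"
  assumes scaleC_add_right: "c *\<^sub>C (x + y) = c *\<^sub>C x + c *\<^sub>C y"
    and scaleC_add_left: "(c + d) *\<^sub>C x = c *\<^sub>C x + d *\<^sub>C x"
    and scaleC_scaleC: "c *\<^sub>C d *\<^sub>C x = (c * d) *\<^sub>C x"
    and scaleR_scaleC: "r *\<^sub>R x = complex_of_real r *\<^sub>C x"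
    and cinner_commute: "cinner x y = cnj (cinner y x)"
    and cinner_add_left: "cinner (x + y) z = cinner x z + cinner y z"
    and cinner_scaleC_left: "cinner (c *\<^sub>C x) y = c * cinner x y"
    and inner_eq_Re_cinner: "inner x y = Re (cinner x y)"

class complex_hilbert = complex_inner + complete_space

interpretation complex_vector: vector_space "scaleC :: complex \<Rightarrow> 'a \<Rightarrow> 'a::complex_inner"
proof
  fix x :: 'a
  show "1 *\<^sub>C x = x"
    using scaleR_scaleC[of 1 x] by simp
qed (simp_all add: scaleC_add_right scaleC_add_left scaleC_scaleC)

instantiation complex :: complex_hilbert
begin

definition scaleC_complex :: "complex \<Rightarrow> complex \<Rightarrow> complex" where
  "scaleC_complex c x = c * x"

definition cinner_complex :: "complex \<Rightarrow> complex \<Rightarrow> complex" where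
  "cinner_complex x y = x * cnj y"

instance
  by standard
    (simp_all add: scaleC_complex_def cinner_complex_def algebra_simps scaleR_conv_of_real
      inner_complex_def)

end


section \<open>The space of square-summable sequences\<close>

definition square_summable :: "(nat \<Rightarrow> complex) \<Rightarrow> bool" where
  "square_summable x \<longleftrightarrow> summable (\<lambda>i. (cmod (x i))\<^sup>2)"

lemma square_summable_prod:
  assumes "square_summable x" "square_summable y"
  shows "summable (\<lambda>i. x i * cnj (y i))"
proof (rule summable_comparison_test)
  show "summable (\<lambda>i. (cmod (x i))\<^sup>2 + (cmod (y i))\<^sup>2)"
    using assms by (intro summable_add) (auto simp: square_summable_def)
  have "cmod (x i * cnj (y i)) \<le> (cmod (x i))\<^sup>2 + (cmod (y i))\<^sup>2" for i
    using sum_squares_bound[of "cmod (x i)" "cmod (y i)"]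
      mult_nonneg_nonneg[OF norm_ge_zero[of "x i"] norm_ge_zero[of "y i"]]
    unfolding norm_mult complex_mod_cnj by linarith
  then show "\<exists>N. \<forall>n\<ge>N. cmod (x n * cnj (y n)) \<le> (cmod (x n))\<^sup>2 + (cmod (y n))\<^sup>2"
    by blast
qed

lemma square_summable_add:
  assumes "square_summable x" "square_summable y"
  shows "square_summable (\<lambda>i. x i + y i)"
  unfolding square_summable_def
proof (rule summable_comparison_test)
  show "summable (\<lambda>i. 2 * (cmod (x i))\<^sup>2 + 2 * (cmod (y i))\<^sup>2)"
    using assms by (intro summable_add summable_mult) (auto simp: square_summable_def)
  have "(cmod (x i + y i))\<^sup>2 \<le> 2 * (cmod (x i))\<^sup>2 + 2 * (cmod (y i))\<^sup>2" for i
  proof -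
    have "(cmod (x i + y i))\<^sup>2 \<le> (cmod (x i) + cmod (y i))\<^sup>2"
      by (intro power_mono norm_triangle_ineq) auto
    also have "\<dots> \<le> 2 * (cmod (x i))\<^sup>2 + 2 * (cmod (y i))\<^sup>2"
      using sum_squares_bound[of "cmod (x i)" "cmod (y i)"]
      unfolding power2_sum by linarith
    finally show ?thesis .
  qed
  then show "\<exists>N. \<forall>n\<ge>N. norm ((cmod (x n + y n))\<^sup>2) \<le> 2 * (cmod (x n))\<^sup>2 + 2 * (cmod (y n))\<^sup>2"
    by simp
qed

lemma square_summable_scale:
  assumes "square_summable x"
  shows "square_summable (\<lambda>i. c * x i)"
  using summable_mult[OF assms[unfolded square_summable_def], of "(cmod c)\<^sup>2"]
  by (simp add: square_summable_def norm_mult power_mult_distrib)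

typedef ell2 = "{x. square_summable x}"
  morphisms ell2_nth Abs_ell2
  by (rule exI[of _ "\<lambda>_. 0"]) (simp add: square_summable_def)

setup_lifting type_definition_ell2

lemma square_summable_nth: "square_summable (ell2_nth x)"
  using ell2_nth by simp

lemma ell2_eqI: "(\<And>i. ell2_nth x i = ell2_nth y i) \<Longrightarrow> x = y"
  by (metis ell2_nth_inject ext)

instantiation ell2 :: complex_inner
begin

lift_definition zero_ell2 :: ell2 is "\<lambda>_. 0"
  by (simp add: square_summable_def)

lift_definition plus_ell2 :: "ell2 \<Rightarrow> ell2 \<Rightarrow> ell2" is "\<lambda>x y i. x i + y i"
  by (rule square_summable_add)

lift_definition scaleC_ell2 :: "complex \<Rightarrow> ell2 \<Rightarrow> ell2" is "\<lambda>c x i. c * x i"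
  by (rule square_summable_scale)

lift_definition uminus_ell2 :: "ell2 \<Rightarrow> ell2" is "\<lambda>x i. - x i"
  by (simp add: square_summable_def)

definition minus_ell2 :: "ell2 \<Rightarrow> ell2 \<Rightarrow> ell2" where
  "minus_ell2 x y = x + (- y)"

definition scaleR_ell2 :: "real \<Rightarrow> ell2 \<Rightarrow> ell2" where
  "scaleR_ell2 r x = complex_of_real r *\<^sub>C x"

definition cinner_ell2 :: "ell2 \<Rightarrow> ell2 \<Rightarrow> complex" where
  "cinner_ell2 x y = (\<Sum>i. ell2_nth x i * cnj (ell2_nth y i))"

definition inner_ell2 :: "ell2 \<Rightarrow> ell2 \<Rightarrow> real" where
  "inner_ell2 x y = Re (cinner x y)"

definition norm_ell2 :: "ell2 \<Rightarrow> real" where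
  "norm_ell2 x = sqrt (inner x x)"

definition sgn_ell2 :: "ell2 \<Rightarrow> ell2" where
  "sgn_ell2 x = inverse (norm x) *\<^sub>R x"

definition dist_ell2 :: "ell2 \<Rightarrow> ell2 \<Rightarrow> real" where
  "dist_ell2 x y = norm (x - y)"

definition uniformity_ell2 :: "(ell2 \<times> ell2) filter" where
  "uniformity_ell2 = (INF e\<in>{0<..}. principal {(x, y). dist x y < e})"

definition open_ell2 :: "ell2 set \<Rightarrow> bool" where
  "open_ell2 U \<longleftrightarrow> (\<forall>x\<in>U. \<forall>\<^sub>F (x', y) in uniformity. x' = x \<longrightarrow> y \<in> U)"

lemma summable_cinner_ell2: "summable (\<lambda>i. ell2_nth x i * cnj (ell2_nth y i))"
  by (intro square_summable_prod square_summable_nth)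

lemma inner_ell2_self: "inner x x = (\<Sum>i. (cmod (ell2_nth x i))\<^sup>2)" for x :: ell2
proof -
  have "inner x x = (\<Sum>i. Re (ell2_nth x i * cnj (ell2_nth x i)))"
    unfolding inner_ell2_def cinner_ell2_def by (intro Re_suminf summable_cinner_ell2)
  moreover have "Re (a * cnj a) = (cmod a)\<^sup>2" for a
    by (metis complex_norm_square Re_complex_of_real)
  ultimately show ?thesis
    by simp
qed

instance
proof
  fix x y z :: ell2 and c d :: complex and r s :: real
  note nth = zero_ell2.rep_eq plus_ell2.rep_eq scaleC_ell2.rep_eq uminus_ell2.rep_eq
  show "x + y + z = x + (y + z)" "x + y = y + x" "0 + x = x" "- x + x = 0" "x - y = x + - y"
    by (auto intro!: ell2_eqI simp: nth minus_ell2_def)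
  show C: "c *\<^sub>C (x + y) = c *\<^sub>C x + c *\<^sub>C y" "(c + d) *\<^sub>C x = c *\<^sub>C x + d *\<^sub>C x"
    "c *\<^sub>C d *\<^sub>C x = (c * d) *\<^sub>C x" "r *\<^sub>R x = complex_of_real r *\<^sub>C x"
    by (auto intro!: ell2_eqI simp: nth scaleR_ell2_def algebra_simps)
  show "r *\<^sub>R (x + y) = r *\<^sub>R x + r *\<^sub>R y" "(r + s) *\<^sub>R x = r *\<^sub>R x + s *\<^sub>R x"
    "r *\<^sub>R s *\<^sub>R x = (r * s) *\<^sub>R x" "1 *\<^sub>R x = x"
    by (auto intro!: ell2_eqI simp: nth scaleR_ell2_def algebra_simps)
  have commute: "cinner u v = cnj (cinner v u)" for u v :: ell2
  proof -
    have "(\<lambda>i. cnj (ell2_nth v i * cnj (ell2_nth u i))) sums cnj (cinner v u)"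
      unfolding cinner_ell2_def sums_cnj by (intro summable_sums summable_cinner_ell2)
    then show ?thesis
      by (simp add: cinner_ell2_def sums_iff mult.commute)
  qed
  then show "cinner x y = cnj (cinner y x)" .
  show add: "cinner (x + y) z = cinner x z + cinner y z"
    unfolding cinner_ell2_def
    by (subst suminf_add) (auto intro: summable_cinner_ell2 simp: nth algebra_simps)
  show scale: "cinner (c *\<^sub>C x) y = c * cinner x y" for c
    unfolding cinner_ell2_def
    by (subst suminf_mult[symmetric]) (auto intro: summable_cinner_ell2 simp: nth algebra_simps)
  show "inner x y = Re (cinner x y)"
    by (simp add: inner_ell2_def)
  show "inner x y = inner y x"
    unfolding inner_ell2_def by (subst commute) simp
  show "inner (x + y) z = inner x z + inner y z"
    by (simp add: inner_ell2_def add)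
  show "inner (r *\<^sub>R x) y = r * inner x y"
    by (simp add: inner_ell2_def scaleR_ell2_def scale)
  have summ: "summable (\<lambda>i. (cmod (ell2_nth x i))\<^sup>2)"
    using square_summable_nth by (simp add: square_summable_def)
  show "0 \<le> inner x x"
    using summ by (auto simp: inner_ell2_self intro: suminf_nonneg)
  show "inner x x = 0 \<longleftrightarrow> x = 0"
    using summ by (auto simp: inner_ell2_self suminf_eq_zero_iff nth intro!: ell2_eqI)
  show "norm x = sqrt (inner x x)" "dist x y = norm (x - y)" "sgn x = inverse (norm x) *\<^sub>R x"
    by (simp_all add: norm_ell2_def dist_ell2_def sgn_ell2_def)
  show "uniformity = (INF e\<in>{0<..}. principal {(x, y :: ell2). dist x y < e})"
    by (rule uniformity_ell2_def)
  show "open U \<longleftrightarrow> (\<forall>x\<in>U. \<forall>\<^sub>F (x', y) in uniformity. x' = x \<longrightarrow> y \<in> U)" for U :: "ell2 set"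
    by (rule open_ell2_def)
qed

end

lemma norm_ell2_square: "(norm x)\<^sup>2 = (\<Sum>i. (cmod (ell2_nth x i))\<^sup>2)"
  by (simp add: power2_norm_eq_inner inner_ell2_self)

lemma ell2_nth_diff: "ell2_nth (x - y) i = ell2_nth x i - ell2_nth y i"
  unfolding minus_ell2_def plus_ell2.rep_eq uminus_ell2.rep_eq by simp

lemma sum_le_norm_ell2:
  "(\<Sum>i<k. (cmod (ell2_nth x i))\<^sup>2) \<le> (norm x)\<^sup>2"
  unfolding norm_ell2_square
  using square_summable_nth by (intro sum_le_suminf) (auto simp: square_summable_def)

lemma cmod_nth_le_norm_ell2: "cmod (ell2_nth x i) \<le> norm x"
proof (rule power2_le_imp_le)
  have "(cmod (ell2_nth x i))\<^sup>2 \<le> (\<Sum>j<Suc i. (cmod (ell2_nth x j))\<^sup>2)"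
    by (rule member_le_sum) auto
  then show "(cmod (ell2_nth x i))\<^sup>2 \<le> (norm x)\<^sup>2"
    using sum_le_norm_ell2[of x "Suc i"] by linarith
qed simp

instance ell2 :: complex_hilbert
proof
  fix X :: "nat \<Rightarrow> ell2"
  assume X: "Cauchy X"
  have "Cauchy (\<lambda>n. ell2_nth (X n) i)" for i
  proof (rule metric_CauchyI)
    fix e :: real assume "e > 0"
    then obtain M where M: "\<And>m n. m \<ge> M \<Longrightarrow> n \<ge> M \<Longrightarrow> dist (X m) (X n) < e"
      using metric_CauchyD[OF X] by blast
    have "dist (ell2_nth (X m) i) (ell2_nth (X n) i) < e" if "m \<ge> M" "n \<ge> M" for m n
      using M[OF that] cmod_nth_le_norm_ell2[of "X m - X n" i]
      by (simp add: dist_norm ell2_nth_diff)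
    then show "\<exists>M. \<forall>m\<ge>M. \<forall>n\<ge>M. dist (ell2_nth (X m) i) (ell2_nth (X n) i) < e"
      by blast
  qed
  then have "\<exists>l. (\<lambda>n. ell2_nth (X n) i) \<longlonglongrightarrow> l" for i
    using Cauchy_convergent convergent_def by blast
  then obtain y where y: "\<And>i. (\<lambda>n. ell2_nth (X n) i) \<longlonglongrightarrow> y i"
    by metis
  have bound: "(\<Sum>i<k. (cmod (ell2_nth (X m) i - y i))\<^sup>2) \<le> e\<^sup>2"
    if "e > 0" and M: "\<forall>n\<ge>M. dist (X m) (X n) < e" for e m M k
  proof (rule LIMSEQ_le_const2)
    show "(\<lambda>n. \<Sum>i<k. (cmod (ell2_nth (X m) i - ell2_nth (X n) i))\<^sup>2)
        \<longlonglongrightarrow> (\<Sum>i<k. (cmod (ell2_nth (X m) i - y i))\<^sup>2)"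
      by (intro tendsto_intros y)
    have "(\<Sum>i<k. (cmod (ell2_nth (X m) i - ell2_nth (X n) i))\<^sup>2) \<le> e\<^sup>2" if "n \<ge> M" for n
    proof -
      have "(\<Sum>i<k. (cmod (ell2_nth (X m) i - ell2_nth (X n) i))\<^sup>2) \<le> (norm (X m - X n))\<^sup>2"
        using sum_le_norm_ell2[of "X m - X n" k] by (simp add: ell2_nth_diff)
      also have "\<dots> \<le> e\<^sup>2"
        using M that by (intro power_mono) (auto simp: dist_norm intro: less_imp_le)
      finally show ?thesis .
    qed
    then show "\<exists>M. \<forall>n\<ge>M. (\<Sum>i<k. (cmod (ell2_nth (X m) i - ell2_nth (X n) i))\<^sup>2) \<le> e\<^sup>2"
      by blast
  qed
  have summ: "summable (\<lambda>i. (cmod (ell2_nth (X m) i - y i))\<^sup>2)"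
    and le: "(\<Sum>i. (cmod (ell2_nth (X m) i - y i))\<^sup>2) \<le> e\<^sup>2"
    if "e > 0" and "\<forall>n\<ge>M. dist (X m) (X n) < e" for e m M
  proof -
    show *: "summable (\<lambda>i. (cmod (ell2_nth (X m) i - y i))\<^sup>2)"
      by (rule summableI_nonneg_bounded[OF _ bound[OF that]]) simp
    show "(\<Sum>i. (cmod (ell2_nth (X m) i - y i))\<^sup>2) \<le> e\<^sup>2"
      by (rule suminf_le_const[OF * bound[OF that]])
  qed
  obtain M1 where M1: "\<forall>m\<ge>M1. \<forall>n\<ge>M1. dist (X m) (X n) < 1"
    using metric_CauchyD[OF X, of 1] by auto
  have "square_summable (\<lambda>i. ell2_nth (X M1) i + (-1) * (ell2_nth (X M1) i - y i))"
    using summ[of 1 M1 M1] M1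
    by (intro square_summable_add square_summable_scale square_summable_nth)
       (auto simp: square_summable_def)
  then have "square_summable y"
    by simp
  then have nth_y: "ell2_nth (Abs_ell2 y) = y"
    by (simp add: Abs_ell2_inverse)
  have "X \<longlonglongrightarrow> Abs_ell2 y"
  proof (rule metric_LIMSEQ_I)
    fix e :: real assume "e > 0"
    then obtain M where M: "\<forall>m\<ge>M. \<forall>n\<ge>M. dist (X m) (X n) < e / 2"
      using metric_CauchyD[OF X, of "e / 2"] by auto
    have "dist (X m) (Abs_ell2 y) < e" if "m \<ge> M" for m
    proof -
      have "(norm (X m - Abs_ell2 y))\<^sup>2 \<le> (e / 2)\<^sup>2"
        unfolding norm_ell2_square ell2_nth_diff nth_y
        using M that \<open>e > 0\<close> by (intro le[of _ M]) auto
      then have "norm (X m - Abs_ell2 y) \<le> e / 2"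
        by (rule power2_le_imp_le) (use \<open>e > 0\<close> in simp)
      then show ?thesis
        using \<open>e > 0\<close> by (simp add: dist_norm)
    qed
    then show "\<exists>M. \<forall>m\<ge>M. dist (X m) (Abs_ell2 y) < e"
      by blast
  qed
  then show "convergent X"
    by (auto simp: convergent_def)
qed

text \<open>The closed subspace of sequences supported in \<open>I\<close>, a model of \<open>\<ell>\<^sup>2(I)\<close>.\<close>

definition ell2_on :: "nat set \<Rightarrow> ell2 set" where
  "ell2_on I = {x. \<forall>i. i \<notin> I \<longrightarrow> ell2_nth x i = 0}"


section \<open>Operators on closed subspaces\<close>

text \<open>
  A Hilbert space is represented by a closed complex subspace \<open>H\<close> of a type of class
  \<^class>\<open>complex_hilbert\<close>, and an operator on it by a function of which only the values on
  \<open>H\<close> matter.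
\<close>

definition linear_op :: "'a::complex_hilbert set \<Rightarrow> 'b::complex_hilbert set \<Rightarrow> ('a \<Rightarrow> 'b) \<Rightarrow> bool" where
  "linear_op H K T \<longleftrightarrow> T ` H \<subseteq> K \<and> (\<forall>x\<in>H. \<forall>y\<in>H. T (x + y) = T x + T y) \<and>
     (\<forall>x\<in>H. \<forall>c. T (c *\<^sub>C x) = c *\<^sub>C T x)"

definition contraction_op :: "'a::complex_hilbert set \<Rightarrow> ('a \<Rightarrow> 'a) \<Rightarrow> bool" where
  "contraction_op H T \<longleftrightarrow> linear_op H H T \<and> (\<forall>x\<in>H. norm (T x) \<le> norm x)"

definition unitary_op :: "'a::complex_hilbert set \<Rightarrow> 'b::complex_hilbert set \<Rightarrow> ('a \<Rightarrow> 'b) \<Rightarrow> bool" where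
  "unitary_op H K U \<longleftrightarrow> linear_op H K U \<and> U ` H = K \<and>
     (\<forall>x\<in>H. \<forall>y\<in>H. cinner (U x) (U y) = cinner x y)"

definition adjoint_op :: "'a::complex_hilbert set \<Rightarrow> ('a \<Rightarrow> 'a) \<Rightarrow> 'a \<Rightarrow> 'a" where
  "adjoint_op H T y = (THE z. z \<in> H \<and> (\<forall>x\<in>H. cinner (T x) y = cinner x z))"

text \<open>The positive square root; it is set to \<open>0\<close> off \<open>H\<close> to make it unique as a function.\<close>

definition sqrt_op :: "'a::complex_hilbert set \<Rightarrow> ('a \<Rightarrow> 'a) \<Rightarrow> 'a \<Rightarrow> 'a" where
  "sqrt_op H A = (THE R. linear_op H H R \<and> (\<exists>C. \<forall>x\<in>H. norm (R x) \<le> C * norm x) \<and>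
     (\<forall>x\<in>H. cinner (R x) x \<in> \<real>\<^sub>\<ge>\<^sub>0) \<and> (\<forall>x\<in>H. R (R x) = A x) \<and> (\<forall>x. x \<notin> H \<longrightarrow> R x = 0))"

definition defect_op :: "'a::complex_hilbert set \<Rightarrow> ('a \<Rightarrow> 'a) \<Rightarrow> 'a \<Rightarrow> 'a" where
  "defect_op H T = sqrt_op H (\<lambda>x. x - adjoint_op H T (T x))"

definition defect_op_adj :: "'a::complex_hilbert set \<Rightarrow> ('a \<Rightarrow> 'a) \<Rightarrow> 'a \<Rightarrow> 'a" where
  "defect_op_adj H T = sqrt_op H (\<lambda>x. x - T (adjoint_op H T x))"

definition defect_space :: "'a::complex_hilbert set \<Rightarrow> ('a \<Rightarrow> 'a) \<Rightarrow> 'a set" where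
  "defect_space H T = closure (defect_op H T ` H)"

definition defect_space_adj :: "'a::complex_hilbert set \<Rightarrow> ('a \<Rightarrow> 'a) \<Rightarrow> 'a set" where
  "defect_space_adj H T = closure (defect_op_adj H T ` H)"

definition rank_one_defects :: "'a::complex_hilbert set \<Rightarrow> ('a \<Rightarrow> 'a) \<Rightarrow> bool" where
  "rank_one_defects H T \<longleftrightarrow>
     complex_vector.dim (defect_space H T) = 1 \<and> complex_vector.dim (defect_space_adj H T) = 1"

definition completely_nonunitary :: "'a::complex_hilbert set \<Rightarrow> ('a \<Rightarrow> 'a) \<Rightarrow> bool" where
  "completely_nonunitary H T \<longleftrightarrow>
     \<not> (\<exists>M. complex_vector.subspace M \<and> closed M \<and> M \<subseteq> H \<and> M \<noteq> {0} \<and>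
          T ` M \<subseteq> M \<and> adjoint_op H T ` M \<subseteq> M \<and> unitary_op M M T)"

definition char_fun :: "'a::complex_hilbert set \<Rightarrow> ('a \<Rightarrow> 'a) \<Rightarrow> complex \<Rightarrow> 'a \<Rightarrow> 'a" where
  "char_fun H T z x =
     - T x + z *\<^sub>C defect_op_adj H T (inv_into H (\<lambda>y. y - z *\<^sub>C adjoint_op H T y) (defect_op H T x))"

definition char_fun_agrees :: "'a::complex_hilbert set \<Rightarrow> ('a \<Rightarrow> 'a) \<Rightarrow> (complex \<Rightarrow> complex) \<Rightarrow> bool" where
  "char_fun_agrees H T g \<longleftrightarrow>
     (\<exists>(W :: complex \<Rightarrow> 'a) (V :: 'a \<Rightarrow> complex).
        unitary_op UNIV (defect_space H T) W \<and> unitary_op (defect_space_adj H T) UNIV V \<and>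
        (\<forall>z\<in>ball 0 1. \<forall>c. V (char_fun H T z (W c)) = g z * c))"


section \<open>Operators given by matrices\<close>

text \<open>\<open>y\<close> is the product of the matrix \<open>A\<close>, indexed by \<open>I \<times> I\<close>, and the vector \<open>x\<close>.\<close>

definition matrix_maps :: "nat set \<Rightarrow> (nat \<Rightarrow> nat \<Rightarrow> complex) \<Rightarrow> ell2 \<Rightarrow> ell2 \<Rightarrow> bool" where
  "matrix_maps I A x y \<longleftrightarrow>
     y \<in> ell2_on I \<and> (\<forall>i\<in>I. ((\<lambda>j. A i j * ell2_nth x j) has_sum ell2_nth y i) I)"

definition defines_matrix_op :: "nat set \<Rightarrow> (nat \<Rightarrow> nat \<Rightarrow> complex) \<Rightarrow> bool" where
  "defines_matrix_op I A \<longleftrightarrow> (\<forall>x\<in>ell2_on I. \<exists>y. matrix_maps I A x y)"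

definition matrix_op :: "nat set \<Rightarrow> (nat \<Rightarrow> nat \<Rightarrow> complex) \<Rightarrow> ell2 \<Rightarrow> ell2" where
  "matrix_op I A x = (THE y. matrix_maps I A x y)"


section \<open>Truncated CMV matrices\<close>

text \<open>
  Matrices are indexed from \<open>1\<close>, and a matrix of size \<open>N \<le> \<infinity>\<close> is a function on
  \<open>\<nat> \<times> \<nat>\<close> that vanishes outside \<open>cmv_index N \<times> cmv_index N\<close>.
\<close>

definition cmv_index :: "enat \<Rightarrow> nat set" where
  "cmv_index N = {i. 1 \<le> i \<and> enat i \<le> N}"

definition rho :: "(nat \<Rightarrow> complex) \<Rightarrow> nat \<Rightarrow> complex" where
  "rho \<alpha> n = complex_of_real (sqrt (1 - (cmod (\<alpha> n))\<^sup>2))"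

definition trunc_cmv :: "enat \<Rightarrow> (nat \<Rightarrow> complex) \<Rightarrow> nat \<Rightarrow> nat \<Rightarrow> complex" where
  "trunc_cmv N \<alpha> i j =
    (if i \<notin> cmv_index N \<or> j \<notin> cmv_index N then 0
     else if i = j then - cnj (\<alpha> j) * \<alpha> (j - 1)
     else if i = j + 1 then (if odd j then cnj (\<alpha> (j + 1)) * rho \<alpha> j else - \<alpha> (j - 1) * rho \<alpha> j)
     else if j = i + 1 then (if odd i then - \<alpha> (i - 1) * rho \<alpha> i else cnj (\<alpha> (i + 1)) * rho \<alpha> i)
     else if i = j + 2 \<and> odd j then rho \<alpha> j * rho \<alpha> (j + 1)
     else if j = i + 2 \<and> even i then rho \<alpha> i * rho \<alpha> (i + 1)
     else 0)"

definition trunc_cmv_transpose :: "enat \<Rightarrow> (nat \<Rightarrow> complex) \<Rightarrow> nat \<Rightarrow> nat \<Rightarrow> complex" where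
  "trunc_cmv_transpose N \<alpha> i j = trunc_cmv N \<alpha> j i"

definition delete_first :: "nat \<Rightarrow> (nat \<Rightarrow> nat \<Rightarrow> complex) \<Rightarrow> nat \<Rightarrow> nat \<Rightarrow> complex" where
  "delete_first k A i j = (if 1 \<le> i \<and> 1 \<le> j then A (i + k) (j + k) else 0)"


section \<open>Measures on the unit circle\<close>

definition circle_measure :: "complex measure \<Rightarrow> bool" where
  "circle_measure \<mu> \<longleftrightarrow> prob_space \<mu> \<and> sets \<mu> = sets (restrict_space borel (sphere 0 1))"

definition measure_support :: "complex measure \<Rightarrow> complex set" where
  "measure_support \<mu> = {\<zeta>\<in>space \<mu>. \<forall>U. open U \<longrightarrow> \<zeta> \<in> U \<longrightarrow> emeasure \<mu> (U \<inter> space \<mu>) > 0}"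

text \<open>The index \<open>N\<close> of the last Verblunsky coefficient; \<open>\<mu>\<close> is then supported on \<open>N + 1\<close> points.\<close>

definition verblunsky_last :: "complex measure \<Rightarrow> enat" where
  "verblunsky_last \<mu> =
     (if finite (measure_support \<mu>) then enat (card (measure_support \<mu>) - 1) else \<infinity>)"

definition orthogonal_poly :: "complex measure \<Rightarrow> nat \<Rightarrow> complex poly" where
  "orthogonal_poly \<mu> n = (THE p. degree p = n \<and> lead_coeff p = 1 \<and>
     (\<forall>k<n. (LINT \<zeta>|\<mu>. poly p \<zeta> * cnj (\<zeta> ^ k)) = 0))"

text \<open>Meaningful for \<open>enat n \<le> verblunsky_last \<mu>\<close> only.\<close>

definition verblunsky :: "complex measure \<Rightarrow> nat \<Rightarrow> complex" where
  "verblunsky \<mu> n = - cnj (poly (orthogonal_poly \<mu> (Suc n)) 0)"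

definition caratheodory_fun :: "complex measure \<Rightarrow> complex \<Rightarrow> complex" where
  "caratheodory_fun \<mu> z = (LINT \<zeta>|\<mu>. (\<zeta> + z) / (\<zeta> - z))"

text \<open>
  The defining quotients of the Schur function and of its iterates have a removable singularity
  at \<open>0\<close>, where division by zero would yield the value \<open>0\<close>.
\<close>

definition schur_fun :: "complex measure \<Rightarrow> complex \<Rightarrow> complex" where
  "schur_fun \<mu> =
     remove_sings (\<lambda>z. 1 / z * ((caratheodory_fun \<mu> z - 1) / (caratheodory_fun \<mu> z + 1)))"

fun schur_iterate :: "(complex \<Rightarrow> complex) \<Rightarrow> nat \<Rightarrow> complex \<Rightarrow> complex" where
  "schur_iterate f 0 = f"
| "schur_iterate f (Suc n) =
     remove_sings (\<lambda>z. (schur_iterate f n z - schur_iterate f n 0) /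
       (z * (1 - cnj (schur_iterate f n 0) * schur_iterate f n z)))"

end

theory Submission
  imports Defs
begin

text \<open>
  Let \<open>\<Theta>\<^sub>n\<close> be the unitary matrix with rows \<open>(cnj \<alpha>\<^sub>n, \<rho>\<^sub>n)\<close> and \<open>(\<rho>\<^sub>n, - \<alpha>\<^sub>n)\<close>. A truncated CMV matrix
  is a product \<open>L' M'\<close> with \<open>M' = \<Theta>\<^sub>1 \<oplus> \<Theta>\<^sub>3 \<oplus> \<dots>\<close> unitary and \<open>L' = (- \<alpha>\<^sub>0) \<oplus> \<Theta>\<^sub>2 \<oplus> \<Theta>\<^sub>4 \<oplus> \<dots>\<close> unitary up to
  its first entry; the transpose is \<open>M' L'\<close>. Deleting the first \<open>k\<close> rows and columns shifts the
  coefficients by \<open>k\<close>, and it exchanges the two orders of the factors when \<open>k\<close> is odd because the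
  entries depend on the parity of their position. It thus suffices to treat both products for a
  sequence \<open>\<beta>\<^sub>n = \<alpha>\<^sub>n\<^sub>+\<^sub>k\<close> with \<open>\<bar>\<beta>\<^sub>0\<bar> < 1\<close>. Both have the form \<open>T = A L' B\<close>, where one of the unitary
  operators \<open>A\<close>, \<open>B\<close> is \<open>M'\<close> and the other one is the identity.

  \<^item> The defects of \<open>T\<close> are those of \<open>L'\<close>, moved by the unitary factors:
    \<open>I - T\<^sup>* T = \<rho>\<^sub>0\<^sup>2 \<langle>\<cdot>, a\<rangle> a\<close> and \<open>I - T T\<^sup>* = \<rho>\<^sub>0\<^sup>2 \<langle>\<cdot>, b\<rangle> b\<close> with \<open>a = B\<^sup>* e\<^sub>1\<close> and \<open>b = A e\<^sub>1\<close>
    (\<open>rank_one_defect_pair_trunc_op\<close>). Square roots of such operators are explicit, which gives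
    the defect spaces and reduces the characteristic function to
    \<open>\<beta>\<^sub>0 + z \<rho>\<^sub>0\<^sup>2 \<langle>(I - z T\<^sup>*)\<^sup>-\<^sup>1 a, b\<rangle>\<close> (\<open>char_fun_agreesI\<close>).
  \<^item> A subspace on which \<open>T\<close> is unitary is orthogonal to \<open>a\<close> and \<open>b\<close>. As it is invariant under \<open>T\<close> and
    \<open>T\<^sup>*\<close>, the blocks propagate the vanishing of the first coordinate to all the others
    (\<open>completely_nonunitary_aux\<close>).
  \<^item> For the resolvent one has to solve \<open>M' y = z L'\<^sup>* y + e\<^sub>1\<close>; then \<open>\<langle>(I - z T\<^sup>*)\<^sup>-\<^sup>1 a, b\<rangle> = y\<^sub>1\<close>,
    whatever the order of the factors. For \<open>z \<noteq> 0\<close>, any numbers \<open>g\<^sub>n\<close> in the closed disk that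
    obey the Schur recursion with parameters \<open>\<beta>\<^sub>n\<close> at the point \<open>z\<close> yield a square summable solution
    in closed form, and it shows that the characteristic function at \<open>z\<close> is \<open>g\<^sub>0\<close>
    (\<open>resolvent_solution\<close>).
  \<^item> It remains to know that the values at \<open>z\<close> of the Schur iterates of \<open>f\<close> are such numbers, i.e. that
    the Schur parameters of \<open>f\<close> are the Verblunsky coefficients. This theorem of Geronimus holds
    because the Cauchy transforms \<open>P\<^sub>n\<close>, \<open>Q\<^sub>n\<close> of \<open>\<Phi>\<^sub>n\<close>, \<open>\<Phi>\<^sub>n\<^sup>*\<close> inherit the Szego recursion, which is the
    Schur algorithm for \<open>Q\<^sub>n / (z P\<^sub>n)\<close>, and because orthogonality fixes the leading coefficients of
    \<open>P\<^sub>n\<close> and \<open>Q\<^sub>n\<close> at \<open>0\<close> (\<open>quotient_at_0\<close>, \<open>schur_iterate_step\<close>). The iterates stay in the closed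
    disk by the Schwarz lemma.
\<close>

section \<open>Operators whose defects have rank one\<close>

lemma cinner_add_right: "cinner x (y + z) = cinner x y + cinner x z"
  by (metis cinner_add_left cinner_commute complex_cnj_add)

lemma cinner_scaleC_right: "cinner x (c *\<^sub>C y) = cnj c * cinner x y"
  by (metis cinner_commute cinner_scaleC_left complex_cnj_mult)

lemma cinner_minus_left: "cinner (- x) y = - cinner x y"
  using cinner_scaleC_left[of "-1" x y] by simp

lemma cinner_diff_left: "cinner (x - y) z = cinner x z - cinner y z"
  using cinner_add_left[of x "- y" z] by (simp add: cinner_minus_left)

lemma cinner_diff_right: "cinner x (y - z) = cinner x y - cinner x z"
  by (metis cinner_diff_left cinner_commute complex_cnj_diff)

lemma cinner_zero [simp]: "cinner 0 x = 0" "cinner x 0 = 0"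
  using cinner_diff_left[of x x x] cinner_diff_right[of x x x] by simp_all

lemma cinner_self: "cinner x x = complex_of_real ((norm x)\<^sup>2)"
proof -
  have "Im (cinner x x) = 0"
    by (metis cinner_commute cnj.sel(2) equal_neg_zero)
  then show ?thesis
    by (simp add: complex_eq_iff power2_norm_eq_inner inner_eq_Re_cinner)
qed

lemma cinner_self_eq_0 [simp]: "cinner x x = 0 \<longleftrightarrow> x = 0"
  by (simp add: cinner_self)

lemma norm_scaleC [simp]: "norm (c *\<^sub>C x) = cmod c * norm x"
proof -
  have "complex_of_real ((norm (c *\<^sub>C x))\<^sup>2) = (c * cnj c) * cinner x x"
    by (simp only: cinner_self[symmetric] cinner_scaleC_left cinner_scaleC_right mult_ac)
  also have "\<dots> = complex_of_real ((cmod c * norm x)\<^sup>2)"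
    by (simp add: cinner_self complex_norm_square[symmetric] power_mult_distrib)
  finally have "(norm (c *\<^sub>C x))\<^sup>2 = (cmod c * norm x)\<^sup>2"
    using of_real_eq_iff by blast
  then show ?thesis
    by (rule power2_eq_imp_eq) auto
qed

lemma cmod_cinner_le: "cmod (cinner x y) \<le> norm x * norm y"
proof (cases "cinner x y = 0")
  case False
  define c where "c = cnj (cinner x y) / cmod (cinner x y)"
  have c: "cmod c = 1"
    using False by (simp add: c_def norm_divide)
  have "c * cinner x y = complex_of_real (cmod (cinner x y))"
    using False complex_norm_square[of "cinner x y"]
    by (simp add: c_def field_simps power2_eq_square)
  then have "inner (c *\<^sub>C x) y = cmod (cinner x y)"
    by (simp add: inner_eq_Re_cinner cinner_scaleC_left)
  then show ?thesis
    using norm_cauchy_schwarz[of "c *\<^sub>C x" y] c by simp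
qed simp

lemma linear_opD:
  assumes "linear_op H K T"
  shows "x \<in> H \<Longrightarrow> T x \<in> K" "x \<in> H \<Longrightarrow> y \<in> H \<Longrightarrow> T (x + y) = T x + T y"
    "x \<in> H \<Longrightarrow> T (c *\<^sub>C x) = c *\<^sub>C T x"
  using assms by (auto simp: linear_op_def)

lemma linear_op_diff:
  assumes "linear_op H K T" "complex_vector.subspace H" "x \<in> H" "y \<in> H"
  shows "T (x - y) = T x - T y"
proof -
  have "T (x + (-1) *\<^sub>C y) = T x + (-1) *\<^sub>C T y"
    using assms by (metis complex_vector.subspace_scale linear_opD(2,3))
  then show ?thesis
    by simp
qed

lemma adjoint_op_eqI:
  assumes H: "complex_vector.subspace H" and "z \<in> H"
    and adj: "\<And>x. x \<in> H \<Longrightarrow> cinner (T x) y = cinner x z"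
  shows "adjoint_op H T y = z"
  unfolding adjoint_op_def
proof (rule the_equality)
  fix z' assume z': "z' \<in> H \<and> (\<forall>x\<in>H. cinner (T x) y = cinner x z')"
  then have "cinner (z' - z) (z' - z) = 0"
    using adj complex_vector.subspace_diff[OF H, of z' z] \<open>z \<in> H\<close>
    by (metis cinner_diff_right eq_iff_diff_eq_0)
  then show "z' = z"
    by simp
qed (use assms in auto)

text \<open>
  A positive square root \<open>R\<close> of \<open>r\<^sup>2 \<langle>\<cdot>, a\<rangle> a\<close> is symmetric, so \<open>\<parallel>R x\<parallel>\<^sup>2 = \<langle>R\<^sup>2 x, x\<rangle>\<close> vanishes
  for \<open>x\<close> orthogonal to \<open>a\<close>. Symmetry then also makes \<open>R a\<close> a multiple of \<open>a\<close>, and the multiple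
  is the nonnegative square root of \<open>r\<^sup>2\<close>.
\<close>

lemma positive_sqrt_rank_one_unique:
  assumes H: "complex_vector.subspace H" and a: "a \<in> H" "norm a = 1" and "r \<ge> 0"
    and R: "linear_op H H R" and pos: "\<And>x. x \<in> H \<Longrightarrow> cinner (R x) x \<in> \<real>\<^sub>\<ge>\<^sub>0"
    and R2: "\<And>x. x \<in> H \<Longrightarrow> R (R x) = (complex_of_real (r\<^sup>2) * cinner x a) *\<^sub>C a"
    and "x \<in> H"
  shows "R x = (complex_of_real r * cinner x a) *\<^sub>C a"
proof -
  note RH = linear_opD(1)[OF R] and R_add = linear_opD(2)[OF R] and R_scale = linear_opD(3)[OF R]
  note scaleH = complex_vector.subspace_scale[OF H] and addH = complex_vector.subspace_add[OF H]
    and diffH = complex_vector.subspace_diff[OF H]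
  have aa: "cinner a a = 1"
    using a by (simp add: cinner_self)
  have real: "Im (cinner (R x) x) = 0" if "x \<in> H" for x
    using pos[OF that] by (auto simp: complex_nonneg_Reals_iff)
  have sym: "cinner (R x) y = cinner x (R y)" if "x \<in> H" "y \<in> H" for x y
  proof -
    have "Im (cinner (R (x + y)) (x + y)) = 0"
      using that by (intro real addH)
    then have 1: "Im (cinner (R x) y) + Im (cinner (R y) x) = 0"
      using that real by (simp add: R_add cinner_add_left cinner_add_right)
    have "Im (cinner (R (x + \<i> *\<^sub>C y)) (x + \<i> *\<^sub>C y)) = 0"
      using that by (intro real addH scaleH)
    then have 2: "Re (cinner (R y) x) = Re (cinner (R x) y)"
      using that real scaleH[of y \<i>]
      by (simp add: R_add R_scale cinner_add_left cinner_add_right cinner_scaleC_left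
          cinner_scaleC_right)
    have "cinner (R x) y = cnj (cinner (R y) x)"
      using 1 2 by (simp add: complex_eq_iff)
    then show ?thesis
      by (metis cinner_commute)
  qed
  have R0: "R y = 0" if "y \<in> H" "cinner y a = 0" for y
  proof -
    have "cinner (R y) (R y) = cinner (R (R y)) y"
      using sym[of "R y" y] RH that by simp
    also have "\<dots> = 0"
      using that R2 by (simp add: complex_vector.scale_zero_left)
    finally show ?thesis
      by simp
  qed
  have Rx: "R x = cinner x a *\<^sub>C R a" if "x \<in> H" for x
  proof -
    have "R (x - cinner x a *\<^sub>C a) = 0"
      using that a by (intro R0 diffH scaleH) (auto simp: cinner_diff_left cinner_scaleC_left aa)
    then show ?thesis
      using that a by (simp add: linear_op_diff[OF R H] scaleH R_scale)
  qed
  define t where "t = cinner (R a) a"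
  define w where "w = R a - t *\<^sub>C a"
  have w: "w \<in> H" "cinner w a = 0"
    using a by (auto simp: w_def t_def RH scaleH diffH cinner_diff_left cinner_scaleC_left aa)
  have "cinner w w = cinner (R a) w - t * cinner a w"
    by (simp add: w_def cinner_diff_left cinner_scaleC_left)
  also have "\<dots> = 0"
    using sym[of a w] a w R0[OF w] cinner_commute[of a w] by simp
  finally have Ra: "R a = t *\<^sub>C a"
    by (simp add: w_def)
  have t: "t \<in> \<real>\<^sub>\<ge>\<^sub>0"
    using pos a by (simp add: t_def)
  have "R (R a) = (t * t) *\<^sub>C a"
    using a by (simp add: Ra R_scale scaleC_scaleC)
  then have "(t * t) *\<^sub>C a = (complex_of_real (r\<^sup>2)) *\<^sub>C a"
    using R2[OF a(1)] by (simp only: aa mult_1_right)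
  then have "t * t = complex_of_real (r\<^sup>2)"
    using a(2) by (metis complex_vector.scale_right_imp_eq norm_zero zero_neq_one)
  moreover obtain s where s: "t = complex_of_real s" "s \<ge> 0"
    using t by (metis nonneg_Reals_cases)
  ultimately have "s * s = r * r"
    by (metis of_real_eq_iff of_real_mult power2_eq_square)
  then have "s = r"
    using s \<open>r \<ge> 0\<close> by (metis abs_of_nonneg real_sqrt_mult_self real_sqrt_abs2)
  then show ?thesis
    using Rx[OF \<open>x \<in> H\<close>] s by (simp add: Ra scaleC_scaleC mult.commute)
qed

lemma sqrt_op_rank_one:
  assumes H: "complex_vector.subspace H" and a: "a \<in> H" "norm a = 1" and r: "r \<ge> 0"
    and A: "\<And>x. x \<in> H \<Longrightarrow> A x = (complex_of_real (r\<^sup>2) * cinner x a) *\<^sub>C a"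
    and x: "x \<in> H"
  shows "sqrt_op H A x = (complex_of_real r * cinner x a) *\<^sub>C a"
proof -
  define R where "R x = (if x \<in> H then (complex_of_real r * cinner x a) *\<^sub>C a else 0)" for x
  note scaleH = complex_vector.subspace_scale[OF H] and addH = complex_vector.subspace_add[OF H]
  have aa: "cinner a a = 1"
    using a by (simp add: cinner_self)
  have "sqrt_op H A = R"
    unfolding sqrt_op_def
  proof (rule the_equality, intro conjI)
    show "linear_op H H R"
      by (auto simp: linear_op_def R_def scaleH addH a cinner_add_left cinner_scaleC_left
          distrib_left scaleC_add_left scaleC_scaleC algebra_simps)
    have "norm (R y) \<le> r * norm y" if "y \<in> H" for y
      using that cmod_cinner_le[of y a] a r by (simp add: R_def norm_mult mult_left_mono)
    then show "\<exists>C. \<forall>y\<in>H. norm (R y) \<le> C * norm y"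
      by blast
    show "\<forall>y\<in>H. cinner (R y) y \<in> \<real>\<^sub>\<ge>\<^sub>0"
    proof
      fix y assume "y \<in> H"
      then have "cinner (R y) y = complex_of_real r * (cinner y a * cnj (cinner y a))"
        by (simp add: R_def cinner_scaleC_left cinner_commute[of a y])
      also have "\<dots> = complex_of_real (r * (cmod (cinner y a))\<^sup>2)"
        by (simp only: complex_norm_square of_real_mult)
      finally show "cinner (R y) y \<in> \<real>\<^sub>\<ge>\<^sub>0"
        using r by (simp only: nonneg_Reals_of_real_iff mult_nonneg_nonneg zero_le_power2)
    qed
    show "\<forall>y\<in>H. R (R y) = A y"
      using a by (auto simp: R_def A scaleH cinner_scaleC_left aa power2_eq_square mult.assoc)
    show "\<forall>y. y \<notin> H \<longrightarrow> R y = 0"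
      by (simp add: R_def)
  next
    fix R' assume "linear_op H H R' \<and> (\<exists>C. \<forall>x\<in>H. norm (R' x) \<le> C * norm x) \<and>
      (\<forall>x\<in>H. cinner (R' x) x \<in> \<real>\<^sub>\<ge>\<^sub>0) \<and> (\<forall>x\<in>H. R' (R' x) = A x) \<and> (\<forall>x. x \<notin> H \<longrightarrow> R' x = 0)"
    then show "R' = R"
      using positive_sqrt_rank_one_unique[OF H a r, of R'] A by (auto simp: R_def fun_eq_iff)
  qed
  then show ?thesis
    using x by (simp add: R_def)
qed

text \<open>The span of a unit vector \<open>a\<close> is the fixed point set of the continuous map \<open>y \<mapsto> \<langle>y, a\<rangle> a\<close>.\<close>

lemma closed_span_unit_vector:
  fixes a :: "'a::complex_hilbert"
  assumes "norm a = 1"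
  shows "closed (range (\<lambda>c. c *\<^sub>C a))"
proof -
  have aa: "cinner a a = 1"
    using assms by (simp add: cinner_self)
  have "range (\<lambda>c. c *\<^sub>C a) = {y. norm (y - cinner y a *\<^sub>C a) = 0}"
  proof safe
    fix c
    show "norm (c *\<^sub>C a - cinner (c *\<^sub>C a) a *\<^sub>C a) = 0"
      by (simp add: cinner_scaleC_left aa)
  qed (metis eq_iff_diff_eq_0 norm_eq_zero rangeI)
  moreover have "continuous_on UNIV (\<lambda>y. y - cinner y a *\<^sub>C a)"
  proof (rule continuous_at_imp_continuous_on, safe)
    fix y
    show "isCont (\<lambda>y. y - cinner y a *\<^sub>C a) y"
    proof (rule bounded_linear.isCont[OF _ continuous_ident])
      show "bounded_linear (\<lambda>y. y - cinner y a *\<^sub>C a)"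
      proof (rule bounded_linear_intro[where K = 2])
        fix x y :: 'a and s :: real
        show "x + y - cinner (x + y) a *\<^sub>C a = x - cinner x a *\<^sub>C a + (y - cinner y a *\<^sub>C a)"
          by (simp add: cinner_add_left scaleC_add_left)
        show "s *\<^sub>R x - cinner (s *\<^sub>R x) a *\<^sub>C a = s *\<^sub>R (x - cinner x a *\<^sub>C a)"
          by (simp add: scaleR_scaleC cinner_scaleC_left complex_vector.scale_right_diff_distrib
              scaleC_scaleC)
        show "norm (x - cinner x a *\<^sub>C a) \<le> norm x * 2"
          using norm_triangle_ineq4[of x "cinner x a *\<^sub>C a"] cmod_cinner_le[of x a] assms by simp
      qed
    qed
  qed
  then have "closed {y. norm (y - cinner y a *\<^sub>C a) = 0}"
    by (intro closed_Collect_eq continuous_on_norm continuous_on_const)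
  ultimately show ?thesis
    by simp
qed

lemma dim_span_unit_vector:
  assumes "norm (a :: 'a::complex_hilbert) = 1"
  shows "complex_vector.dim (range (\<lambda>c. c *\<^sub>C a)) = 1"
proof -
  have "a \<noteq> 0"
    using assms by auto
  then have "complex_vector.independent {a}"
    by (simp add: complex_vector.dependent_single)
  then show ?thesis
    using complex_vector.dim_eq_card_independent[of "{a}"] complex_vector.dim_span[of "{a}"]
    by (simp add: complex_vector.span_singleton)
qed

text \<open>
  The adjoint is a parameter \<open>S\<close> of the locale, so that it can be supplied by a formula.
\<close>

locale rank_one_defect_pair =
  fixes H :: "'a::complex_hilbert set" and T S :: "'a \<Rightarrow> 'a" and r :: real and a b :: 'a
  assumes H: "complex_vector.subspace H"
    and T: "linear_op H H T" and S: "linear_op H H S"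
    and adj: "\<And>x y. x \<in> H \<Longrightarrow> y \<in> H \<Longrightarrow> cinner (T x) y = cinner x (S y)"
    and r: "r > 0" and a: "a \<in> H" "norm a = 1" and b: "b \<in> H" "norm b = 1"
    and ST: "\<And>x. x \<in> H \<Longrightarrow> x - S (T x) = (complex_of_real (r\<^sup>2) * cinner x a) *\<^sub>C a"
    and TS: "\<And>x. x \<in> H \<Longrightarrow> x - T (S x) = (complex_of_real (r\<^sup>2) * cinner x b) *\<^sub>C b"
begin

lemmas TH = linear_opD(1)[OF T] and SH = linear_opD(1)[OF S]

lemma aa: "cinner a a = 1" and bb: "cinner b b = 1"
  using a b by (simp_all add: cinner_self)

lemma adj': "x \<in> H \<Longrightarrow> y \<in> H \<Longrightarrow> cinner (S x) y = cinner x (T y)"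
  by (metis adj cinner_commute)

lemma adjoint_op_eq: "y \<in> H \<Longrightarrow> adjoint_op H T y = S y"
  using H adj SH by (intro adjoint_op_eqI) auto

lemma norm_T: "x \<in> H \<Longrightarrow> (norm (T x))\<^sup>2 = (norm x)\<^sup>2 - r\<^sup>2 * (cmod (cinner x a))\<^sup>2"
  and norm_S: "x \<in> H \<Longrightarrow> (norm (S x))\<^sup>2 = (norm x)\<^sup>2 - r\<^sup>2 * (cmod (cinner x b))\<^sup>2"
proof -
  assume x: "x \<in> H"
  have *: "cinner ((complex_of_real (r\<^sup>2) * cinner x e) *\<^sub>C e) x =
      complex_of_real (r\<^sup>2 * (cmod (cinner x e))\<^sup>2)" for e
    using complex_norm_square[of "cinner x e"] cinner_commute[of e x] by (simp add: cinner_scaleC_left)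
  have "cinner (T x) (T x) = cinner (S (T x)) x"
    using adj'[of "T x" x] x TH by simp
  also have "\<dots> = cinner x x - cinner (x - S (T x)) x"
    by (simp add: cinner_diff_left)
  finally have "complex_of_real ((norm (T x))\<^sup>2) =
      complex_of_real ((norm x)\<^sup>2 - r\<^sup>2 * (cmod (cinner x a))\<^sup>2)"
    unfolding ST[OF x] * cinner_self by simp
  then show "(norm (T x))\<^sup>2 = (norm x)\<^sup>2 - r\<^sup>2 * (cmod (cinner x a))\<^sup>2"
    using of_real_eq_iff by blast
  have "cinner (S x) (S x) = cinner (T (S x)) x"
    using adj[of "S x" x] x SH by simp
  also have "\<dots> = cinner x x - cinner (x - T (S x)) x"
    by (simp add: cinner_diff_left)
  finally have "complex_of_real ((norm (S x))\<^sup>2) =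
      complex_of_real ((norm x)\<^sup>2 - r\<^sup>2 * (cmod (cinner x b))\<^sup>2)"
    unfolding TS[OF x] * cinner_self by simp
  then show "(norm (S x))\<^sup>2 = (norm x)\<^sup>2 - r\<^sup>2 * (cmod (cinner x b))\<^sup>2"
    using of_real_eq_iff by blast
qed

lemma contraction: "contraction_op H T"
proof -
  have "norm (T x) \<le> norm x" if "x \<in> H" for x
  proof (rule power2_le_imp_le)
    show "(norm (T x))\<^sup>2 \<le> (norm x)\<^sup>2"
      unfolding norm_T[OF that] by simp
  qed simp
  then show ?thesis
    by (simp add: contraction_op_def T)
qed

lemma norm_S_le:
  assumes "x \<in> H"
  shows "norm (S x) \<le> norm x"
proof (rule power2_le_imp_le)
  show "(norm (S x))\<^sup>2 \<le> (norm x)\<^sup>2"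
    unfolding norm_S[OF assms] by simp
qed simp

lemma defect_op_eq: "x \<in> H \<Longrightarrow> defect_op H T x = (complex_of_real r * cinner x a) *\<^sub>C a"
  unfolding defect_op_def
  using H a r ST by (intro sqrt_op_rank_one) (auto simp: adjoint_op_eq TH)

lemma defect_op_adj_eq: "x \<in> H \<Longrightarrow> defect_op_adj H T x = (complex_of_real r * cinner x b) *\<^sub>C b"
  unfolding defect_op_adj_def
  using H b r TS by (intro sqrt_op_rank_one) (auto simp: adjoint_op_eq)

lemma range_rank_one:
  assumes "e \<in> H" "norm e = 1"
  shows "(\<lambda>x. (complex_of_real r * cinner x e) *\<^sub>C e) ` H = range (\<lambda>c. c *\<^sub>C e)"
proof safe
  fix c
  have "c *\<^sub>C e = (complex_of_real r * cinner ((c / complex_of_real r) *\<^sub>C e) e) *\<^sub>C e"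
    using assms r by (simp add: cinner_scaleC_left cinner_self)
  then show "c *\<^sub>C e \<in> (\<lambda>x. (complex_of_real r * cinner x e) *\<^sub>C e) ` H"
    using assms complex_vector.subspace_scale[OF H] by blast
qed auto

lemma defect_space_eq: "defect_space H T = range (\<lambda>c. c *\<^sub>C a)"
proof -
  have "defect_op H T ` H = (\<lambda>x. (complex_of_real r * cinner x a) *\<^sub>C a) ` H"
    by (intro image_cong refl defect_op_eq)
  then show ?thesis
    by (simp only: defect_space_def range_rank_one[OF a] closure_closed closed_span_unit_vector a)
qed

lemma defect_space_adj_eq: "defect_space_adj H T = range (\<lambda>c. c *\<^sub>C b)"
proof -
  have "defect_op_adj H T ` H = (\<lambda>x. (complex_of_real r * cinner x b) *\<^sub>C b) ` H"
    by (intro image_cong refl defect_op_adj_eq)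
  then show ?thesis
    by (simp only: defect_space_adj_def range_rank_one[OF b] closure_closed closed_span_unit_vector b)
qed

lemma rank_one: "rank_one_defects H T"
  unfolding rank_one_defects_def defect_space_eq defect_space_adj_eq
  by (simp only: dim_span_unit_vector a b)

text \<open>
  Where \<open>T\<close> is isometric, \<open>\<parallel>T x\<parallel>\<^sup>2 = \<parallel>x\<parallel>\<^sup>2 - r\<^sup>2 \<bar>\<langle>x, a\<rangle>\<bar>\<^sup>2\<close> makes \<open>\<langle>x, a\<rangle>\<close> vanish. Since \<open>T\<close> maps the
  subspace onto itself, \<open>T T\<^sup>*\<close> is the identity there too, and \<open>\<langle>x, b\<rangle>\<close> vanishes as well.
\<close>

lemma reducing_unitary_orthogonal:
  assumes "M \<subseteq> H" "adjoint_op H T ` M \<subseteq> M" "unitary_op M M T" "x \<in> M"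
  shows "cinner x a = 0" "cinner x b = 0" "T x \<in> M" "S x \<in> M"
proof -
  have orth: "cinner y a = 0" if "y \<in> M" for y
  proof -
    have "cinner (T y) (T y) = cinner y y"
      using assms that by (auto simp: unitary_op_def)
    then have "(norm (T y))\<^sup>2 = (norm y)\<^sup>2"
      unfolding cinner_self using of_real_eq_iff by blast
    then show ?thesis
      using norm_T[of y] that assms r by auto
  qed
  show "cinner x a = 0"
    by (rule orth) fact
  show "T x \<in> M"
    using assms by (auto simp: unitary_op_def)
  show "S x \<in> M"
    using assms adjoint_op_eq[of x] by (metis image_subset_iff subsetD)
  have "x \<in> T ` M"
    using assms by (simp add: unitary_op_def)
  then obtain y where y: "y \<in> M" "x = T y"
    by blast
  have "S x = y"
    using ST[of y] y orth[of y] assms by auto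
  then have "(complex_of_real (r\<^sup>2) * cinner x b) *\<^sub>C b = 0"
    using TS[of x] y assms by auto
  then show "cinner x b = 0"
    using b r by (auto simp: complex_vector.scale_eq_0_iff)
qed

text \<open>
  On the unit vector \<open>a\<close> of the defect space, \<open>\<Theta>\<^sub>T(z)\<close> is \<open>- T a + z r\<^sup>2 \<langle>(I - z T\<^sup>*)\<^sup>-\<^sup>1 a, b\<rangle> b\<close>, so the
  scalar function is known once the equation \<open>x - z T\<^sup>* x = a\<close> has been solved.
\<close>

lemma char_fun_agreesI:
  assumes Ta: "T a = (- c) *\<^sub>C b"
    and sol: "\<And>z. z \<in> ball 0 1 \<Longrightarrow> \<exists>x\<in>H. x - z *\<^sub>C S x = a \<and>
      g z = c + z * complex_of_real (r\<^sup>2) * cinner x b"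
  shows "char_fun_agrees H T g"
  unfolding char_fun_agrees_def defect_space_eq defect_space_adj_eq
proof (intro exI conjI ballI allI)
  show "unitary_op UNIV (range (\<lambda>c. c *\<^sub>C a)) (\<lambda>c. c *\<^sub>C a)"
    by (auto simp: unitary_op_def linear_op_def scaleC_add_left scaleC_scaleC scaleC_complex_def
        cinner_complex_def cinner_scaleC_left cinner_scaleC_right aa)
  show "unitary_op (range (\<lambda>c. c *\<^sub>C b)) UNIV (\<lambda>y. cinner y b)"
    by (auto simp: unitary_op_def linear_op_def scaleC_complex_def cinner_add_left
        cinner_complex_def cinner_scaleC_left cinner_scaleC_right bb image_def)
  fix z :: complex and d :: complex assume z: "z \<in> ball 0 1"
  then obtain x where x: "x \<in> H" "x - z *\<^sub>C S x = a"
    and g: "g z = c + z * complex_of_real (r\<^sup>2) * cinner x b"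
    using sol by blast
  note scaleH = complex_vector.subspace_scale[OF H]
  let ?f = "\<lambda>y. y - z *\<^sub>C adjoint_op H T y"
  have inj: "inj_on ?f H"
  proof (rule inj_onI)
    fix u v assume uv: "u \<in> H" "v \<in> H" "?f u = ?f v"
    have "u - v = z *\<^sub>C S (u - v)"
      using uv by (simp add: adjoint_op_eq linear_op_diff[OF S H]
          complex_vector.scale_right_diff_distrib algebra_simps)
    then have "norm (u - v) = cmod z * norm (S (u - v))"
      by (metis norm_scaleC)
    also have "\<dots> \<le> cmod z * norm (u - v)"
      using uv complex_vector.subspace_diff[OF H] by (intro mult_left_mono norm_S_le) auto
    finally have "(1 - cmod z) * norm (u - v) \<le> 0"
      by (simp add: algebra_simps)
    moreover have "1 - cmod z > 0"
      using z by simp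
    ultimately show "u = v"
      by (simp add: mult_le_0_iff)
  qed
  let ?x = "(complex_of_real r * d) *\<^sub>C x"
  have "?f ?x = (complex_of_real r * d) *\<^sub>C (x - z *\<^sub>C S x)"
    using x(1) by (simp add: adjoint_op_eq scaleH linear_opD(3)[OF S] scaleC_scaleC
        complex_vector.scale_right_diff_distrib mult.commute)
  also have "\<dots> = defect_op H T (d *\<^sub>C a)"
    using x a by (simp add: defect_op_eq scaleH cinner_scaleC_left aa)
  finally have "inv_into H ?f (defect_op H T (d *\<^sub>C a)) = ?x"
    using inv_into_f_f[OF inj, of ?x] x scaleH by simp
  then have "char_fun H T z (d *\<^sub>C a) = - T (d *\<^sub>C a) +
      z *\<^sub>C (complex_of_real r * cinner ?x b) *\<^sub>C b"
    using x by (simp add: char_fun_def defect_op_adj_eq scaleH)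
  then show "cinner (char_fun H T z (d *\<^sub>C a)) b = g z * d"
    using a by (simp add: linear_opD(3)[OF T] Ta g cinner_add_left cinner_minus_left
        cinner_scaleC_left bb power2_eq_square algebra_simps)
qed

end

section \<open>The factors of a CMV matrix\<close>

text \<open>
  With \<open>\<Theta>\<^sub>n\<close> the symmetric unitary matrix with rows \<open>(cnj \<alpha>\<^sub>n, \<rho>\<^sub>n)\<close> and \<open>(\<rho>\<^sub>n, - \<alpha>\<^sub>n)\<close>, the value
  \<open>cmv_factor True\<close> is the direct sum \<open>\<Theta>\<^sub>0 \<oplus> \<Theta>\<^sub>2 \<oplus> \<dots>\<close> and \<open>cmv_factor False\<close> is
  \<open>1 \<oplus> \<Theta>\<^sub>1 \<oplus> \<Theta>\<^sub>3 \<oplus> \<dots>\<close>, where the block \<open>\<Theta>\<^sub>n\<close> acts on the coordinates \<open>n\<close> and \<open>n + 1\<close>. The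
  first argument is the parity of the coordinates at which a block starts.
\<close>

definition factor_diag :: "bool \<Rightarrow> (nat \<Rightarrow> complex) \<Rightarrow> nat \<Rightarrow> complex" where
  "factor_diag e \<alpha> i = (if even i = e then cnj (\<alpha> i) else if i = 0 then 1 else - \<alpha> (i - 1))"

definition factor_off :: "bool \<Rightarrow> (nat \<Rightarrow> complex) \<Rightarrow> nat \<Rightarrow> complex" where
  "factor_off e \<alpha> i = (if even i = e then rho \<alpha> i else 0)"

definition tridiag :: "(nat \<Rightarrow> complex) \<Rightarrow> (nat \<Rightarrow> complex) \<Rightarrow> (nat \<Rightarrow> complex) \<Rightarrow> nat \<Rightarrow> complex" where
  "tridiag d v x i = d i * x i + v i * x (Suc i) + (if i = 0 then 0 else v (i - 1) * x (i - 1))"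

definition cmv_factor :: "bool \<Rightarrow> (nat \<Rightarrow> complex) \<Rightarrow> ell2 \<Rightarrow> ell2" where
  "cmv_factor e \<alpha> x = Abs_ell2 (tridiag (factor_diag e \<alpha>) (factor_off e \<alpha>) (ell2_nth x))"

lemma square_summable_bounded_mult:
  assumes "square_summable x" "\<And>i. cmod (d i) \<le> 1"
  shows "square_summable (\<lambda>i. d i * x i)"
  unfolding square_summable_def
proof (rule summable_comparison_test)
  show "summable (\<lambda>i. (cmod (x i))\<^sup>2)"
    using assms by (simp add: square_summable_def)
  have "(cmod (d i * x i))\<^sup>2 \<le> (cmod (x i))\<^sup>2" for i
    using assms(2)[of i] by (auto simp: norm_mult intro!: power_mono mult_left_le_one_le)
  then show "\<exists>N. \<forall>n\<ge>N. norm ((cmod (d n * x n))\<^sup>2) \<le> (cmod (x n))\<^sup>2"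
    by simp
qed

lemma square_summable_tridiag:
  assumes "square_summable x" "\<And>i. cmod (d i) \<le> 1" "\<And>i. cmod (v i) \<le> 1"
  shows "square_summable (tridiag d v x)"
proof -
  have "square_summable (\<lambda>i. x (Suc i))"
    using assms(1) unfolding square_summable_def by (subst summable_Suc_iff)
  then have 1: "square_summable (\<lambda>i. v i * x (Suc i))"
    using assms(3) by (rule square_summable_bounded_mult)
  have "square_summable (\<lambda>i. v i * x i)"
    using assms(1,3) by (rule square_summable_bounded_mult)
  then have "summable (\<lambda>i. (cmod (v (Suc i - 1) * x (Suc i - 1)))\<^sup>2)"
    by (simp add: square_summable_def)
  then have "summable (\<lambda>i. (cmod (if i = 0 then 0 else v (i - 1) * x (i - 1)))\<^sup>2)"
    by (subst summable_Suc_iff[symmetric]) simp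
  then have 2: "square_summable (\<lambda>i. if i = 0 then 0 else v (i - 1) * x (i - 1))"
    by (simp add: square_summable_def)
  have "square_summable (\<lambda>i. d i * x i)"
    using assms(1,2) by (rule square_summable_bounded_mult)
  then show ?thesis
    using 1 2 unfolding tridiag_def by (intro square_summable_add)
qed

text \<open>
  The terms above the diagonal on one side and those below it on the other side form the same
  series up to an index shift.
\<close>

lemma suminf_tridiag_adjoint:
  assumes x: "square_summable x" and y: "square_summable y"
    and d: "\<And>i. cmod (d i) \<le> 1" and v: "\<And>i. cmod (v i) \<le> 1"
  shows "(\<Sum>i. tridiag d v x i * cnj (y i)) =
    (\<Sum>i. x i * cnj (tridiag (\<lambda>i. cnj (d i)) (\<lambda>i. cnj (v i)) y i))"
proof -
  have shift: "square_summable (\<lambda>i. u (Suc i))" if "square_summable u" for u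
    using that unfolding square_summable_def by (subst summable_Suc_iff)
  have s0: "summable (\<lambda>i. d i * x i * cnj (y i))"
    by (intro square_summable_prod square_summable_bounded_mult x y d)
  have s1: "summable (\<lambda>i. v i * x (Suc i) * cnj (y i))"
    by (intro square_summable_prod square_summable_bounded_mult x y v shift)
  have s2: "summable (\<lambda>i. v i * x i * cnj (y (Suc i)))"
    by (intro square_summable_prod square_summable_bounded_mult x y v shift)
  have sh: "(\<lambda>i. if i = 0 then 0 else f (i - 1)) sums suminf f" if "summable f"
    for f :: "nat \<Rightarrow> complex"
    using sums_Suc_iff[of "\<lambda>i. if i = 0 then 0 else f (i - 1)" "suminf f"] summable_sums[OF that]
    by simp
  let ?s0 = "\<Sum>i. d i * x i * cnj (y i)" and ?s1 = "\<Sum>i. v i * x (Suc i) * cnj (y i)"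
    and ?s2 = "\<Sum>i. v i * x i * cnj (y (Suc i))"
  have "(\<lambda>i. d i * x i * cnj (y i) + v i * x (Suc i) * cnj (y i) +
      (if i = 0 then 0 else v (i - 1) * x (i - 1) * cnj (y (Suc (i - 1))))) sums (?s0 + ?s1 + ?s2)"
    by (intro sums_add summable_sums s0 s1 sh s2)
  also have "(\<lambda>i. d i * x i * cnj (y i) + v i * x (Suc i) * cnj (y i) +
      (if i = 0 then 0 else v (i - 1) * x (i - 1) * cnj (y (Suc (i - 1))))) =
      (\<lambda>i. tridiag d v x i * cnj (y i))"
    by (auto simp: tridiag_def fun_eq_iff algebra_simps)
  finally have 1: "(\<Sum>i. tridiag d v x i * cnj (y i)) = ?s0 + ?s1 + ?s2"
    by (simp add: sums_iff)
  have "(\<lambda>i. d i * x i * cnj (y i) + v i * x i * cnj (y (Suc i)) +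
      (if i = 0 then 0 else v (i - 1) * x (Suc (i - 1)) * cnj (y (i - 1)))) sums (?s0 + ?s2 + ?s1)"
    by (intro sums_add summable_sums s0 s2 sh s1)
  also have "(\<lambda>i. d i * x i * cnj (y i) + v i * x i * cnj (y (Suc i)) +
      (if i = 0 then 0 else v (i - 1) * x (Suc (i - 1)) * cnj (y (i - 1)))) =
      (\<lambda>i. x i * cnj (tridiag (\<lambda>i. cnj (d i)) (\<lambda>i. cnj (v i)) y i))"
    by (auto simp: tridiag_def fun_eq_iff algebra_simps)
  finally show ?thesis
    using 1 by (simp add: sums_iff)
qed

lemma rho_square:
  assumes "cmod (\<alpha> n) \<le> 1"
  shows "rho \<alpha> n * rho \<alpha> n + \<alpha> n * cnj (\<alpha> n) = 1"
proof -
  have "(cmod (\<alpha> n))\<^sup>2 \<le> 1"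
    using assms by (simp add: power_le_one)
  then show ?thesis
    by (simp add: rho_def complex_norm_square[symmetric] flip: of_real_mult)
qed

lemma cmod_rho_le:
  assumes "cmod (\<alpha> n) \<le> 1"
  shows "cmod (rho \<alpha> n) \<le> 1"
proof -
  have "(cmod (\<alpha> n))\<^sup>2 \<le> 1"
    using assms by (simp add: power_le_one)
  then show ?thesis
    by (simp add: rho_def abs_if real_le_lsqrt)
qed

lemma cnj_rho [simp]: "cnj (rho \<alpha> n) = rho \<alpha> n"
  by (simp add: rho_def)

lemma rho_cnj [simp]: "rho (\<lambda>n. cnj (\<alpha> n)) n = rho \<alpha> n"
  by (simp add: rho_def)

lemma rho_eq_0_iff:
  assumes "cmod (\<alpha> n) \<le> 1"
  shows "rho \<alpha> n = 0 \<longleftrightarrow> cmod (\<alpha> n) = 1"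
proof -
  have "cmod (\<alpha> n) \<noteq> -1"
    using norm_ge_zero[of "\<alpha> n"] by linarith
  then show ?thesis
    using assms by (auto simp: rho_def power2_eq_1_iff)
qed

locale contractive_seq =
  fixes \<alpha> :: "nat \<Rightarrow> complex"
  assumes cmod_le_1: "cmod (\<alpha> n) \<le> 1"
begin

abbreviation factor ("\<F>") where "\<F> e \<equiv> cmv_factor e \<alpha>"
abbreviation factor_adj ("\<F>\<^sup>*") where "\<F>\<^sup>* e \<equiv> cmv_factor e (\<lambda>n. cnj (\<alpha> n))"

lemma conj_contractive: "contractive_seq (\<lambda>n. cnj (\<alpha> n))"
  by unfold_locales (simp add: cmod_le_1)

lemma factor_bounds: "cmod (factor_diag e \<alpha> i) \<le> 1" "cmod (factor_off e \<alpha> i) \<le> 1"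
  by (auto simp: factor_diag_def factor_off_def cmod_le_1 cmod_rho_le)

lemma nth_factor: "ell2_nth (\<F> e x) = tridiag (factor_diag e \<alpha>) (factor_off e \<alpha>) (ell2_nth x)"
  unfolding cmv_factor_def using square_summable_tridiag[OF square_summable_nth] factor_bounds
  by (simp add: Abs_ell2_inverse)

text \<open>
  Every coordinate is the first or the second one of a block, except for the coordinate \<open>0\<close> of
  \<open>1 \<oplus> \<Theta>\<^sub>1 \<oplus> \<Theta>\<^sub>3 \<oplus> \<dots>\<close>.
\<close>

lemma nth_factor_first:
  "even i = e \<Longrightarrow> ell2_nth (\<F> e x) i = cnj (\<alpha> i) * ell2_nth x i + rho \<alpha> i * ell2_nth x (Suc i)"
  by (cases i) (auto simp: nth_factor tridiag_def factor_diag_def factor_off_def)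

lemma nth_factor_second:
  "even i = e \<Longrightarrow> ell2_nth (\<F> e x) (Suc i) = rho \<alpha> i * ell2_nth x i - \<alpha> i * ell2_nth x (Suc i)"
  by (auto simp: nth_factor tridiag_def factor_diag_def factor_off_def)

lemma nth_factor_0: "ell2_nth (\<F> False x) 0 = ell2_nth x 0"
  by (auto simp: nth_factor tridiag_def factor_diag_def factor_off_def)

lemma factor_add: "\<F> e (x + y) = \<F> e x + \<F> e y"
  by (rule ell2_eqI) (auto simp: nth_factor tridiag_def plus_ell2.rep_eq algebra_simps)

lemma factor_scaleC: "\<F> e (c *\<^sub>C x) = c *\<^sub>C \<F> e x"
  by (rule ell2_eqI) (auto simp: nth_factor tridiag_def scaleC_ell2.rep_eq algebra_simps)

lemma factor_cinner: "cinner (\<F> e x) y = cinner x (\<F>\<^sup>* e y)"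
proof -
  interpret c: contractive_seq "\<lambda>n. cnj (\<alpha> n)"
    by (rule conj_contractive)
  have "factor_diag e (\<lambda>n. cnj (\<alpha> n)) = (\<lambda>i. cnj (factor_diag e \<alpha> i))"
    "factor_off e (\<lambda>n. cnj (\<alpha> n)) = (\<lambda>i. cnj (factor_off e \<alpha> i))"
    by (auto simp: factor_diag_def factor_off_def fun_eq_iff)
  then show ?thesis
    unfolding cinner_ell2_def nth_factor c.nth_factor
    using suminf_tridiag_adjoint[OF square_summable_nth square_summable_nth factor_bounds] by simp
qed

lemma factor_adj_factor: "\<F>\<^sup>* e (\<F> e x) = x"
proof (rule ell2_eqI)
  interpret c: contractive_seq "\<lambda>n. cnj (\<alpha> n)"
    by (rule conj_contractive)
  fix i
  consider "even i = e" | j where "i = Suc j" "even j = e" | "i = 0" "\<not> e"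
    by (cases i) auto
  then show "ell2_nth (\<F>\<^sup>* e (\<F> e x)) i = ell2_nth x i"
  proof cases
    case 1
    have "ell2_nth (\<F>\<^sup>* e (\<F> e x)) i =
        (rho \<alpha> i * rho \<alpha> i + \<alpha> i * cnj (\<alpha> i)) * ell2_nth x i"
      using 1 by (simp add: nth_factor_first nth_factor_second c.nth_factor_first algebra_simps)
    then show ?thesis
      by (simp add: rho_square cmod_le_1)
  next
    case (2 j)
    have "ell2_nth (\<F>\<^sup>* e (\<F> e x)) i =
        (rho \<alpha> j * rho \<alpha> j + \<alpha> j * cnj (\<alpha> j)) * ell2_nth x (Suc j)"
      using 2 by (simp add: nth_factor_first nth_factor_second c.nth_factor_second algebra_simps)
    then show ?thesis
      using 2 by (simp add: rho_square cmod_le_1)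
  next
    case 3
    then show ?thesis
      by (simp add: nth_factor_0 c.nth_factor_0)
  qed
qed

lemma factor_factor_adj: "\<F> e (\<F>\<^sup>* e x) = x"
  using contractive_seq.factor_adj_factor[OF conj_contractive, of e x] by simp

end

section \<open>Truncated CMV matrices as operators\<close>

definition unit_vec :: "nat \<Rightarrow> ell2" where
  "unit_vec i = Abs_ell2 (\<lambda>j. if j = i then 1 else 0)"

lemma nth_unit_vec: "ell2_nth (unit_vec i) j = (if j = i then 1 else 0)"
proof -
  have "square_summable (\<lambda>j. if j = i then 1 else 0)"
    unfolding square_summable_def by (rule summable_finite[of "{i}"]) auto
  then show ?thesis
    by (simp add: unit_vec_def Abs_ell2_inverse)
qed

lemma cinner_unit_vec: "cinner x (unit_vec i) = ell2_nth x i"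
proof -
  have "(\<lambda>j. ell2_nth x j * cnj (ell2_nth (unit_vec i) j)) = (\<lambda>j. if j = i then ell2_nth x j else 0)"
    by (auto simp: nth_unit_vec)
  then show ?thesis
    using sums_single[of i "ell2_nth x"] by (simp add: cinner_ell2_def sums_iff)
qed

lemma norm_eq_1I:
  assumes "cinner x x = 1"
  shows "norm x = 1"
proof -
  have "complex_of_real ((norm x)\<^sup>2) = complex_of_real (1\<^sup>2)"
    using assms cinner_self[of x] by simp
  then have "(norm x)\<^sup>2 = 1\<^sup>2"
    using of_real_eq_iff by blast
  then show ?thesis
    by (rule power2_eq_imp_eq) auto
qed

definition zero_first :: "ell2 \<Rightarrow> ell2" where
  "zero_first x = x - ell2_nth x 0 *\<^sub>C unit_vec 0"

lemma nth_zero_first: "ell2_nth (zero_first x) i = (if i = 0 then 0 else ell2_nth x i)"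
  by (simp add: zero_first_def ell2_nth_diff scaleC_ell2.rep_eq nth_unit_vec)

lemma cinner_zero_first:
  assumes "ell2_nth y 0 = 0"
  shows "cinner (zero_first x) y = cinner x y" "cinner y (zero_first x) = cinner y x"
  using assms cinner_unit_vec[of y 0] cinner_commute[of "unit_vec 0" y]
  by (simp_all add: zero_first_def cinner_diff_left cinner_diff_right cinner_scaleC_left
      cinner_scaleC_right)

lemma subspace_ell2_on: "complex_vector.subspace (ell2_on I)"
  by (auto simp: complex_vector.subspace_def ell2_on_def zero_ell2.rep_eq plus_ell2.rep_eq
      scaleC_ell2.rep_eq)

text \<open>
  The sequence \<open>p\<^sub>n\<close> which together with \<open>q\<^sub>n = z g\<^sub>n p\<^sub>n\<close> solves the recursion
  \<open>\<rho>\<^sub>n p\<^sub>n\<^sub>+\<^sub>1 = z p\<^sub>n - cnj \<alpha>\<^sub>n q\<^sub>n\<close>, \<open>\<rho>\<^sub>n q\<^sub>n\<^sub>+\<^sub>1 = q\<^sub>n - \<alpha>\<^sub>n z p\<^sub>n\<close> of normalised orthogonal polynomials, provided that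
  the numbers \<open>g\<^sub>n\<close> obey the Schur recursion. After an index with \<open>\<rho>\<^sub>n = 0\<close>, division by \<open>0\<close> makes the
  sequence vanish, which is what a matrix of finite size requires.
\<close>

primrec wave :: "(nat \<Rightarrow> complex) \<Rightarrow> complex \<Rightarrow> (nat \<Rightarrow> complex) \<Rightarrow> nat \<Rightarrow> complex" where
  "wave \<alpha> z g 0 = 1"
| "wave \<alpha> z g (Suc n) = z * wave \<alpha> z g n * (1 - cnj (\<alpha> n) * g n) / rho \<alpha> n"

text \<open>
  The index \<open>M\<close> of the last coefficient may be \<open>\<infinity>\<close>. A finite \<open>M\<close> enters the factors only through
  \<open>\<rho>\<^sub>M = 0\<close>, so the same formulas describe finite and infinite matrices.
\<close>

locale truncated_seq = contractive_seq \<alpha> for \<alpha> +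
  fixes M :: enat
  assumes M_pos: "1 \<le> M"
    and cmod_less_1: "enat n < M \<Longrightarrow> cmod (\<alpha> n) < 1"
    and cmod_last: "M = enat m \<Longrightarrow> cmod (\<alpha> m) = 1"
begin

abbreviation "H \<equiv> ell2_on (cmv_index M)"

lemma conj_truncated: "truncated_seq (\<lambda>n. cnj (\<alpha> n)) M"
  by unfold_locales (use M_pos cmod_less_1 cmod_last cmod_le_1 in auto)

lemma rho_nonzero: "enat n < M \<Longrightarrow> rho \<alpha> n \<noteq> 0"
  using rho_eq_0_iff[of \<alpha> n, OF cmod_le_1] cmod_less_1[of n] by auto

lemma rho_last: "M = enat m \<Longrightarrow> rho \<alpha> m = 0"
  using rho_eq_0_iff[of \<alpha> m, OF cmod_le_1] cmod_last[of m] by auto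

lemma in_H_iff: "x \<in> H \<longleftrightarrow> ell2_nth x 0 = 0 \<and> (\<forall>i. M < enat i \<longrightarrow> ell2_nth x i = 0)"
  unfolding ell2_on_def cmv_index_def
  by (auto simp: not_le Suc_le_eq)

lemma unit_vec_1_in_H: "unit_vec 1 \<in> H"
  using M_pos by (auto simp: in_H_iff nth_unit_vec one_enat_def)

text \<open>
  The factor \<open>L' = (- \<alpha>\<^sub>0) \<oplus> \<Theta>\<^sub>2 \<oplus> \<Theta>\<^sub>4 \<oplus> \<dots>\<close>, as the compression of \<open>\<Theta>\<^sub>0 \<oplus> \<Theta>\<^sub>2 \<oplus> \<dots>\<close> to the coordinates from \<open>1\<close> on.
\<close>

definition inner_factor :: "ell2 \<Rightarrow> ell2" where
  "inner_factor x = zero_first (\<F> True x)"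

definition inner_adj :: "ell2 \<Rightarrow> ell2" where
  "inner_adj x = zero_first (\<F>\<^sup>* True x)"

text \<open>
  In \<open>T = A L' B\<close> the unitary factors are \<open>A = outer (\<not> s)\<close> and \<open>B = outer s\<close>, with \<open>s\<close> true for \<open>L' M'\<close>
  and false for the transpose \<open>M' L'\<close>.
\<close>

definition outer :: "bool \<Rightarrow> ell2 \<Rightarrow> ell2" where
  "outer s x = (if s then \<F> False x else x)"

definition outer_adj :: "bool \<Rightarrow> ell2 \<Rightarrow> ell2" where
  "outer_adj s x = (if s then \<F>\<^sup>* False x else x)"

text \<open>
  Because \<open>\<rho>\<^sub>M = 0\<close>, the block \<open>\<Theta>\<^sub>M\<close> is diagonal and the factors do not couple the coordinates
  up to \<open>M\<close> with the later ones.
\<close>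

lemma factor_tail:
  assumes x: "\<And>i. M < enat i \<Longrightarrow> ell2_nth x i = 0" and "M < enat i"
  shows "ell2_nth (\<F> e x) i = 0"
proof (cases "even i = e")
  case True
  have "M < enat (Suc i)"
    using assms(2) by (meson enat_ord_simps(2) lessI less_trans)
  then show ?thesis
    using True assms by (simp add: nth_factor_first)
next
  case False
  obtain m where m: "M = enat m"
    using assms(2) by (cases M) auto
  with assms(2) obtain j where j: "i = Suc j" "m \<le> j"
    by (cases i) auto
  have "ell2_nth x j = 0 \<or> rho \<alpha> j = 0"
    using x[of j] rho_last[OF m] m j by (cases "j = m") auto
  then show ?thesis
    using False assms j by (auto simp: nth_factor_second)
qed

lemma factor_in_H: "x \<in> H \<Longrightarrow> \<F> False x \<in> H"
  using factor_tail[of x] by (simp add: in_H_iff nth_factor_0)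

lemma inner_factor_in_H: "x \<in> H \<Longrightarrow> inner_factor x \<in> H"
  using factor_tail[of x] by (auto simp: in_H_iff inner_factor_def nth_zero_first)

lemma factor_adj_in_H: "x \<in> H \<Longrightarrow> \<F>\<^sup>* False x \<in> H"
  by (rule truncated_seq.factor_in_H[OF conj_truncated])

lemma inner_adj_in_H: "x \<in> H \<Longrightarrow> inner_adj x \<in> H"
  using truncated_seq.inner_factor_in_H[OF conj_truncated]
    truncated_seq.inner_factor_def[OF conj_truncated] by (simp add: inner_adj_def)

lemma inner_factor_add: "inner_factor (x + y) = inner_factor x + inner_factor y"
  by (rule ell2_eqI) (simp add: inner_factor_def nth_zero_first factor_add plus_ell2.rep_eq)

lemma inner_factor_scaleC: "inner_factor (c *\<^sub>C x) = c *\<^sub>C inner_factor x"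
  by (rule ell2_eqI) (simp add: inner_factor_def nth_zero_first factor_scaleC scaleC_ell2.rep_eq)

lemma inner_adj_eq: "inner_adj = truncated_seq.inner_factor (\<lambda>n. cnj (\<alpha> n))"
  by (simp add: fun_eq_iff inner_adj_def truncated_seq.inner_factor_def[OF conj_truncated])

lemma outer_adj_eq: "outer_adj = truncated_seq.outer (\<lambda>n. cnj (\<alpha> n))"
  by (simp add: fun_eq_iff outer_adj_def truncated_seq.outer_def[OF conj_truncated])

lemma inner_factor_cinner:
  assumes "x \<in> H" "y \<in> H"
  shows "cinner (inner_factor x) y = cinner x (inner_adj y)"
  using assms by (simp add: inner_factor_def inner_adj_def cinner_zero_first in_H_iff factor_cinner)

text \<open>
  On vectors with vanishing coordinate \<open>0\<close>, the compression loses only the entry \<open>\<rho>\<^sub>0 x\<^sub>1\<close> which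
  \<open>\<Theta>\<^sub>0\<close> creates at the coordinate \<open>0\<close>.
\<close>

lemma inner_adj_inner_factor:
  assumes "x \<in> H"
  shows "x - inner_adj (inner_factor x) = (rho \<alpha> 0 * rho \<alpha> 0 * ell2_nth x 1) *\<^sub>C unit_vec 1"
proof -
  interpret c: contractive_seq "\<lambda>n. cnj (\<alpha> n)"
    by (rule conj_contractive)
  have x0: "ell2_nth x 0 = 0"
    using assms by (simp add: in_H_iff)
  have "zero_first (\<F> True x) + (rho \<alpha> 0 * ell2_nth x 1) *\<^sub>C unit_vec 0 = \<F> True x"
    using x0 by (auto intro!: ell2_eqI simp: nth_zero_first plus_ell2.rep_eq scaleC_ell2.rep_eq
        nth_unit_vec nth_factor_first)
  then have "\<F>\<^sup>* True (zero_first (\<F> True x)) +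
      (rho \<alpha> 0 * ell2_nth x 1) *\<^sub>C \<F>\<^sup>* True (unit_vec 0) = x"
    by (metis c.factor_add c.factor_scaleC factor_adj_factor)
  then have nth: "ell2_nth (\<F>\<^sup>* True (zero_first (\<F> True x))) i +
      rho \<alpha> 0 * ell2_nth x 1 * ell2_nth (\<F>\<^sup>* True (unit_vec 0)) i = ell2_nth x i" for i
    by (metis plus_ell2.rep_eq scaleC_ell2.rep_eq)
  have e: "ell2_nth (\<F>\<^sup>* True (unit_vec 0)) i = (if i = 1 then rho \<alpha> 0 else 0)" if "i \<noteq> 0" for i
    using that
    by (cases i) (auto simp: c.nth_factor tridiag_def factor_diag_def factor_off_def nth_unit_vec)
  show ?thesis
  proof (rule ell2_eqI)
    fix i
    show "ell2_nth (x - inner_adj (inner_factor x)) i =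
        ell2_nth ((rho \<alpha> 0 * rho \<alpha> 0 * ell2_nth x 1) *\<^sub>C unit_vec 1) i"
      using nth[of i] x0 e[of i]
      by (auto simp: ell2_nth_diff scaleC_ell2.rep_eq nth_unit_vec inner_adj_def inner_factor_def
          nth_zero_first algebra_simps)
  qed
qed

lemma inner_factor_inner_adj:
  assumes "x \<in> H"
  shows "x - inner_factor (inner_adj x) = (rho \<alpha> 0 * rho \<alpha> 0 * ell2_nth x 1) *\<^sub>C unit_vec 1"
  using truncated_seq.inner_adj_inner_factor[OF conj_truncated assms]
  by (simp add: inner_factor_def inner_adj_def truncated_seq.inner_factor_def[OF conj_truncated]
      truncated_seq.inner_adj_def[OF conj_truncated])

lemma inner_factor_unit_vec: "inner_factor (unit_vec 1) = (- \<alpha> 0) *\<^sub>C unit_vec 1"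
proof (rule ell2_eqI)
  fix i :: nat
  consider "i = 0" | "i = 1" | j where "i = Suc (Suc j)"
    by (metis One_nat_def not0_implies_Suc)
  then show "ell2_nth (inner_factor (unit_vec 1)) i = ell2_nth ((- \<alpha> 0) *\<^sub>C unit_vec 1) i"
    by cases (auto simp: inner_factor_def nth_zero_first scaleC_ell2.rep_eq nth_unit_vec
        uminus_ell2.rep_eq nth_factor tridiag_def factor_diag_def factor_off_def)
qed

lemma outer_simps:
  "outer_adj s (outer s x) = x" "outer s (outer_adj s x) = x"
  "outer s (x + y) = outer s x + outer s y" "outer s (c *\<^sub>C x) = c *\<^sub>C outer s x"
  "cinner (outer s x) w = cinner x (outer_adj s w)"
  "\<F> False (outer_adj (\<not> s) x) = outer s x" "\<F>\<^sup>* False (outer s x) = outer_adj (\<not> s) x"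
  "outer s (outer (\<not> s) x) = \<F> False x"
  by (auto simp: outer_def outer_adj_def factor_adj_factor factor_factor_adj factor_add
      factor_scaleC factor_cinner)

lemma cinner_outer:
  "cinner (outer s x) (outer s y) = cinner x y" "cinner (outer_adj s x) (outer_adj s y) = cinner x y"
  using outer_simps(5)[of s "outer_adj s x" "y"]
  by (simp_all add: outer_simps(1,2,5))

lemma outer_in_H: "x \<in> H \<Longrightarrow> outer s x \<in> H" "x \<in> H \<Longrightarrow> outer_adj s x \<in> H"
  by (auto simp: outer_def outer_adj_def factor_in_H factor_adj_in_H)

definition trunc_op :: "bool \<Rightarrow> ell2 \<Rightarrow> ell2" where
  "trunc_op s x = outer (\<not> s) (inner_factor (outer s x))"

definition trunc_adj :: "bool \<Rightarrow> ell2 \<Rightarrow> ell2" where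
  "trunc_adj s x = outer_adj s (inner_adj (outer_adj (\<not> s) x))"

text \<open>
  The defects of the inner factor are multiples of the projection onto \<open>e\<^sub>1\<close>; the outer factors carry
  \<open>e\<^sub>1\<close> to \<open>B\<^sup>* e\<^sub>1\<close> and \<open>A e\<^sub>1\<close>.
\<close>

lemma rank_one_defect_pair_trunc_op:
  "rank_one_defect_pair H (trunc_op s) (trunc_adj s) (sqrt (1 - (cmod (\<alpha> 0))\<^sup>2))
     (outer_adj s (unit_vec 1)) (outer (\<not> s) (unit_vec 1))"
proof -
  interpret c: truncated_seq "\<lambda>n. cnj (\<alpha> n)" M
    by (rule conj_truncated)
  have \<rho>: "complex_of_real ((sqrt (1 - (cmod (\<alpha> 0))\<^sup>2))\<^sup>2) = rho \<alpha> 0 * rho \<alpha> 0"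
    by (simp only: rho_def power2_eq_square of_real_mult)
  note adj_simps = c.outer_simps[folded outer_adj_eq] c.inner_factor_add[folded inner_adj_eq]
    c.inner_factor_scaleC[folded inner_adj_eq]
  have outer_diff: "outer t (x - y) = outer t x - outer t y"
    "outer_adj t (x - y) = outer_adj t x - outer_adj t y" for t x y
    using outer_simps(3)[of t "x - y" y] adj_simps(3)[of t "x - y" y] by (simp_all add: eq_diff_eq)
  show ?thesis
  proof
    show "complex_vector.subspace H"
      by (rule subspace_ell2_on)
    show "linear_op H H (trunc_op s)"
      by (auto simp: linear_op_def trunc_op_def outer_in_H inner_factor_in_H outer_simps
          inner_factor_add inner_factor_scaleC)
    show "linear_op H H (trunc_adj s)"
      by (auto simp: linear_op_def trunc_adj_def outer_in_H inner_adj_in_H adj_simps)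
    show "cinner (trunc_op s x) y = cinner x (trunc_adj s y)" if "x \<in> H" "y \<in> H" for x y
      using that by (simp add: trunc_op_def trunc_adj_def outer_simps inner_factor_cinner outer_in_H)
    have "enat 0 < M"
      using M_pos by (cases M) (auto simp: one_enat_def)
    then have "(cmod (\<alpha> 0))\<^sup>2 < 1"
      using cmod_less_1[of 0] by (simp add: abs_square_less_1)
    then show "0 < sqrt (1 - (cmod (\<alpha> 0))\<^sup>2)"
      by simp
    show "outer_adj s (unit_vec 1) \<in> H" "outer (\<not> s) (unit_vec 1) \<in> H"
      using unit_vec_1_in_H outer_in_H by auto
    show "norm (outer_adj s (unit_vec 1)) = 1" "norm (outer (\<not> s) (unit_vec 1)) = 1"
      by (simp_all add: norm_eq_1I cinner_outer cinner_unit_vec nth_unit_vec)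
    fix x assume x: "x \<in> H"
    show "x - trunc_adj s (trunc_op s x) = (complex_of_real ((sqrt (1 - (cmod (\<alpha> 0))\<^sup>2))\<^sup>2) *
        cinner x (outer_adj s (unit_vec 1))) *\<^sub>C outer_adj s (unit_vec 1)"
    proof -
      have "x - trunc_adj s (trunc_op s x) =
          outer_adj s (outer s x - inner_adj (inner_factor (outer s x)))"
        by (simp add: trunc_op_def trunc_adj_def outer_simps outer_diff)
      also have "\<dots> = (rho \<alpha> 0 * rho \<alpha> 0 * cinner (outer s x) (unit_vec 1)) *\<^sub>C
          outer_adj s (unit_vec 1)"
        using x by (simp add: inner_adj_inner_factor outer_in_H adj_simps cinner_unit_vec)
      finally show ?thesis
        unfolding \<rho> by (simp only: outer_simps)
    qed
    show "x - trunc_op s (trunc_adj s x) = (complex_of_real ((sqrt (1 - (cmod (\<alpha> 0))\<^sup>2))\<^sup>2) *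
        cinner x (outer (\<not> s) (unit_vec 1))) *\<^sub>C outer (\<not> s) (unit_vec 1)"
    proof -
      have "x - trunc_op s (trunc_adj s x) = outer (\<not> s) (outer_adj (\<not> s) x -
          inner_factor (inner_adj (outer_adj (\<not> s) x)))"
        by (simp add: trunc_op_def trunc_adj_def outer_simps outer_diff)
      also have "\<dots> = (rho \<alpha> 0 * rho \<alpha> 0 * cinner (outer_adj (\<not> s) x) (unit_vec 1)) *\<^sub>C
          outer (\<not> s) (unit_vec 1)"
        using x by (simp add: inner_factor_inner_adj outer_in_H outer_simps cinner_unit_vec)
      also have "cinner (outer_adj (\<not> s) x) (unit_vec 1) = cinner x (outer (\<not> s) (unit_vec 1))"
        by (metis cinner_commute outer_simps(5))
      finally show ?thesis
        unfolding \<rho> .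
    qed
  qed
qed

text \<open>
  For a subspace \<open>K\<close> reducing \<open>T = A L' B\<close> to a unitary operator, let \<open>E = A\<^sup>* K\<close> and \<open>G = B K\<close>. Their vectors
  vanish at the coordinate \<open>1\<close> because \<open>K\<close> is orthogonal to the defect vectors. Moreover \<open>M'\<close> maps \<open>E\<close>
  into \<open>G\<close> and \<open>M'\<^sup>*\<close> maps \<open>G\<close> into \<open>E\<close>, while \<open>L'\<close> maps \<open>G\<close> into \<open>E\<close> and \<open>L'\<^sup>*\<close> maps \<open>E\<close> into \<open>G\<close>. If a block
  \<open>\<Theta>\<^sub>j\<close> with \<open>\<rho>\<^sub>j \<noteq> 0\<close> takes a vector vanishing at \<open>j\<close> to such a vector, then that vector vanishes at \<open>j + 1\<close>
  too. Hence all coordinates of the vectors in \<open>E\<close> and \<open>G\<close> vanish.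
\<close>

lemma completely_nonunitary_aux:
  assumes K: "K \<subseteq> H"
    and orth: "\<And>x. x \<in> K \<Longrightarrow> cinner x (outer_adj s (unit_vec 1)) = 0"
      "\<And>x. x \<in> K \<Longrightarrow> cinner x (outer (\<not> s) (unit_vec 1)) = 0"
    and inv: "\<And>x. x \<in> K \<Longrightarrow> trunc_op s x \<in> K" "\<And>x. x \<in> K \<Longrightarrow> trunc_adj s x \<in> K"
    and "x \<in> K"
  shows "x = 0"
proof -
  interpret c: truncated_seq "\<lambda>n. cnj (\<alpha> n)" M
    by (rule conj_truncated)
  have step: "ell2_nth x (Suc j) = 0"
    if "even j = e" "ell2_nth x j = 0" "ell2_nth (\<F> e x) j = 0 \<or> ell2_nth (\<F>\<^sup>* e x) j = 0"
      "enat j < M" for x e j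
    using that rho_nonzero[of j] by (auto simp: nth_factor_first c.nth_factor_first)
  have vanish: "\<forall>x\<in>K. ell2_nth (outer_adj (\<not> s) x) j = 0 \<and> ell2_nth (outer s x) j = 0" for j
  proof (induction j)
    case 0
    then show ?case
      using K outer_in_H by (auto simp: in_H_iff subset_iff)
  next
    case (Suc j)
    show ?case
    proof (cases "enat j < M")
      case False
      then have "M < enat (Suc j)"
        by (meson enat_ord_simps(2) lessI less_le_trans not_le_imp_less order_le_less_trans)
      then show ?thesis
        using K outer_in_H by (auto simp: in_H_iff subset_iff)
    next
      case True
      show ?thesis
      proof (cases "j = 0")
        case j: True
        show ?thesis
        proof
          fix x assume x: "x \<in> K"
          have "cinner (outer s x) (unit_vec 1) = 0" "cinner (outer_adj (\<not> s) x) (unit_vec 1) = 0"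
            using orth[OF x] outer_simps(5) by (simp, metis cinner_commute complex_cnj_zero)
          then show "ell2_nth (outer_adj (\<not> s) x) (Suc j) = 0 \<and> ell2_nth (outer s x) (Suc j) = 0"
            using j by (simp add: cinner_unit_vec)
        qed
      next
        case j: False
        show ?thesis
        proof
          fix x assume x: "x \<in> K"
          have E: "ell2_nth (outer_adj (\<not> s) x) j = 0" and G: "ell2_nth (outer s x) j = 0"
            using Suc x by auto
          show "ell2_nth (outer_adj (\<not> s) x) (Suc j) = 0 \<and> ell2_nth (outer s x) (Suc j) = 0"
          proof (cases "even j")
            case False
            then show ?thesis
              using step[of j False] True E G by (simp add: outer_simps)
          next
            case even: True
            have "inner_factor (outer s x) = outer_adj (\<not> s) (trunc_op s x)"
              "inner_adj (outer_adj (\<not> s) x) = outer s (trunc_adj s x)"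
              by (simp_all add: trunc_op_def trunc_adj_def outer_simps)
            then have "ell2_nth (inner_factor (outer s x)) j = 0"
              "ell2_nth (inner_adj (outer_adj (\<not> s) x)) j = 0"
              using Suc inv[OF x] by auto
            then have "ell2_nth (\<F> True (outer s x)) j = 0"
              "ell2_nth (\<F>\<^sup>* True (outer_adj (\<not> s) x)) j = 0"
              using j by (simp_all add: inner_factor_def inner_adj_def nth_zero_first)
            then show ?thesis
              using step[of j True] even True E G by simp
          qed
        qed
      qed
    qed
  qed
  have "outer s x = 0"
    using vanish \<open>x \<in> K\<close> by (intro ell2_eqI) (simp add: zero_ell2.rep_eq)
  moreover have "outer_adj s 0 = 0"
    using outer_simps(4)[of s 0 "outer_adj s 0"] outer_simps(1,2)
    by (metis complex_vector.scale_zero_left)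
  ultimately show ?thesis
    by (metis outer_simps(1))
qed

text \<open>
  The solution interlaces \<open>q\<^sub>n\<close> for odd \<open>n\<close> with \<open>p\<^sub>n\<close> for even \<open>n\<close>, both scaled by powers of \<open>z\<close>: the blocks
  of odd index take \<open>(q\<^sub>n, p\<^sub>n\<^sub>+\<^sub>1)\<close> to \<open>(z p\<^sub>n, q\<^sub>n\<^sub>+\<^sub>1)\<close>, and the adjoints of those of even index reverse this.
  The bound \<open>\<bar>g\<^sub>n\<bar> \<le> 1\<close> gives \<open>\<bar>q\<^sub>n\<bar> \<le> \<bar>z p\<^sub>n\<bar>\<close>, from which square summability follows.
\<close>

lemma resolvent_solution:
  assumes z: "z \<noteq> 0" "cmod z < 1"
    and g: "\<And>n. enat n \<le> M \<Longrightarrow> cmod (g n) \<le> 1"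
    and rec: "\<And>n. enat n < M \<Longrightarrow> g n - \<alpha> n = z * g (Suc n) * (1 - cnj (\<alpha> n) * g n)"
    and g_last: "\<And>m. M = enat m \<Longrightarrow> g m = \<alpha> m"
  obtains y where "y \<in> H" "\<F> False y = z *\<^sub>C inner_adj y + unit_vec 1"
    "g 0 = \<alpha> 0 + z * (rho \<alpha> 0 * rho \<alpha> 0) * ell2_nth y 1"
proof -
  interpret cs: truncated_seq "\<lambda>n. cnj (\<alpha> n)" M
    by (rule conj_truncated)
  define p where "p = wave \<alpha> z g"
  define q where "q n = z * g n * p n" for n
  define c where "c = 1 / (z * rho \<alpha> 0)"
  have p_Suc: "p (Suc n) = z * p n * (1 - cnj (\<alpha> n) * g n) / rho \<alpha> n" and p_0: "p 0 = 1" for n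
    by (simp_all add: p_def)
  have M0: "enat 0 < M"
    using M_pos by (cases M) (auto simp: one_enat_def)
  have rr: "rho \<alpha> n * rho \<alpha> n + \<alpha> n * cnj (\<alpha> n) = 1" for n
    by (rule rho_square[OF cmod_le_1])
  have p_tail: "p n = 0" if "M < enat n" for n
    using that
  proof (induction n)
    case 0
    then show ?case
      using M0 by simp
  next
    case (Suc n)
    show ?case
    proof (cases "M = enat n")
      case True
      then show ?thesis
        by (simp add: p_Suc rho_last)
    next
      case False
      with Suc.prems have "M < enat n"
        by (cases M) auto
      then show ?thesis
        using Suc by (simp add: p_Suc)
    qed
  qed
  have tail_Suc: "M < enat (Suc n)" if "\<not> enat n < M" for n
    using that by (cases M) auto
  \<comment> \<open>The block \<open>\<Theta>\<^sub>n\<^sup>*\<close> maps \<open>(z p\<^sub>n, q\<^sub>n\<^sub>+\<^sub>1)\<close> to \<open>(q\<^sub>n, p\<^sub>n\<^sub>+\<^sub>1)\<close>, also beyond \<open>M\<close>, where everything is \<open>0\<close>.\<close>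
  have R1: "q n = rho \<alpha> n * q (Suc n) + \<alpha> n * z * p n" for n
  proof (cases "enat n < M")
    case True
    have "q n - \<alpha> n * z * p n = z * p n * (g n - \<alpha> n)"
      by (simp add: q_def algebra_simps)
    also have "\<dots> = rho \<alpha> n * q (Suc n)"
      using rho_nonzero[OF True] by (simp add: rec[OF True] q_def p_Suc)
    finally show ?thesis
      by (simp add: algebra_simps)
  next
    case False
    then have "M = enat n \<or> M < enat n"
      by (cases M) auto
    then show ?thesis
      using p_tail[OF tail_Suc[OF False]] p_tail[of n] g_last[of n] by (auto simp: q_def)
  qed
  have R3: "z * p n = cnj (\<alpha> n) * q n + rho \<alpha> n * p (Suc n)" for n
  proof (cases "enat n < M")
    case True
    then have "rho \<alpha> n * p (Suc n) = z * p n * (1 - cnj (\<alpha> n) * g n)"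
      using rho_nonzero by (simp add: p_Suc)
    then show ?thesis
      by (simp add: q_def algebra_simps)
  next
    case False
    then have "M = enat n \<or> M < enat n"
      by (cases M) auto
    then show ?thesis
      using p_tail[OF tail_Suc[OF False]] p_tail[of n] g_last[of n] rr[of n] rho_last[of n]
      by (auto simp: q_def algebra_simps)
  qed
  have p_last: "p (Suc n) = 0" "q (Suc n) = 0" if "\<not> enat n < M" for n
    using p_tail[OF tail_Suc[OF that]] by (simp_all add: q_def)
  have cancel: "u = v" if "rho \<alpha> n * u = rho \<alpha> n * v" "enat n < M" for u v n
    using that rho_nonzero by simp
  have R2: "p (Suc n) = rho \<alpha> n * z * p n - cnj (\<alpha> n) * q (Suc n)" for n
  proof (cases "enat n < M")
    case True
    have "rho \<alpha> n * p (Suc n) = z * p n - cnj (\<alpha> n) * (rho \<alpha> n * q (Suc n) + \<alpha> n * z * p n)"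
      using R1[of n] R3[of n] by (simp add: algebra_simps)
    also have "\<dots> = (1 - \<alpha> n * cnj (\<alpha> n)) * (z * p n) - cnj (\<alpha> n) * (rho \<alpha> n * q (Suc n))"
      by (simp add: algebra_simps)
    also have "1 - \<alpha> n * cnj (\<alpha> n) = rho \<alpha> n * rho \<alpha> n"
      using rr[of n] by (simp add: algebra_simps)
    finally have "rho \<alpha> n * p (Suc n) = rho \<alpha> n * (rho \<alpha> n * z * p n - cnj (\<alpha> n) * q (Suc n))"
      by (simp add: algebra_simps)
    then show ?thesis
      by (rule cancel[OF _ True])
  next
    case False
    then have "M = enat n \<or> M < enat n"
      by (cases M) auto
    then show ?thesis
      using p_last[OF False] rho_last[of n] p_tail[of n] by auto
  qed
  have R4: "q (Suc n) = rho \<alpha> n * q n - \<alpha> n * p (Suc n)" for n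
  proof -
    have "rho \<alpha> n * q n - \<alpha> n * p (Suc n) = (rho \<alpha> n * rho \<alpha> n + \<alpha> n * cnj (\<alpha> n)) * q (Suc n)"
      by (subst R1[of n], subst R2[of n]) (simp add: algebra_simps)
    then show ?thesis
      by (simp add: rr)
  qed
  have isometric: "(cmod (q n))\<^sup>2 + (cmod (p (Suc n)))\<^sup>2 =
      (cmod z)\<^sup>2 * (cmod (p n))\<^sup>2 + (cmod (q (Suc n)))\<^sup>2" for n
  proof -
    have "complex_of_real ((cmod (q n))\<^sup>2 + (cmod (p (Suc n)))\<^sup>2) =
        q n * cnj (q n) + p (Suc n) * cnj (p (Suc n))"
      by (simp only: of_real_add complex_norm_square)
    also have "\<dots> = (rho \<alpha> n * rho \<alpha> n + \<alpha> n * cnj (\<alpha> n)) *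
        (z * p n * cnj (z * p n) + q (Suc n) * cnj (q (Suc n)))"
      unfolding R1[of n] R2[of n] by (simp add: algebra_simps)
    also have "\<dots> = complex_of_real ((cmod z)\<^sup>2 * (cmod (p n))\<^sup>2 + (cmod (q (Suc n)))\<^sup>2)"
      unfolding rr by (simp add: complex_norm_square[symmetric] norm_mult power_mult_distrib
          del: complex_cnj_mult)
    finally show ?thesis
      using of_real_eq_iff by blast
  qed
  \<comment> \<open>The equation at the coordinate \<open>1\<close> determines the factor \<open>c\<close>; at the other ones it is homogeneous.\<close>
  define y where "y i = (if i = 0 then 0 else c * (if odd i then q i else p i) / z ^ (Suc i div 2))"
    for i
  have y_odd: "y (Suc (2 * n)) = c * q (Suc (2 * n)) / z ^ Suc n"
    and y_even: "y (Suc (Suc (2 * n))) = c * p (Suc (Suc (2 * n))) / z ^ Suc n"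
    and y_odd': "y (Suc (Suc (Suc (2 * n)))) = c * q (Suc (Suc (Suc (2 * n)))) / z ^ Suc (Suc n)"
    and y_even': "y (Suc (Suc (Suc (Suc (2 * n))))) =
      c * p (Suc (Suc (Suc (Suc (2 * n))))) / z ^ Suc (Suc n)" for n
    by (simp_all add: y_def)
  let ?a = "(cmod z)\<^sup>2"
  have a: "0 < ?a" "?a < 1"
    using z by (auto simp: power_less_one_iff abs_square_less_1)
  \<comment> \<open>Since the blocks are isometric, the partial sums of \<open>\<bar>y\<^sub>i\<bar>\<^sup>2\<close> telescope to differences of \<open>u\<close>.\<close>
  define u where "u m = (?a * (cmod (p (2 * m)))\<^sup>2 - (cmod (q (2 * m)))\<^sup>2) / ?a ^ m" for m
  have u_nonneg: "u m \<ge> 0" for m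
  proof -
    have "cmod (g (2 * m)) * cmod (p (2 * m)) \<le> cmod (p (2 * m))"
      using g[of "2 * m"] p_tail[of "2 * m"]
      by (cases "enat (2 * m) \<le> M") (auto simp: mult_left_le_one_le)
    then have "(cmod (g (2 * m)) * cmod (p (2 * m)))\<^sup>2 \<le> (cmod (p (2 * m)))\<^sup>2"
      by (intro power_mono) auto
    then have "(cmod (q (2 * m)))\<^sup>2 \<le> ?a * (cmod (p (2 * m)))\<^sup>2"
      by (simp add: q_def norm_mult power_mult_distrib mult.assoc mult_left_mono)
    then show ?thesis
      by (simp add: u_def)
  qed
  have partial: "(1 - ?a) * (\<Sum>i<2 * m + 1. (cmod (y i))\<^sup>2) = (cmod c)\<^sup>2 * (u 0 - u m)" for m
  proof (induction m)
    case 0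
    then show ?case
      by (simp add: y_def)
  next
    case (Suc m)
    have y1: "(cmod (y (Suc (2 * m))))\<^sup>2 = (cmod c)\<^sup>2 * (cmod (q (Suc (2 * m))))\<^sup>2 / ?a ^ Suc m"
      and y2: "(cmod (y (Suc (Suc (2 * m)))))\<^sup>2 =
        (cmod c)\<^sup>2 * (cmod (p (Suc (Suc (2 * m)))))\<^sup>2 / ?a ^ Suc m"
      by (simp_all add: y_def norm_mult norm_divide norm_power power_mult_distrib power_divide
          flip: power_mult) (simp_all add: mult.commute)
    have key: "(1 - ?a) * ((cmod (q (Suc (2 * m))))\<^sup>2 + (cmod (p (Suc (Suc (2 * m)))))\<^sup>2) =
        ?a * (?a * (cmod (p (2 * m)))\<^sup>2 - (cmod (q (2 * m)))\<^sup>2) -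
        (?a * (cmod (p (2 * Suc m)))\<^sup>2 - (cmod (q (2 * Suc m)))\<^sup>2)"
    proof -
      have "(1 - a) * (q1 + p2) = a * (a * p0 - q0) - (a * p2 - q2)"
        if "q0 + p1 = a * p0 + q1" "q1 + p2 = a * p1 + q2" for a q0 p0 q1 p1 q2 p2 :: real
        using that by algebra
      from this[OF isometric[of "2 * m"] isometric[of "Suc (2 * m)"]] show ?thesis
        by simp
    qed
    have "(1 - ?a) * ((cmod (y (Suc (2 * m))))\<^sup>2 + (cmod (y (Suc (Suc (2 * m)))))\<^sup>2) =
        (cmod c)\<^sup>2 * ((1 - ?a) * ((cmod (q (Suc (2 * m))))\<^sup>2 +
          (cmod (p (Suc (Suc (2 * m)))))\<^sup>2)) / ?a ^ Suc m"
      unfolding y1 y2 by (simp add: add_divide_distrib distrib_left mult_ac)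
    also have "\<dots> = (cmod c)\<^sup>2 * (u m - u (Suc m))"
      proof -
      have "C * (b * X - Y) / (b * b ^ m) = C * (X / b ^ m - Y / (b * b ^ m))"
        if "b > 0" for C X Y b :: real
        using that by (simp add: field_simps)
      from this[OF a(1)] show ?thesis
        unfolding key u_def by simp
    qed
    finally show ?case
      using Suc by (simp add: distrib_left algebra_simps)
  qed
  have "square_summable y"
    unfolding square_summable_def
  proof (rule summableI_nonneg_bounded)
    fix n
    have "(\<Sum>i<n. (cmod (y i))\<^sup>2) \<le> (\<Sum>i<2 * n + 1. (cmod (y i))\<^sup>2)"
      by (rule sum_mono2) auto
    also have "\<dots> \<le> (cmod c)\<^sup>2 * u 0 / (1 - ?a)"
    proof -
      have "(cmod c)\<^sup>2 * (u 0 - u n) \<le> (cmod c)\<^sup>2 * u 0"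
        using u_nonneg[of n] by (intro mult_left_mono) auto
      then show ?thesis
        unfolding partial[symmetric] using a by (simp add: pos_le_divide_eq mult.commute)
    qed
    finally show "(\<Sum>i<n. (cmod (y i))\<^sup>2) \<le> (cmod c)\<^sup>2 * u 0 / (1 - ?a)" .
  qed simp
  then have nth_y: "ell2_nth (Abs_ell2 y) = y"
    by (simp add: Abs_ell2_inverse)
  show ?thesis
  proof (rule that[of "Abs_ell2 y"])
    show "Abs_ell2 y \<in> H"
      using p_tail by (auto simp: in_H_iff nth_y y_def q_def)
    have c: "c * z * rho \<alpha> 0 = 1"
      using z rho_nonzero[OF M0] by (simp add: c_def)
    show "g 0 = \<alpha> 0 + z * (rho \<alpha> 0 * rho \<alpha> 0) * ell2_nth (Abs_ell2 y) 1"
    proof -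
      have "z * g 0 = rho \<alpha> 0 * q 1 + \<alpha> 0 * z"
        using R1[of 0] by (simp add: q_def p_0)
      also have "\<dots> = z * (\<alpha> 0 + (c * z * rho \<alpha> 0) * rho \<alpha> 0 * q 1 / z)"
        unfolding c using z by (simp add: field_simps)
      finally have "g 0 = \<alpha> 0 + (c * z * rho \<alpha> 0) * rho \<alpha> 0 * q 1 / z"
        using z by simp
      then show ?thesis
        unfolding nth_y by (simp add: y_def)
    qed
    show "\<F> False (Abs_ell2 y) = z *\<^sub>C inner_adj (Abs_ell2 y) + unit_vec 1"
    proof (rule ell2_eqI)
      fix i
      have rhs: "ell2_nth (z *\<^sub>C inner_adj (Abs_ell2 y) + unit_vec 1) i =
          z * (if i = 0 then 0 else ell2_nth (\<F>\<^sup>* True (Abs_ell2 y)) i) + (if i = 1 then 1 else 0)"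
        by (simp add: plus_ell2.rep_eq scaleC_ell2.rep_eq inner_adj_def nth_zero_first nth_unit_vec)
      consider "i = 0" | "i = 1" | n where "i = Suc (Suc (2 * n))" | n where "i = Suc (Suc (Suc (2 * n)))"
        by (metis One_nat_def evenE not0_implies_Suc oddE Suc_eq_plus1 even_Suc)
      then show "ell2_nth (\<F> False (Abs_ell2 y)) i =
          ell2_nth (z *\<^sub>C inner_adj (Abs_ell2 y) + unit_vec 1) i"
      proof cases
        case 1
        then show ?thesis
          unfolding rhs by (simp add: nth_factor_0 nth_y y_def)
      next
        case 2
        have "ell2_nth (\<F> False (Abs_ell2 y)) 1 = c * (cnj (\<alpha> 1) * q 1 + rho \<alpha> 1 * p 2) / z"
          using y_odd[of 0] y_even[of 0]
          by (simp add: nth_factor_first nth_y numeral_2_eq_2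
              distrib_left add_divide_distrib mult.left_commute)
        also have "\<dots> = c * p 1"
          using z by (simp add: R3[of "Suc 0", symmetric] numeral_2_eq_2)
        also have "\<dots> = c * (rho \<alpha> 0 * z - cnj (\<alpha> 0) * q 1)"
          using R2[of 0] by (simp add: p_0)
        also have "\<dots> = 1 - cnj (\<alpha> 0) * c * q 1"
          using c by (simp add: algebra_simps)
        also have "\<dots> = z * ell2_nth (\<F>\<^sup>* True (Abs_ell2 y)) 1 + 1"
          using cs.nth_factor_second[of 0 True] y_odd[of 0] z by (simp add: nth_y y_def[of 0])
        finally show ?thesis
          unfolding rhs using 2 by simp
      next
        case (3 n)
        have "ell2_nth (\<F> False (Abs_ell2 y)) i =
            c * (rho \<alpha> (Suc (2 * n)) * q (Suc (2 * n)) -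
              \<alpha> (Suc (2 * n)) * p (Suc (Suc (2 * n)))) / z ^ Suc n"
          using 3 by (simp add: nth_factor_second nth_y y_odd y_even
              right_diff_distrib diff_divide_distrib mult.left_commute)
        also have "\<dots> = c * q i / z ^ Suc n"
          using 3 by (simp add: R4[of "Suc (2 * n)", symmetric])
        also have "\<dots> = z * (c * (\<alpha> i * z * p i + rho \<alpha> i * q (Suc i)) / z ^ Suc (Suc n))"
          using z by (simp add: R1[of i] add.commute mult.left_commute)
        also have "\<dots> = z * ell2_nth (\<F>\<^sup>* True (Abs_ell2 y)) i"
          using 3 z by (simp add: cs.nth_factor_first nth_y y_even y_odd'
              distrib_left add_divide_distrib mult.left_commute)
        finally show ?thesis
          unfolding rhs using 3 by simp
      next
        case (4 n)
        have "ell2_nth (\<F> False (Abs_ell2 y)) i =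
            c * (cnj (\<alpha> i) * q i + rho \<alpha> i * p (Suc i)) / z ^ Suc (Suc n)"
          using 4 by (simp add: nth_factor_first nth_y y_odd' y_even'
              distrib_left add_divide_distrib mult.left_commute)
        also have "\<dots> = c * p i / z ^ Suc n"
          using z by (simp add: R3[of i, symmetric])
        also have "\<dots> = z * (c * (rho \<alpha> (i - 1) * z * p (i - 1) - cnj (\<alpha> (i - 1)) * q i) / z ^ Suc (Suc n))"
          using 4 z by (simp add: R2[of "Suc (Suc (2 * n))"])
        also have "\<dots> = z * ell2_nth (\<F>\<^sup>* True (Abs_ell2 y)) i"
          using 4 z by (simp add: cs.nth_factor_second nth_y y_even y_odd'
              right_diff_distrib diff_divide_distrib mult.left_commute)
        finally show ?thesis
          unfolding rhs using 4 by simp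
      qed
    qed
  qed
qed

end

context truncated_seq
begin

text \<open>
  Every function that agrees with \<open>trunc_op s\<close> on \<open>H\<close> is covered, since an operator given by a matrix is
  determined on \<open>H\<close> only.
\<close>

lemma rank_one_defect_pair_cong:
  assumes T_eq: "\<And>x. x \<in> H \<Longrightarrow> T x = trunc_op s x"
  shows "rank_one_defect_pair H T (trunc_adj s) (sqrt (1 - (cmod (\<alpha> 0))\<^sup>2))
    (outer_adj s (unit_vec 1)) (outer (\<not> s) (unit_vec 1))"
proof -
  interpret t: rank_one_defect_pair H "trunc_op s" "trunc_adj s" "sqrt (1 - (cmod (\<alpha> 0))\<^sup>2)"
    "outer_adj s (unit_vec 1)" "outer (\<not> s) (unit_vec 1)"
    by (rule rank_one_defect_pair_trunc_op)
  show ?thesis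
  proof
    show "linear_op H H T"
      using t.T T_eq complex_vector.subspace_add[OF subspace_ell2_on]
        complex_vector.subspace_scale[OF subspace_ell2_on]
      by (auto simp: linear_op_def image_subset_iff)
  qed (use t.H t.S t.adj t.r t.a t.b t.ST t.TS t.SH T_eq in auto)
qed

lemma completely_nonunitary_trunc_op:
  assumes T_eq: "\<And>x. x \<in> H \<Longrightarrow> T x = trunc_op s x"
  shows "completely_nonunitary H T"
  unfolding completely_nonunitary_def
proof (rule notI, elim exE conjE)
  fix K assume K: "complex_vector.subspace K" "K \<subseteq> H" "K \<noteq> {0}"
    and inv: "adjoint_op H T ` K \<subseteq> K" "unitary_op K K T"
  note red = rank_one_defect_pair.reducing_unitary_orthogonal[OF
      rank_one_defect_pair_cong[OF T_eq] K(2) inv]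
  have trunc_op_K: "trunc_op s x \<in> K" if "x \<in> K" for x
    using red(3)[OF _ that] T_eq[of x] K(2) that by auto
  have "x = 0" if "x \<in> K" for x
    using completely_nonunitary_aux[OF K(2) red(1,2) trunc_op_K red(4) that] .
  moreover have "0 \<in> K"
    using K(1) by (rule complex_vector.subspace_0)
  ultimately show False
    using K(3) by auto
qed

text \<open>
  From a solution of \<open>M' y = z L'\<^sup>* y + e\<^sub>1\<close> one obtains \<open>x = A y\<close> with \<open>x - z T\<^sup>* x = B\<^sup>* e\<^sub>1\<close>, because \<open>M' = B A\<close>
  for both orders of the factors, and \<open>\<langle>x, A e\<^sub>1\<rangle> = y\<^sub>1\<close>.
\<close>

lemma char_fun_trunc_op:
  assumes T_eq: "\<And>x. x \<in> H \<Longrightarrow> T x = trunc_op s x"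
    and G: "\<And>z n. z \<noteq> 0 \<Longrightarrow> cmod z < 1 \<Longrightarrow> enat n \<le> M \<Longrightarrow> cmod (G n z) \<le> 1"
    and rec: "\<And>z n. z \<noteq> 0 \<Longrightarrow> cmod z < 1 \<Longrightarrow> enat n < M \<Longrightarrow>
        G n z - \<alpha> n = z * G (Suc n) z * (1 - cnj (\<alpha> n) * G n z)"
    and G_last: "\<And>z m. z \<noteq> 0 \<Longrightarrow> cmod z < 1 \<Longrightarrow> M = enat m \<Longrightarrow> G m z = \<alpha> m"
    and G0: "G 0 0 = \<alpha> 0"
  shows "char_fun_agrees H T (G 0)"
proof -
  let ?r = "sqrt (1 - (cmod (\<alpha> 0))\<^sup>2)" and ?a = "outer_adj s (unit_vec 1)"
    and ?b = "outer (\<not> s) (unit_vec 1)"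
  interpret c: truncated_seq "\<lambda>n. cnj (\<alpha> n)" M
    by (rule conj_truncated)
  interpret rank_one_defect_pair H T "trunc_adj s" ?r ?a ?b
    by (rule rank_one_defect_pair_cong[OF T_eq])
  show "char_fun_agrees H T (G 0)"
  proof (rule char_fun_agreesI)
    have "T ?a = outer (\<not> s) ((- \<alpha> 0) *\<^sub>C unit_vec 1)"
      using T_eq[OF a(1)] by (simp only: trunc_op_def outer_simps(2) inner_factor_unit_vec)
    then show "T ?a = (- \<alpha> 0) *\<^sub>C ?b"
      by (simp only: outer_simps(4))
    fix z :: complex assume "z \<in> ball 0 1"
    then have z: "cmod z < 1"
      by simp
    have \<rho>: "complex_of_real (?r\<^sup>2) = rho \<alpha> 0 * rho \<alpha> 0"
      by (simp only: rho_def power2_eq_square of_real_mult)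
    show "\<exists>x\<in>H. x - z *\<^sub>C trunc_adj s x = ?a \<and>
        G 0 z = \<alpha> 0 + z * complex_of_real (?r\<^sup>2) * cinner x ?b"
    proof (cases "z = 0")
      case True
      then show ?thesis
        using a G0 by (intro bexI[of _ ?a]) (auto simp: complex_vector.scale_zero_left)
    next
      case False
      obtain y where y: "y \<in> H" "\<F> False y = z *\<^sub>C inner_adj y + unit_vec 1"
        "G 0 z = \<alpha> 0 + z * (rho \<alpha> 0 * rho \<alpha> 0) * ell2_nth y 1"
        using resolvent_solution[OF False z, of "\<lambda>n. G n z"] G[OF False z] rec[OF False z]
          G_last[OF False z] by blast
      have "outer (\<not> s) y = outer_adj s (\<F> False y)"
        by (metis outer_simps(1,8))
      also have "\<dots> = z *\<^sub>C outer_adj s (inner_adj y) + ?a"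
        unfolding y(2) by (simp add: outer_adj_eq c.outer_simps)
      also have "outer_adj s (inner_adj y) = trunc_adj s (outer (\<not> s) y)"
        by (simp only: trunc_adj_def outer_simps(1))
      finally have "outer (\<not> s) y - z *\<^sub>C trunc_adj s (outer (\<not> s) y) = ?a"
        by (metis add_diff_cancel_left')
      moreover have "cinner (outer (\<not> s) y) ?b = ell2_nth y 1"
        by (simp add: cinner_outer cinner_unit_vec)
      ultimately show ?thesis
        using y outer_in_H unfolding \<rho> by (intro bexI[of _ "outer (\<not> s) y"]) auto
    qed
  qed
qed

end

section \<open>Matrix entries\<close>

lemma matrix_op_eqI:
  assumes "matrix_maps I A x y"
  shows "matrix_op I A x = y"
  unfolding matrix_op_def
proof (rule the_equality)
  fix y' assume y': "matrix_maps I A x y'"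
  show "y' = y"
  proof (rule ell2_eqI)
    fix i
    show "ell2_nth y' i = ell2_nth y i"
      using assms y'
      by (cases "i \<in> I") (auto simp: matrix_maps_def ell2_on_def intro: has_sum_unique)
  qed
qed fact

lemma trunc_cmv_finite_size:
  "i \<in> cmv_index M \<Longrightarrow> j \<in> cmv_index M \<Longrightarrow> trunc_cmv M \<alpha> i j = trunc_cmv \<infinity> \<alpha> i j"
  by (simp add: trunc_cmv_def cmv_index_def)

lemma trunc_cmv_band:
  "j \<notin> {i - 2, i - 1, i, i + 1, i + 2} \<Longrightarrow> trunc_cmv M \<alpha> i j = 0"
  "j \<notin> {i - 2, i - 1, i, i + 1, i + 2} \<Longrightarrow> trunc_cmv M \<alpha> j i = 0"
  by (auto simp: trunc_cmv_def)

text \<open>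
  Rows and columns have at most five nonzero entries. Replacing the entries \<open>A\<close> of the matrix of size
  \<open>M\<close> by those of the infinite matrix, \<open>B\<close>, keeps case distinctions at the end of the index set out of the
  finite sum: there the coordinates of \<open>x\<close> vanish.
\<close>

lemma banded_has_sum:
  assumes x: "x \<in> ell2_on (cmv_index M)"
    and band: "\<And>j. j \<notin> {i - 2, i - 1, i, i + 1, i + 2} \<Longrightarrow> A j = 0"
    and A: "\<And>j. j \<in> cmv_index M \<Longrightarrow> A j = B j"
  shows "((\<lambda>j. A j * ell2_nth x j) has_sum
    (\<Sum>j\<in>{i - 2, i - 1, i, i + 1, i + 2}. B j * ell2_nth x j)) (cmv_index M)"
proof -
  have "((\<lambda>j. B j * ell2_nth x j) has_sum
      (\<Sum>j\<in>{i - 2, i - 1, i, i + 1, i + 2}. B j * ell2_nth x j)) {i - 2, i - 1, i, i + 1, i + 2}"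
    by (rule has_sum_finite) simp
  also have "?this \<longleftrightarrow> ?thesis"
    by (rule has_sum_cong_neutral) (use x band A in \<open>auto simp: ell2_on_def\<close>)
  finally show ?thesis .
qed

context truncated_seq
begin

lemma nth_trunc_op:
  assumes "x \<in> H" "i \<noteq> 0"
  shows "ell2_nth (trunc_op True x) i =
      (\<Sum>j\<in>{i - 2, i - 1, i, i + 1, i + 2}. trunc_cmv \<infinity> \<alpha> i j * ell2_nth x j)" (is ?true)
    and "ell2_nth (trunc_op False x) i =
      (\<Sum>j\<in>{i - 2, i - 1, i, i + 1, i + 2}. trunc_cmv \<infinity> \<alpha> j i * ell2_nth x j)" (is ?false)
proof -
  have x0: "ell2_nth x 0 = 0"
    using assms by (simp add: in_H_iff)
  note entry = trunc_cmv_def cmv_index_def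
  note nth = trunc_op_def outer_def inner_factor_def nth_zero_first nth_factor_first nth_factor_second
    nth_factor_0
  consider "i = 1" | n where "i = Suc (Suc (2 * n))" | n where "i = Suc (Suc (Suc (2 * n)))"
    using assms(2) by (metis One_nat_def evenE not0_implies_Suc oddE Suc_eq_plus1 even_Suc)
  then have "?true \<and> ?false"
  proof cases
    case 1
    then show ?thesis
      using nth_factor_second[of 0 True] by (simp add: nth entry x0 algebra_simps)
  next
    case (2 n)
    then show ?thesis
      by (cases n) (simp_all add: nth entry x0 algebra_simps)
  next
    case (3 n)
    then show ?thesis
      by (simp add: nth entry x0 algebra_simps)
  qed
  then show ?true ?false
    by auto
qed

lemma matrix_maps_trunc_op:
  assumes "x \<in> H"
  shows "matrix_maps (cmv_index M) (trunc_cmv M \<alpha>) x (trunc_op True x)"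
    and "matrix_maps (cmv_index M) (trunc_cmv_transpose M \<alpha>) x (trunc_op False x)"
proof -
  have i: "i \<noteq> 0" if "i \<in> cmv_index M" for i
    using that by (simp add: cmv_index_def)
  show "matrix_maps (cmv_index M) (trunc_cmv M \<alpha>) x (trunc_op True x)"
    unfolding matrix_maps_def
  proof (intro conjI ballI)
    show "trunc_op True x \<in> H"
      using rank_one_defect_pair.TH[OF rank_one_defect_pair_trunc_op assms] .
    show "((\<lambda>j. trunc_cmv M \<alpha> i j * ell2_nth x j) has_sum ell2_nth (trunc_op True x) i)
        (cmv_index M)"
      if "i \<in> cmv_index M" for i
      unfolding nth_trunc_op(1)[OF assms i[OF that]]
      using that by (intro banded_has_sum[OF assms] trunc_cmv_band trunc_cmv_finite_size)
  qed
  show "matrix_maps (cmv_index M) (trunc_cmv_transpose M \<alpha>) x (trunc_op False x)"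
    unfolding matrix_maps_def trunc_cmv_transpose_def
  proof (intro conjI ballI)
    show "trunc_op False x \<in> H"
      using rank_one_defect_pair.TH[OF rank_one_defect_pair_trunc_op assms] .
    show "((\<lambda>j. trunc_cmv M \<alpha> j i * ell2_nth x j) has_sum ell2_nth (trunc_op False x) i)
        (cmv_index M)"
      if "i \<in> cmv_index M" for i
      unfolding nth_trunc_op(2)[OF assms i[OF that]]
      using that by (intro banded_has_sum[OF assms] trunc_cmv_band trunc_cmv_finite_size)
  qed
qed

end

section \<open>Orthogonal polynomials on the unit circle\<close>

text \<open>
  The pair \<open>(\<Phi>\<^sub>n, \<Phi>\<^sub>n\<^sup>*)\<close> of a monic orthogonal polynomial and its reversed polynomial, by the Szego
  recursion \<open>\<Phi>\<^sub>n\<^sub>+\<^sub>1 = \<zeta> \<Phi>\<^sub>n - a\<^sub>n \<Phi>\<^sub>n\<^sup>*\<close>, \<open>\<Phi>\<^sub>n\<^sub>+\<^sub>1\<^sup>* = \<Phi>\<^sub>n\<^sup>* - cnj a\<^sub>n \<zeta> \<Phi>\<^sub>n\<close>. The coefficient \<open>a\<^sub>n\<close> is computed from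
  integrals instead of values of orthogonal polynomials, so that the existence of the latter and their
  recursion come at once; it turns out to be the conjugate of the Verblunsky coefficient.
\<close>

primrec szego_pair :: "complex measure \<Rightarrow> nat \<Rightarrow> complex poly \<times> complex poly" where
  "szego_pair \<mu> 0 = (1, 1)"
| "szego_pair \<mu> (Suc n) =
    (let p = fst (szego_pair \<mu> n); q = snd (szego_pair \<mu> n);
         a = (LINT \<zeta>|\<mu>. \<zeta> * poly p \<zeta>) / (LINT \<zeta>|\<mu>. poly q \<zeta>)
     in (pCons 0 p - smult a q, q - smult (cnj a) (pCons 0 p)))"

locale circle_prob = prob_space \<mu> for \<mu> :: "complex measure" +
  assumes sets_circle: "sets \<mu> = sets (restrict_space borel (sphere 0 1))"
begin

lemma space_circle: "space \<mu> = sphere 0 1"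
  using sets_eq_imp_space_eq[OF sets_circle] by (simp add: space_restrict_space)

lemma mult_cnj_circle: "\<zeta> \<in> space \<mu> \<Longrightarrow> \<zeta> * cnj \<zeta> = 1"
  by (simp add: space_circle complex_norm_square[symmetric])

lemma integrable_continuous:
  fixes g :: "complex \<Rightarrow> 'b::{banach, second_countable_topology}"
  assumes "continuous_on (sphere 0 1) g"
  shows "integrable \<mu> g"
proof -
  have "bounded (g ` sphere 0 1)"
    by (intro compact_imp_bounded compact_continuous_image assms) simp
  then obtain B where B: "\<forall>x\<in>g ` sphere 0 1. norm x \<le> B"
    unfolding bounded_iff by blast
  show ?thesis
  proof (rule integrable_const_bound)
    show "AE \<zeta> in \<mu>. norm (g \<zeta>) \<le> B"
      using B space_circle by (intro AE_I2) auto
    show "g \<in> borel_measurable \<mu>"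
      using borel_measurable_continuous_on_restrict[OF assms] measurable_cong_sets[OF sets_circle refl]
      by blast
  qed
qed

definition moment :: "complex poly \<Rightarrow> nat \<Rightarrow> complex" where
  "moment p j = (LINT \<zeta>|\<mu>. poly p \<zeta> * cnj (\<zeta> ^ j))"

lemma integrable_poly: "integrable \<mu> (\<lambda>\<zeta>. poly p \<zeta> * cnj (poly q \<zeta>))"
  "integrable \<mu> (\<lambda>\<zeta>. poly p \<zeta> * cnj (\<zeta> ^ j))" "integrable \<mu> (\<lambda>\<zeta>. poly p \<zeta> * cnj \<zeta> ^ j)"
  by (intro integrable_continuous continuous_intros)+

lemma moment_diff: "moment (p - q) j = moment p j - moment q j"
  by (simp add: moment_def left_diff_distrib Bochner_Integration.integral_diff integrable_poly)

lemma moment_smult: "moment (smult c p) j = c * moment p j"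
  by (simp add: moment_def mult.assoc)

lemma moment_pCons_Suc: "moment (pCons 0 p) (Suc j) = moment p j"
proof -
  have "poly (pCons 0 p) \<zeta> * cnj (\<zeta> ^ Suc j) = poly p \<zeta> * cnj (\<zeta> ^ j)" if "\<zeta> \<in> space \<mu>" for \<zeta>
  proof -
    have "poly (pCons 0 p) \<zeta> * cnj (\<zeta> ^ Suc j) = (\<zeta> * cnj \<zeta>) * (poly p \<zeta> * cnj (\<zeta> ^ j))"
      by (simp add: mult_ac)
    then show ?thesis
      by (simp only: mult_cnj_circle[OF that] mult_1_left)
  qed
  then show ?thesis
    unfolding moment_def by (intro Bochner_Integration.integral_cong refl)
qed

lemma integral_poly_cnj_poly:
  "(LINT \<zeta>|\<mu>. poly p \<zeta> * cnj (poly r \<zeta>)) = (\<Sum>i\<le>degree r. cnj (coeff r i) * moment p i)"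
proof -
  have "(LINT \<zeta>|\<mu>. poly p \<zeta> * cnj (poly r \<zeta>)) =
      (LINT \<zeta>|\<mu>. (\<Sum>i\<le>degree r. cnj (coeff r i) * (poly p \<zeta> * cnj (\<zeta> ^ i))))"
    by (simp add: poly_altdef sum_distrib_left mult_ac)
  also have "\<dots> = (\<Sum>i\<le>degree r. LINT \<zeta>|\<mu>. cnj (coeff r i) * (poly p \<zeta> * cnj (\<zeta> ^ i)))"
    by (intro Bochner_Integration.integral_sum integrable_mult_right integrable_poly)
  finally show ?thesis
    by (simp add: moment_def)
qed

definition norm_sq :: "complex poly \<Rightarrow> real" where
  "norm_sq p = (LINT \<zeta>|\<mu>. (cmod (poly p \<zeta>))\<^sup>2)"

lemma integral_poly_self:
  "(LINT \<zeta>|\<mu>. poly p \<zeta> * cnj (poly p \<zeta>)) = complex_of_real (norm_sq p)"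
  unfolding norm_sq_def integral_complex_of_real[symmetric] by (simp only: complex_norm_square)

text \<open>
  The complement of the support is a union of open null sets, and countably many of them suffice.
\<close>

lemma AE_in_support: "AE \<zeta> in \<mu>. \<zeta> \<in> measure_support \<mu>"
proof -
  have open_sets: "U \<inter> space \<mu> \<in> sets \<mu>" if "open U" for U
    unfolding sets_circle space_circle sets_restrict_space using that by auto
  define \<U> where "\<U> = {U. open U \<and> emeasure \<mu> (U \<inter> space \<mu>) = 0}"
  obtain \<V> where \<V>: "\<V> \<subseteq> \<U>" "countable \<V>" "\<Union>\<V> = \<Union>\<U>"
    using Lindelof[of \<U>] by (auto simp: \<U>_def)
  have "(\<Union>U\<in>\<V>. U \<inter> space \<mu>) \<in> null_sets \<mu>"
    using \<V> open_sets by (intro null_sets_UN') (auto simp: \<U>_def null_sets_def)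
  then have "AE \<zeta> in \<mu>. \<zeta> \<notin> (\<Union>U\<in>\<V>. U \<inter> space \<mu>)"
    by (rule AE_not_in)
  then show ?thesis
  proof (rule AE_mp, intro AE_I2 impI)
    fix \<zeta> assume "\<zeta> \<in> space \<mu>" "\<zeta> \<notin> (\<Union>U\<in>\<V>. U \<inter> space \<mu>)"
    then have "\<zeta> \<notin> \<Union>\<U>"
      using \<V>(3) by auto
    then show "\<zeta> \<in> measure_support \<mu>"
      using \<open>\<zeta> \<in> space \<mu>\<close> by (auto simp: measure_support_def \<U>_def zero_less_iff_neq_zero)
  qed
qed

lemma support_nonempty: "measure_support \<mu> \<noteq> {}"
  using AE_in_support AE_False by auto

lemma norm_sq_0_imp_support:
  assumes "norm_sq p = 0"
  shows "measure_support \<mu> \<subseteq> {\<zeta>. poly p \<zeta> = 0}"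
proof
  fix \<zeta> assume \<zeta>: "\<zeta> \<in> measure_support \<mu>"
  have "integrable \<mu> (\<lambda>\<zeta>. (cmod (poly p \<zeta>))\<^sup>2)"
    by (intro integrable_continuous continuous_intros)
  then have AE: "AE \<zeta> in \<mu>. poly p \<zeta> = 0"
    using assms by (simp add: norm_sq_def integral_nonneg_eq_0_iff_AE)
  let ?U = "{\<zeta>. poly p \<zeta> \<noteq> 0}"
  have "open ?U"
    by (intro open_Collect_neq continuous_intros)
  moreover have "emeasure \<mu> (?U \<inter> space \<mu>) = 0"
  proof -
    have "?U \<inter> space \<mu> = {\<zeta> \<in> space \<mu>. poly p \<zeta> \<noteq> 0}"
      by auto
    then show ?thesis
      using AE by (simp add: emeasure_eq_0_AE)
  qed
  ultimately show "\<zeta> \<in> {\<zeta>. poly p \<zeta> = 0}"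
    using \<zeta> by (fastforce simp: measure_support_def)
qed

text \<open>
  A polynomial vanishing on the support has at least as many roots as the support has points.
\<close>

lemma norm_sq_pos:
  assumes "p \<noteq> 0" "enat (degree p) \<le> verblunsky_last \<mu>"
  shows "norm_sq p > 0"
proof (rule ccontr)
  assume "\<not> norm_sq p > 0"
  moreover have "norm_sq p \<ge> 0"
    by (simp add: norm_sq_def)
  ultimately have sub: "measure_support \<mu> \<subseteq> {\<zeta>. poly p \<zeta> = 0}"
    by (intro norm_sq_0_imp_support) simp
  have fin: "finite {\<zeta>. poly p \<zeta> = 0}"
    using assms(1) by (rule poly_roots_finite)
  then have fin_supp: "finite (measure_support \<mu>)"
    using sub finite_subset by blast
  have "card (measure_support \<mu>) \<le> degree p"
    using card_mono[OF fin sub] card_poly_roots_bound[OF assms(1)] by linarith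
  moreover have "card (measure_support \<mu>) > 0"
    using fin_supp support_nonempty by (simp add: card_gt_0_iff)
  ultimately show False
    using assms(2) fin_supp by (simp add: verblunsky_last_def)
qed

definition Phi :: "nat \<Rightarrow> complex poly" where "Phi n = fst (szego_pair \<mu> n)"
definition Phi_star :: "nat \<Rightarrow> complex poly" where "Phi_star n = snd (szego_pair \<mu> n)"
definition szego_coeff :: "nat \<Rightarrow> complex" where
  "szego_coeff n = moment (pCons 0 (Phi n)) 0 / moment (Phi_star n) 0"

lemma Phi_0: "Phi 0 = 1" "Phi_star 0 = 1"
  by (simp_all add: Phi_def Phi_star_def)

lemma Phi_Suc:
  "Phi (Suc n) = pCons 0 (Phi n) - smult (szego_coeff n) (Phi_star n)"
  "Phi_star (Suc n) = Phi_star n - smult (cnj (szego_coeff n)) (pCons 0 (Phi n))"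
  by (simp_all add: Phi_def Phi_star_def Let_def szego_coeff_def moment_def)

lemma coeff_Phi: "coeff (Phi n) n = 1" "degree (Phi n) \<le> n" "degree (Phi_star n) \<le> n"
  "coeff (Phi_star n) 0 = 1"
proof (induction n)
  case (Suc n)
  { case 1
    show ?case
      using Suc by (simp add: Phi_Suc coeff_eq_0)
  next
    case 2
    show ?case
      using Suc by (auto simp: Phi_Suc intro!: degree_diff_le order.trans[OF degree_pCons_le]
          order.trans[OF degree_smult_le])
  next
    case 3
    show ?case
      using Suc by (auto simp: Phi_Suc intro!: degree_diff_le order.trans[OF degree_pCons_le]
          order.trans[OF degree_smult_le])
  next
    case 4
    show ?case
      using Suc by (simp add: Phi_Suc)
  }
qed (simp_all add: Phi_0)

lemma degree_Phi: "degree (Phi n) = n"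
  using coeff_Phi(1,2)[of n] by (metis le_antisym le_degree zero_neq_one)

lemma poly_Phi_star:
  assumes "\<zeta> \<in> space \<mu>"
  shows "poly (Phi_star n) \<zeta> = \<zeta> ^ n * cnj (poly (Phi n) \<zeta>)"
proof (induction n)
  case (Suc n)
  have 1: "\<zeta> * cnj \<zeta> = 1"
    by (rule mult_cnj_circle[OF assms])
  then have n: "\<zeta> ^ n * cnj \<zeta> ^ n = 1"
    by (metis power_mult_distrib power_one)
  have "\<zeta> ^ Suc n * cnj (poly (Phi (Suc n)) \<zeta>) =
      (\<zeta> * cnj \<zeta>) * (\<zeta> ^ n * cnj (poly (Phi n) \<zeta>)) -
      cnj (szego_coeff n) * \<zeta> * ((\<zeta> ^ n * cnj \<zeta> ^ n) * poly (Phi n) \<zeta>)"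
    by (simp add: Phi_Suc Suc algebra_simps)
  also have "\<dots> = poly (Phi_star (Suc n)) \<zeta>"
    unfolding 1 n by (simp add: Phi_Suc Suc)
  finally show ?case ..
qed (simp add: Phi_0)

lemma moment_Phi_star:
  assumes "j \<le> n"
  shows "moment (Phi_star n) j = cnj (moment (Phi n) (n - j))"
proof -
  have "poly (Phi_star n) \<zeta> * cnj (\<zeta> ^ j) = cnj (poly (Phi n) \<zeta> * cnj (\<zeta> ^ (n - j)))"
    if "\<zeta> \<in> space \<mu>" for \<zeta>
  proof -
    have "\<zeta> ^ j * cnj \<zeta> ^ j = 1"
      using mult_cnj_circle[OF that] by (metis power_mult_distrib power_one)
    moreover have "\<zeta> ^ n = \<zeta> ^ (n - j) * \<zeta> ^ j"
      using assms by (simp flip: power_add)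
    ultimately show ?thesis
      by (simp add: poly_Phi_star[OF that] mult_ac)
  qed
  then have "moment (Phi_star n) j = (LINT \<zeta>|\<mu>. cnj (poly (Phi n) \<zeta> * cnj (\<zeta> ^ (n - j))))"
    unfolding moment_def by (intro Bochner_Integration.integral_cong refl)
  also have "\<dots> = cnj (moment (Phi n) (n - j))"
    unfolding moment_def by (rule Bochner_Integration.integral_cnj)
  finally show ?thesis .
qed

text \<open>
  The Szego coefficient is chosen to make \<open>\<Phi>\<^sub>n\<^sub>+\<^sub>1\<close> orthogonal to \<open>1\<close>; orthogonality to the other powers
  is inherited from \<open>\<Phi>\<^sub>n\<close> and \<open>\<Phi>\<^sub>n\<^sup>*\<close>.
\<close>

lemma orthogonal_and_norm:
  assumes "\<And>m. m < n \<Longrightarrow> enat m \<le> verblunsky_last \<mu>"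
  shows "(\<forall>j<n. moment (Phi n) j = 0) \<and> moment (Phi n) n = complex_of_real (norm_sq (Phi n))"
  using assms
proof (induction n)
  case 0
  show ?case
    using integral_poly_self[of "Phi 0"] by (simp add: Phi_0 moment_def)
next
  case (Suc n)
  have IH: "moment (Phi n) j = 0" if "j < n" for j
    using Suc that by auto
  have IH_norm: "moment (Phi n) n = complex_of_real (norm_sq (Phi n))"
    using Suc by auto
  have "Phi n \<noteq> 0"
    using coeff_Phi(1)[of n] by auto
  then have "norm_sq (Phi n) > 0"
    using Suc.prems[of n] by (intro norm_sq_pos) (auto simp: degree_Phi)
  then have nz: "moment (Phi_star n) 0 \<noteq> 0"
    using moment_Phi_star[of 0 n] by (simp add: IH_norm)
  have orth: "moment (Phi (Suc n)) j = 0" if "j < Suc n" for j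
  proof (cases j)
    case 0
    then show ?thesis
      using nz by (simp add: Phi_Suc moment_diff moment_smult szego_coeff_def)
  next
    case (Suc i)
    then have "moment (Phi_star n) j = 0"
      using that moment_Phi_star[of j n] IH[of "n - j"] by simp
    then show ?thesis
      using Suc that IH[of i] by (simp add: Phi_Suc moment_diff moment_smult moment_pCons_Suc)
  qed
  have "complex_of_real (norm_sq (Phi (Suc n))) =
      (\<Sum>i\<le>Suc n. cnj (coeff (Phi (Suc n)) i) * moment (Phi (Suc n)) i)"
    by (simp only: integral_poly_self[symmetric] integral_poly_cnj_poly degree_Phi)
  also have "\<dots> = (\<Sum>i\<in>{Suc n}. cnj (coeff (Phi (Suc n)) i) * moment (Phi (Suc n)) i)"
    using orth by (intro sum.mono_neutral_right) auto
  finally show ?case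
    using orth by (simp add: coeff_Phi)
qed

lemma orthogonal:
  assumes "\<And>m. m < n \<Longrightarrow> enat m \<le> verblunsky_last \<mu>"
  shows "j < n \<Longrightarrow> moment (Phi n) j = 0"
    and "moment (Phi n) n = complex_of_real (norm_sq (Phi n))"
  using orthogonal_and_norm[OF assms] by auto

lemma moment_Phi_star_eq_0:
  assumes "\<And>m. m < n \<Longrightarrow> enat m \<le> verblunsky_last \<mu>" "1 \<le> j" "j \<le> n"
  shows "moment (Phi_star n) j = 0"
  using moment_Phi_star[OF assms(3)] orthogonal(1)[of n "n - j"] assms by simp

lemma moment_Phi_star_Suc:
  assumes "enat n \<le> verblunsky_last \<mu>"
  shows "moment (Phi_star n) (Suc n) = cnj (szego_coeff n) * complex_of_real (norm_sq (Phi n))"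
proof -
  have N: "enat m \<le> verblunsky_last \<mu>" if "m < Suc n" for m
    using assms that by (meson enat_ord_simps(1) less_Suc_eq_le order.trans)
  have "moment (Phi_star (Suc n)) (Suc n) = 0"
    using N by (intro moment_Phi_star_eq_0) auto
  then show ?thesis
    using orthogonal(2)[of n] N by (simp add: Phi_Suc moment_diff moment_smult moment_pCons_Suc)
qed

lemma norm_sq_Phi_pos: "enat n \<le> verblunsky_last \<mu> \<Longrightarrow> norm_sq (Phi n) > 0"
  using coeff_Phi(1)[of n] by (intro norm_sq_pos) (auto simp: degree_Phi)

lemma norm_sq_Phi_Suc:
  assumes "enat n \<le> verblunsky_last \<mu>"
  shows "norm_sq (Phi (Suc n)) = norm_sq (Phi n) * (1 - (cmod (szego_coeff n))\<^sup>2)"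
proof -
  have N: "enat m \<le> verblunsky_last \<mu>" if "m < Suc n" for m
    using assms that by (meson enat_ord_simps(1) less_Suc_eq_le order.trans)
  have "complex_of_real (norm_sq (Phi (Suc n))) = moment (Phi (Suc n)) (Suc n)"
    using N by (intro orthogonal(2)[symmetric])
  also have "\<dots> = moment (Phi n) n - szego_coeff n * moment (Phi_star n) (Suc n)"
    by (simp add: Phi_Suc moment_diff moment_smult moment_pCons_Suc)
  also have "\<dots> = norm_sq (Phi n) * (1 - szego_coeff n * cnj (szego_coeff n))"
    using orthogonal(2)[of n] N by (simp add: moment_Phi_star_Suc[OF assms] algebra_simps)
  also have "\<dots> = complex_of_real (norm_sq (Phi n) * (1 - (cmod (szego_coeff n))\<^sup>2))"
    by (simp add: complex_norm_square[symmetric])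
  finally show ?thesis
    using of_real_eq_iff by blast
qed

lemma cmod_szego_coeff_less:
  assumes "enat n < verblunsky_last \<mu>"
  shows "cmod (szego_coeff n) < 1"
proof -
  have "norm_sq (Phi (Suc n)) > 0"
    using assms by (intro norm_sq_Phi_pos) (simp add: Suc_ile_eq)
  moreover have "enat n \<le> verblunsky_last \<mu>"
    using assms by simp
  ultimately have "(cmod (szego_coeff n))\<^sup>2 < 1"
    using norm_sq_Phi_Suc[of n] norm_sq_Phi_pos[of n] by (simp add: zero_less_mult_iff)
  then show ?thesis
    by (simp add: abs_square_less_1)
qed

text \<open>
  When the support has \<open>N + 1\<close> points, the polynomial vanishing there differs from \<open>\<Phi>\<^sub>N\<^sub>+\<^sub>1\<close> by a
  polynomial of lower degree, so \<open>\<parallel>\<Phi>\<^sub>N\<^sub>+\<^sub>1\<parallel>\<^sup>2\<close> is the inner product of the two, which is \<open>0\<close>.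
\<close>

lemma cmod_szego_coeff_last:
  assumes "verblunsky_last \<mu> = enat N"
  shows "cmod (szego_coeff N) = 1"
proof -
  have fin: "finite (measure_support \<mu>)"
    using assms by (auto simp: verblunsky_last_def split: if_splits)
  then have card: "card (measure_support \<mu>) = Suc N"
    using assms support_nonempty card_gt_0_iff[of "measure_support \<mu>"]
    by (auto simp: verblunsky_last_def)
  define r where "r = (\<Prod>\<zeta>\<in>measure_support \<mu>. [:- \<zeta>, 1:])"
  have deg: "degree r = Suc N" "coeff r (Suc N) = 1"
  proof -
    show deg: "degree r = Suc N"
      unfolding r_def by (subst degree_prod_eq_sum_degree) (auto simp: card)
    have "lead_coeff r = 1"
      unfolding r_def by (subst lead_coeff_prod) simp
    then show "coeff r (Suc N) = 1"
      by (simp add: deg)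
  qed
  have "AE \<zeta> in \<mu>. poly r \<zeta> = 0"
    using AE_in_support by (rule AE_mp) (use fin in \<open>auto simp: r_def poly_prod\<close>)
  then have "(LINT \<zeta>|\<mu>. poly (Phi (Suc N)) \<zeta> * cnj (poly r \<zeta>)) = (LINT \<zeta>|\<mu>. 0)"
    by (intro integral_cong_AE borel_measurable_integrable[OF integrable_poly(1)]) auto
  then have "(\<Sum>i\<le>Suc N. cnj (coeff r i) * moment (Phi (Suc N)) i) = 0"
    by (simp only: integral_poly_cnj_poly deg) simp
  moreover have "(\<Sum>i\<le>Suc N. cnj (coeff r i) * moment (Phi (Suc N)) i) =
      (\<Sum>i\<in>{Suc N}. cnj (coeff r i) * moment (Phi (Suc N)) i)"
    using orthogonal(1)[of "Suc N"] assms by (intro sum.mono_neutral_right) auto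
  ultimately have "norm_sq (Phi (Suc N)) = 0"
    using orthogonal(2)[of "Suc N"] assms deg by simp
  then have "(cmod (szego_coeff N))\<^sup>2 = 1"
    using norm_sq_Phi_Suc[of N] norm_sq_Phi_pos[of N] assms by simp
  then show ?thesis
    using norm_ge_zero[of "szego_coeff N"] by (metis power2_eq_1_iff neg_0_le_iff_le not_one_le_zero)
qed

text \<open>
  The difference of two monic orthogonal polynomials of degree \<open>n\<close> has lower degree and is therefore
  orthogonal to itself.
\<close>

lemma orthogonal_poly_eq_Phi:
  assumes N: "\<And>m. m < n \<Longrightarrow> enat m \<le> verblunsky_last \<mu>"
  shows "orthogonal_poly \<mu> n = Phi n"
  unfolding orthogonal_poly_def moment_def[symmetric]
proof (rule the_equality)
  show "degree (Phi n) = n \<and> lead_coeff (Phi n) = 1 \<and> (\<forall>k<n. moment (Phi n) k = 0)"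
    using orthogonal(1)[of n] N by (simp add: degree_Phi coeff_Phi)
  fix p assume p: "degree p = n \<and> lead_coeff p = 1 \<and> (\<forall>k<n. moment p k = 0)"
  show "p = Phi n"
  proof (rule ccontr)
    assume "p \<noteq> Phi n"
    then have nz: "p - Phi n \<noteq> 0"
      by simp
    moreover have "degree (p - Phi n) \<le> n" "coeff (p - Phi n) n = 0"
      using p degree_Phi[of n] coeff_Phi(1)[of n] by (auto intro!: degree_diff_le)
    ultimately have deg: "degree (p - Phi n) < n"
      by (metis leading_coeff_0_iff le_neq_implies_less)
    have "moment (p - Phi n) i = 0" if "i < n" for i
      using p that orthogonal(1)[of n i] N by (simp add: moment_diff)
    then have "complex_of_real (norm_sq (p - Phi n)) = 0"
      using deg unfolding integral_poly_self[symmetric] integral_poly_cnj_poly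
      by (intro sum.neutral) auto
    then show False
      using norm_sq_pos[OF nz N[OF deg]] by simp
  qed
qed

lemma verblunsky_eq: "enat n \<le> verblunsky_last \<mu> \<Longrightarrow> verblunsky \<mu> n = cnj (szego_coeff n)"
proof -
  assume n: "enat n \<le> verblunsky_last \<mu>"
  have "orthogonal_poly \<mu> (Suc n) = Phi (Suc n)"
    using n by (intro orthogonal_poly_eq_Phi) (meson enat_ord_simps(1) less_Suc_eq_le order.trans)
  then show ?thesis
    using coeff_Phi(4)[of n] by (simp add: verblunsky_def Phi_Suc poly_0_coeff_0)
qed

end

section \<open>Schur iterates\<close>

lemma cmod_blaschke_le:
  assumes "cmod a \<le> 1" "cmod b \<le> 1"
  shows "cmod (b - a) \<le> cmod (1 - cnj a * b)"
proof (rule power2_le_imp_le)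
  have "complex_of_real ((cmod (1 - cnj a * b))\<^sup>2 - (cmod (b - a))\<^sup>2) =
      (1 - cnj a * b) * cnj (1 - cnj a * b) - (b - a) * cnj (b - a)"
    by (simp only: complex_norm_square of_real_diff)
  also have "\<dots> = (1 - a * cnj a) * (1 - b * cnj b)"
    by (simp add: algebra_simps)
  also have "\<dots> = complex_of_real ((1 - (cmod a)\<^sup>2) * (1 - (cmod b)\<^sup>2))"
    by (simp only: complex_norm_square of_real_diff of_real_mult of_real_1)
  finally have "(cmod (1 - cnj a * b))\<^sup>2 - (cmod (b - a))\<^sup>2 = (1 - (cmod a)\<^sup>2) * (1 - (cmod b)\<^sup>2)"
    using of_real_eq_iff by blast
  moreover have "0 \<le> (1 - (cmod a)\<^sup>2) * (1 - (cmod b)\<^sup>2)"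
    using assms by (intro mult_nonneg_nonneg) (auto simp: power_le_one)
  ultimately show "(cmod (b - a))\<^sup>2 \<le> (cmod (1 - cnj a * b))\<^sup>2"
    by linarith
qed simp

text \<open>
  The Schwarz lemma for \<open>\<bar>w\<bar> \<le> 1\<close> instead of \<open>\<bar>w\<bar> < 1\<close> follows by applying it to \<open>c w\<close>
  for \<open>c < 1\<close>.
\<close>

lemma schwarz_quotient:
  assumes w: "w holomorphic_on ball 0 1" "w 0 = 0" "\<And>z. z \<in> ball 0 1 \<Longrightarrow> cmod (w z) \<le> 1"
  shows "\<exists>h. h holomorphic_on ball 0 1 \<and> (\<forall>z\<in>ball 0 1. w z = z * h z) \<and>
    (\<forall>z\<in>ball 0 1. cmod (h z) \<le> 1)"
proof (intro exI conjI ballI)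
  define h where "h z = (if z = 0 then deriv w 0 else (w z - w 0) / (z - 0))" for z
  show "h holomorphic_on ball 0 1"
    unfolding h_def by (rule pole_lemma[OF w(1)]) simp
  show "w z = z * h z" for z
    using w(2) by (simp add: h_def)
  fix z :: complex assume z: "z \<in> ball 0 1"
  have "c * cmod (h z) \<le> 1" if "0 < c" "c < 1" for c
  proof -
    have hol: "(\<lambda>z. complex_of_real c * w z) holomorphic_on ball 0 1"
      by (intro holomorphic_intros w)
    have lt: "cmod (complex_of_real c * w z) < 1" if "cmod z < 1" for z
    proof -
      have "c * cmod (w z) \<le> c * 1"
        using w(3)[of z] that \<open>0 < c\<close> by (intro mult_left_mono) auto
      then have "c * cmod (w z) < 1"
        using \<open>c < 1\<close> by linarith
      then show ?thesis
        using \<open>0 < c\<close> by (simp add: norm_mult)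
    qed
    note schwarz = Schwarz_Lemma[OF hol _ lt]
    show ?thesis
    proof (cases "z = 0")
      case True
      have "w field_differentiable at 0"
        using w(1) by (rule holomorphic_on_imp_differentiable_at) auto
      then have "deriv (\<lambda>z. complex_of_real c * w z) 0 = complex_of_real c * deriv w 0"
        by (rule deriv_cmult)
      then show ?thesis
        using schwarz(2)[of 0] w(2) True that by (simp add: h_def norm_mult)
    next
      case False
      then show ?thesis
        using schwarz(1)[of z] w(2) z that by (simp add: h_def norm_mult norm_divide field_simps)
    qed
  qed
  then show "cmod (h z) \<le> 1"
    by (rule field_le_mult_one_interval)
qed

lemma remove_sings_eq_holomorphic:
  assumes h: "h holomorphic_on ball 0 1" and k: "\<And>z. z \<in> ball 0 1 \<Longrightarrow> z \<noteq> 0 \<Longrightarrow> k z = h z"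
    and z: "z \<in> ball 0 1"
  shows "remove_sings k z = h z"
proof (rule remove_sings_eqI)
  have "isCont h z"
    using h z by (meson continuous_on_eq_continuous_at holomorphic_on_imp_continuous_on open_ball)
  then have "h \<midarrow>z\<rightarrow> h z"
    by (simp add: isCont_def)
  moreover have "eventually (\<lambda>y. h y = k y) (at z)"
  proof (cases "z = 0")
    case True
    have "eventually (\<lambda>y. y \<in> ball 0 1 - {0}) (at (0 :: complex))"
      by (rule eventually_at_in_open) auto
    then show ?thesis
      using True k by (auto elim: eventually_mono)
  next
    case False
    have "eventually (\<lambda>y. y \<in> ball 0 1 - {0}) (nhds z)"
      using z False by (intro eventually_nhds_in_open) auto
    then show ?thesis
      using k by (auto simp: eventually_at_filter elim: eventually_mono)
  qed
  ultimately show "k \<midarrow>z\<rightarrow> h z"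
    using Lim_transform_eventually by blast
qed

context circle_prob
begin

text \<open>
  Half of \<open>(\<zeta> + z) / (\<zeta> - z) + 1\<close> equals \<open>1 / (1 - cnj \<zeta> z)\<close>, and this geometric series can be integrated
  term by term.
\<close>

lemma caratheodory_sums:
  assumes z: "cmod z < 1"
  shows "(\<lambda>j. moment 1 j * z ^ j) sums ((caratheodory_fun \<mu> z + 1) / 2)"
proof -
  have cont: "continuous_on (sphere 0 1) (\<lambda>\<zeta>. (\<zeta> + z) / (\<zeta> - z))"
    using z by (auto intro!: continuous_intros)
  have geo: "(\<lambda>j. (cnj \<zeta> * z) ^ j) sums (((\<zeta> + z) / (\<zeta> - z) + 1) / 2)" if "\<zeta> \<in> space \<mu>" for \<zeta>
  proof -
    have \<zeta>: "cmod \<zeta> = 1" "\<zeta> * cnj \<zeta> = 1"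
      using that mult_cnj_circle[OF that] by (auto simp: space_circle)
    have "cmod (cnj \<zeta> * z) < 1"
      using z \<zeta> by (simp add: norm_mult)
    then have "(\<lambda>j. (cnj \<zeta> * z) ^ j) sums (1 / (1 - cnj \<zeta> * z))"
      by (rule geometric_sums)
    also have "1 / (1 - cnj \<zeta> * z) = \<zeta> / (\<zeta> - z)"
    proof -
      have "\<zeta> \<noteq> z" "1 - cnj \<zeta> * z \<noteq> 0"
        using \<zeta> z by (auto simp: norm_mult)
          (metis mult.commute complex_mod_cnj less_irrefl mult_1_right norm_mult norm_one)
      then show ?thesis
        using \<zeta>(2) by (simp add: divide_simps) (simp add: algebra_simps)
    qed
    also have "\<dots> = ((\<zeta> + z) / (\<zeta> - z) + 1) / 2"
    proof -
      have "\<zeta> - z \<noteq> 0"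
        using \<zeta> z by auto
      then show ?thesis
        by (simp add: divide_simps)
    qed
    finally show ?thesis .
  qed
  have "(\<lambda>j. LINT \<zeta>|\<mu>. (cnj \<zeta> * z) ^ j) sums (LINT \<zeta>|\<mu>. (\<Sum>j. (cnj \<zeta> * z) ^ j))"
  proof (rule sums_integral)
    show "integrable \<mu> (\<lambda>\<zeta>. (cnj \<zeta> * z) ^ j)" for j
      by (intro integrable_continuous continuous_intros)
    have n: "norm ((cnj \<zeta> * z) ^ j) = cmod z ^ j" if "\<zeta> \<in> space \<mu>" for \<zeta> j
      using that by (simp add: space_circle norm_mult norm_power)
    have s: "summable (\<lambda>j. cmod z ^ j)"
      using z by (simp add: summable_geometric)
    show "AE \<zeta> in \<mu>. summable (\<lambda>j. norm ((cnj \<zeta> * z) ^ j))"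
      using s by (intro AE_I2) (simp add: n)
    have "(LINT \<zeta>|\<mu>. norm ((cnj \<zeta> * z) ^ j)) = cmod z ^ j" for j
      using n by (simp cong: Bochner_Integration.integral_cong add: prob_space)
    then show "summable (\<lambda>j. LINT \<zeta>|\<mu>. norm ((cnj \<zeta> * z) ^ j))"
      using s by simp
  qed
  moreover have "(LINT \<zeta>|\<mu>. (cnj \<zeta> * z) ^ j) = moment 1 j * z ^ j" for j
    by (simp add: moment_def power_mult_distrib)
  moreover have "(LINT \<zeta>|\<mu>. (\<Sum>j. (cnj \<zeta> * z) ^ j)) = (caratheodory_fun \<mu> z + 1) / 2"
  proof -
    have "(LINT \<zeta>|\<mu>. (\<Sum>j. (cnj \<zeta> * z) ^ j)) = (LINT \<zeta>|\<mu>. ((\<zeta> + z) / (\<zeta> - z) + 1) / 2)"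
      using geo by (intro Bochner_Integration.integral_cong refl) (simp add: sums_iff)
    also have "\<dots> = ((LINT \<zeta>|\<mu>. (\<zeta> + z) / (\<zeta> - z)) + (LINT \<zeta>|\<mu>. 1)) / 2"
      using integrable_continuous[OF cont] by (simp add: Bochner_Integration.integral_add)
    finally show ?thesis
      by (simp add: caratheodory_fun_def prob_space)
  qed
  ultimately show ?thesis
    by simp
qed

lemma Re_caratheodory_nonneg:
  assumes z: "cmod z < 1"
  shows "Re (caratheodory_fun \<mu> z) \<ge> 0"
proof -
  have cont: "continuous_on (sphere 0 1) (\<lambda>\<zeta>. (\<zeta> + z) / (\<zeta> - z))"
    using z by (auto intro!: continuous_intros)
  have "Re ((\<zeta> + z) / (\<zeta> - z)) \<ge> 0" if "\<zeta> \<in> space \<mu>" for \<zeta>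
  proof -
    have "Re ((\<zeta> + z) * cnj (\<zeta> - z)) = (cmod \<zeta>)\<^sup>2 - (cmod z)\<^sup>2"
      unfolding cmod_power2 by (simp add: algebra_simps power2_eq_square)
    also have "\<dots> \<ge> 0"
      using that z by (simp add: space_circle power_le_one)
    finally show ?thesis
      by (simp add: Re_complex_div_ge_0)
  qed
  then have "(LINT \<zeta>|\<mu>. Re ((\<zeta> + z) / (\<zeta> - z))) \<ge> 0"
    by (intro Bochner_Integration.integral_nonneg_AE AE_I2)
  then show ?thesis
    unfolding caratheodory_fun_def using integrable_continuous[OF cont] by simp
qed

text \<open>
  The pair \<open>(P\<^sub>n, Q\<^sub>n)\<close> of the Cauchy transforms \<open>P\<^sub>n(z) = \<integral> \<Phi>\<^sub>n(\<zeta>) \<zeta> / (\<zeta> - z) d\<mu>(\<zeta>)\<close> and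
  \<open>Q\<^sub>n(z) = \<integral> \<Phi>\<^sub>n\<^sup>*(\<zeta>) z / (\<zeta> - z) d\<mu>(\<zeta>)\<close>, by the recursion which they inherit from \<open>\<Phi>\<^sub>n\<close> and \<open>\<Phi>\<^sub>n\<^sup>*\<close>.
\<close>

primrec second_kind :: "nat \<Rightarrow> complex \<Rightarrow> complex \<times> complex" where
  "second_kind 0 z = ((caratheodory_fun \<mu> z + 1) / 2, (caratheodory_fun \<mu> z - 1) / 2)"
| "second_kind (Suc n) z =
    (z * fst (second_kind n z) - szego_coeff n * snd (second_kind n z),
     snd (second_kind n z) - cnj (szego_coeff n) * (z * fst (second_kind n z)))"

definition P where "P n z = fst (second_kind n z)"
definition Q where "Q n z = snd (second_kind n z)"

lemma P_Q_0: "P 0 z = (caratheodory_fun \<mu> z + 1) / 2" "Q 0 z = (caratheodory_fun \<mu> z - 1) / 2"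
  by (simp_all add: P_def Q_def)

lemma P_Q_Suc: "P (Suc n) z = z * P n z - szego_coeff n * Q n z"
  "Q (Suc n) z = Q n z - cnj (szego_coeff n) * (z * P n z)"
  by (simp_all add: P_def Q_def)

definition P_fps where "P_fps n = Abs_fps (moment (Phi n))"
definition Q_fps where "Q_fps n = Abs_fps (\<lambda>j. if j = 0 then 0 else moment (Phi_star n) j)"

text \<open>
  At the constant coefficient, the recursion for \<open>P\<^sub>n\<^sub>+\<^sub>1\<close> amounts to the orthogonality of \<open>\<Phi>\<^sub>n\<^sub>+\<^sub>1\<close> to \<open>1\<close>.
\<close>

lemma has_fps_expansion_P_Q:
  assumes "\<And>m. m < n \<Longrightarrow> enat m \<le> verblunsky_last \<mu>"
  shows "P n has_fps_expansion P_fps n \<and> Q n has_fps_expansion Q_fps n"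
  using assms
proof (induction n)
  case 0
  have "eventually (\<lambda>z. z \<in> ball 0 1) (nhds (0 :: complex))"
    by (intro eventually_nhds_in_open) auto
  then have P: "P 0 has_fps_expansion P_fps 0"
    using caratheodory_sums
    by (intro has_fps_expansionI) (auto simp: P_fps_def Phi_0 P_Q_0 elim!: eventually_mono)
  have "moment 1 0 = 1"
    by (simp add: moment_def prob_space)
  then have "Q_fps 0 = P_fps 0 - fps_const 1"
    by (intro fps_ext) (simp add: P_fps_def Q_fps_def Phi_0)
  moreover have "Q 0 = (\<lambda>z. P 0 z - 1)"
    by (auto simp: P_Q_0 fun_eq_iff field_simps)
  moreover have "(\<lambda>z. P 0 z - 1) has_fps_expansion P_fps 0 - fps_const 1"
    by (intro has_fps_expansion_diff P has_fps_expansion_const)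
  ultimately show ?case
    using P by simp
next
  case (Suc n)
  then have P: "P n has_fps_expansion P_fps n" and Q: "Q n has_fps_expansion Q_fps n"
    by auto
  have P_Suc: "P_fps (Suc n) = fps_X * P_fps n - fps_const (szego_coeff n) * Q_fps n"
  proof (rule fps_ext)
    fix j
    show "fps_nth (P_fps (Suc n)) j =
        fps_nth (fps_X * P_fps n - fps_const (szego_coeff n) * Q_fps n) j"
      using orthogonal(1)[of "Suc n" 0] Suc.prems
      by (cases j) (auto simp: P_fps_def Q_fps_def Phi_Suc moment_diff moment_smult moment_pCons_Suc)
  qed
  have Q_Suc: "Q_fps (Suc n) = Q_fps n - fps_const (cnj (szego_coeff n)) * (fps_X * P_fps n)"
  proof (rule fps_ext)
    fix j
    show "fps_nth (Q_fps (Suc n)) j =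
        fps_nth (Q_fps n - fps_const (cnj (szego_coeff n)) * (fps_X * P_fps n)) j"
      by (cases j) (auto simp: P_fps_def Q_fps_def Phi_Suc moment_diff moment_smult moment_pCons_Suc)
  qed
  have "P (Suc n) = (\<lambda>z. z * P n z - szego_coeff n * Q n z)"
    "Q (Suc n) = (\<lambda>z. Q n z - cnj (szego_coeff n) * (z * P n z))"
    by (auto simp: P_Q_Suc)
  then show ?case
    unfolding P_Suc Q_Suc by (auto intro!: fps_expansion_intros P Q)
qed

text \<open>
  By orthogonality, the power series of \<open>P\<^sub>n\<close> starts with \<open>\<parallel>\<Phi>\<^sub>n\<parallel>\<^sup>2 z\<^sup>n\<close>, and that of \<open>Q\<^sub>n\<close> with a term of order
  \<open>n + 1\<close>, whose coefficient follows from the orthogonality of \<open>\<Phi>\<^sub>n\<^sub>+\<^sub>1\<^sup>*\<close> to \<open>\<zeta>\<^sup>n\<^sup>+\<^sup>1\<close>.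
\<close>

lemma quotient_at_0:
  assumes n: "enat n \<le> verblunsky_last \<mu>" and f: "f holomorphic_on ball 0 1"
    and Q: "\<And>z. z \<in> ball 0 1 \<Longrightarrow> Q n z = z * P n z * f z"
  shows "f 0 = cnj (szego_coeff n)"
proof -
  have N: "enat m \<le> verblunsky_last \<mu>" if "m < n" for m
    using n that by (meson enat_ord_simps(1) less_imp_le order.trans)
  define G where "G = fps_expansion f 0"
  have G: "f has_fps_expansion G"
    unfolding G_def using f centre_in_ball[of "0 :: complex" 1]
    by (intro analytic_at_imp_has_fps_expansion_0)
       (auto simp: analytic_at intro!: exI[of _ "ball 0 1"])
  have PQ: "P n has_fps_expansion P_fps n" "Q n has_fps_expansion Q_fps n"
    using has_fps_expansion_P_Q[of n] N by auto
  have "eventually (\<lambda>z. z \<in> ball 0 1) (nhds (0 :: complex))"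
    by (intro eventually_nhds_in_open) auto
  then have "eventually (\<lambda>z. Q n z = z * (P n z * f z)) (nhds 0)"
    using Q by (auto simp: mult.assoc elim!: eventually_mono)
  then have "Q n has_fps_expansion fps_X * (P_fps n * G) \<longleftrightarrow>
      (\<lambda>z. z * (P n z * f z)) has_fps_expansion fps_X * (P_fps n * G)"
    by (intro has_fps_expansion_cong refl)
  moreover have "(\<lambda>z. z * (P n z * f z)) has_fps_expansion fps_X * (P_fps n * G)"
    by (intro fps_expansion_intros PQ G)
  ultimately have "Q_fps n = fps_X * (P_fps n * G)"
    using PQ(2) fps_expansion_unique_complex by blast
  then have "fps_nth (Q_fps n) (Suc n) = fps_nth (P_fps n * G) n"
    by simp
  also have "\<dots> = (\<Sum>i=0..n. moment (Phi n) i * fps_nth G (n - i))"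
    by (simp add: fps_mult_nth P_fps_def)
  also have "\<dots> = (\<Sum>i\<in>{n}. moment (Phi n) i * fps_nth G (n - i))"
    using orthogonal(1)[of n] N by (intro sum.mono_neutral_right) auto
  finally have "cnj (szego_coeff n) * complex_of_real (norm_sq (Phi n)) =
      complex_of_real (norm_sq (Phi n)) * fps_nth G 0"
    using orthogonal(2)[of n] N by (simp add: Q_fps_def moment_Phi_star_Suc[OF n])
  then show ?thesis
    using norm_sq_Phi_pos[OF n] has_fps_expansion_imp_0_eq_fps_nth_0[OF G] by simp
qed

abbreviation "f n \<equiv> schur_iterate (schur_fun \<mu>) n"

text \<open>
  Dividing the recursion \<open>Q\<^sub>n\<^sub>+\<^sub>1 = Q\<^sub>n - \<alpha>\<^sub>n z P\<^sub>n\<close> by \<open>P\<^sub>n\<^sub>+\<^sub>1 = z P\<^sub>n - cnj \<alpha>\<^sub>n Q\<^sub>n\<close> gives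
  \<open>(f\<^sub>n - \<alpha>\<^sub>n) / (1 - cnj \<alpha>\<^sub>n f\<^sub>n)\<close> for \<open>f\<^sub>n = Q\<^sub>n / (z P\<^sub>n)\<close>. As \<open>\<alpha>\<^sub>n = f\<^sub>n(0)\<close>, this is the Schur algorithm, and the
  Schwarz lemma bounds the next iterate.
\<close>

lemma schur_iterate_step:
  assumes less: "enat n < verblunsky_last \<mu>" and fn: "f n holomorphic_on ball 0 1"
    and f_le: "\<And>z. z \<in> ball 0 1 \<Longrightarrow> cmod (f n z) \<le> 1"
    and Qn: "\<And>z. z \<in> ball 0 1 \<Longrightarrow> Q n z = z * P n z * f n z"
  shows "f (Suc n) holomorphic_on ball 0 1"
    and "z \<in> ball 0 1 \<Longrightarrow> cmod (f (Suc n) z) \<le> 1"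
    and "z \<in> ball 0 1 \<Longrightarrow> Q (Suc n) z = z * P (Suc n) z * f (Suc n) z"
    and "z \<in> ball 0 1 \<Longrightarrow>
      f n z - cnj (szego_coeff n) = z * f (Suc n) z * (1 - szego_coeff n * f n z)"
proof -
  have n: "enat n \<le> verblunsky_last \<mu>" "enat n < verblunsky_last \<mu>"
    using less by simp_all
  have f0: "f n 0 = cnj (szego_coeff n)"
    by (rule quotient_at_0[OF n(1) fn Qn])
  have nz: "1 - szego_coeff n * f n z \<noteq> 0" if "z \<in> ball 0 1" for z
  proof -
    have "cmod (szego_coeff n) * cmod (f n z) \<le> cmod (szego_coeff n) * 1"
      using f_le[OF that] by (intro mult_left_mono) auto
    then have "cmod (szego_coeff n * f n z) < 1"
      using cmod_szego_coeff_less[OF n(2)] by (simp add: norm_mult)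
    then show ?thesis
      by auto
  qed
  define w where "w z = (f n z - f n 0) / (1 - szego_coeff n * f n z)" for z
  have "w holomorphic_on ball 0 1"
    unfolding w_def using nz by (intro holomorphic_intros fn) auto
  moreover have "w 0 = 0"
    by (simp add: w_def)
  moreover have "cmod (w z) \<le> 1" if "z \<in> ball 0 1" for z
    using cmod_blaschke_le[of "f n 0" "f n z"] f_le[OF that] f_le[of 0] nz[OF that]
    by (simp add: w_def f0 norm_divide divide_le_eq_1)
  ultimately have "\<exists>h. h holomorphic_on ball 0 1 \<and> (\<forall>z\<in>ball 0 1. w z = z * h z) \<and>
      (\<forall>z\<in>ball 0 1. cmod (h z) \<le> 1)"
    by (rule schwarz_quotient)
  then obtain h where h: "h holomorphic_on ball 0 1" "\<And>z. z \<in> ball 0 1 \<Longrightarrow> w z = z * h z"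
    "\<And>z. z \<in> ball 0 1 \<Longrightarrow> cmod (h z) \<le> 1"
    by blast
  have quot: "(f n z - f n 0) / (z * (1 - cnj (f n 0) * f n z)) = w z / z" for z
    by (simp add: w_def f0 mult.commute)
  have f: "f (Suc n) z = h z" if "z \<in> ball 0 1" for z
    unfolding schur_iterate.simps quot
    using that h(2) by (intro remove_sings_eq_holomorphic[OF h(1)]) auto
  have "f (Suc n) holomorphic_on ball 0 1 \<longleftrightarrow> h holomorphic_on ball 0 1"
    by (intro holomorphic_cong f) auto
  then show "f (Suc n) holomorphic_on ball 0 1"
    using h(1) by simp
  assume z: "z \<in> ball 0 1"
  show "cmod (f (Suc n) z) \<le> 1"
    using h(3) f z by simp
  have "z * f (Suc n) z = w z"
    using h(2) f z by simp
  then show rec: "f n z - cnj (szego_coeff n) = z * f (Suc n) z * (1 - szego_coeff n * f n z)"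
    using nz[OF z] by (simp add: w_def f0)
  have "P (Suc n) z = z * P n z * (1 - szego_coeff n * f n z)"
    using Qn[OF z] by (simp add: P_Q_Suc algebra_simps)
  then have "z * P (Suc n) z * f (Suc n) z =
      z * P n z * (z * f (Suc n) z * (1 - szego_coeff n * f n z))"
    by (simp add: mult_ac)
  also have "\<dots> = Q (Suc n) z"
    unfolding rec[symmetric] using Qn[OF z] by (simp add: P_Q_Suc algebra_simps)
  finally show "Q (Suc n) z = z * P (Suc n) z * f (Suc n) z" ..
qed

lemma schur_iterate_quotient:
  assumes "enat n \<le> verblunsky_last \<mu>"
  shows "f n holomorphic_on ball 0 1 \<and>
    (\<forall>z\<in>ball 0 1. cmod (f n z) \<le> 1 \<and> Q n z = z * P n z * f n z)"
  using assms
proof (induction n)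
  case 0
  let ?F = "caratheodory_fun \<mu>"
  have F1: "?F z + 1 \<noteq> 0" if "z \<in> ball 0 1" for z
    using Re_caratheodory_nonneg[of z] that by (auto simp: complex_eq_iff)
  have "(\<lambda>z. (?F z + 1) / 2) holomorphic_on ball 0 1"
    using caratheodory_sums by (intro power_series_holomorphic[where a = "moment 1"]) simp
  then have "(\<lambda>z. (?F z + 1) / 2 + (?F z + 1) / 2 - 1) holomorphic_on ball 0 1"
    by (intro holomorphic_on_add holomorphic_on_diff holomorphic_on_const)
  moreover have "(\<lambda>z. (?F z + 1) / 2 + (?F z + 1) / 2 - 1) = ?F"
    by (simp add: fun_eq_iff field_simps)
  ultimately have F: "?F holomorphic_on ball 0 1"
    by simp
  define w where "w z = (?F z - 1) / (?F z + 1)" for z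
  have "w holomorphic_on ball 0 1"
    unfolding w_def using F1 by (intro holomorphic_intros F) auto
  moreover have "w 0 = 0"
  proof -
    have "caratheodory_fun \<mu> 0 = (LINT \<zeta>|\<mu>. 1)"
      unfolding caratheodory_fun_def
      by (intro Bochner_Integration.integral_cong) (auto simp: space_circle)
    then show ?thesis
      by (simp add: w_def prob_space)
  qed
  moreover have "cmod (w z) \<le> 1" if "z \<in> ball 0 1" for z
  proof -
    have "(cmod (?F z - 1))\<^sup>2 \<le> (cmod (?F z + 1))\<^sup>2"
      using Re_caratheodory_nonneg[of z] that unfolding cmod_power2
      by (simp add: power2_eq_square algebra_simps)
    then have "cmod (?F z - 1) \<le> cmod (?F z + 1)"
      by (rule power2_le_imp_le) simp
    then show ?thesis
      using F1[OF that] by (simp add: w_def norm_divide divide_le_eq_1)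
  qed
  ultimately have "\<exists>h. h holomorphic_on ball 0 1 \<and> (\<forall>z\<in>ball 0 1. w z = z * h z) \<and>
      (\<forall>z\<in>ball 0 1. cmod (h z) \<le> 1)"
    by (rule schwarz_quotient)
  then obtain h where h: "h holomorphic_on ball 0 1" "\<And>z. z \<in> ball 0 1 \<Longrightarrow> w z = z * h z"
    "\<And>z. z \<in> ball 0 1 \<Longrightarrow> cmod (h z) \<le> 1"
    by blast
  have f: "f 0 z = h z" if "z \<in> ball 0 1" for z
    unfolding schur_iterate.simps schur_fun_def
    using that h(2) by (intro remove_sings_eq_holomorphic[OF h(1)]) (auto simp: w_def[symmetric])
  have "f 0 holomorphic_on ball 0 1 \<longleftrightarrow> h holomorphic_on ball 0 1"
    by (intro holomorphic_cong f) auto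
  moreover have "Q 0 z = z * P 0 z * f 0 z" if "z \<in> ball 0 1" for z
  proof -
    have "?F z - 1 = z * h z * (?F z + 1)"
      using F1[OF that] h(2)[OF that] by (simp add: w_def divide_eq_eq)
    then show ?thesis
      unfolding f[OF that] P_Q_0 by simp
  qed
  ultimately show ?case
    using h f by auto
next
  case (Suc n)
  have n: "enat n \<le> verblunsky_last \<mu>" "enat n < verblunsky_last \<mu>"
    using Suc.prems by (simp_all add: Suc_ile_eq less_imp_le)
  have fn: "f n holomorphic_on ball 0 1"
    and f_le: "\<And>z. z \<in> ball 0 1 \<Longrightarrow> cmod (f n z) \<le> 1"
    and Qn: "\<And>z. z \<in> ball 0 1 \<Longrightarrow> Q n z = z * P n z * f n z"
    using Suc.IH[OF n(1)] by auto
  show ?case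
    using schur_iterate_step[OF n(2) fn f_le Qn] by blast
qed

lemma schur_iterate_properties:
  assumes "enat n \<le> verblunsky_last \<mu>"
  shows "f n 0 = verblunsky \<mu> n"
    and "cmod z < 1 \<Longrightarrow> cmod (f n z) \<le> 1"
    and "cmod z < 1 \<Longrightarrow> z \<noteq> 0 \<Longrightarrow> enat n < verblunsky_last \<mu> \<Longrightarrow>
      f n z - verblunsky \<mu> n = z * f (Suc n) z * (1 - cnj (verblunsky \<mu> n) * f n z)"
    and "cmod z < 1 \<Longrightarrow> enat n = verblunsky_last \<mu> \<Longrightarrow> f n z = verblunsky \<mu> n"
proof -
  note f = schur_iterate_quotient[OF assms]
  show f0: "f n 0 = verblunsky \<mu> n"
    using quotient_at_0[OF assms, of "f n"] f verblunsky_eq[OF assms] by simp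
  show f_le: "cmod (f n z) \<le> 1" if "cmod z < 1" for z
    using f that by simp
  show "f n z - verblunsky \<mu> n = z * f (Suc n) z * (1 - cnj (verblunsky \<mu> n) * f n z)"
    if z: "cmod z < 1" "z \<noteq> 0" and n: "enat n < verblunsky_last \<mu>"
    using schur_iterate_step(4)[OF n, of z] f z verblunsky_eq[OF assms] by simp
  show "f n z = verblunsky \<mu> n" if z: "cmod z < 1" and n: "enat n = verblunsky_last \<mu>"
  proof -
    \<comment> \<open>The last iterate attains its maximal modulus at \<open>0\<close>.\<close>
    have "cmod (f n 0) = 1"
      using cmod_szego_coeff_last[of n] n f0 verblunsky_eq[OF assms] by simp
    then have "f n constant_on ball 0 1"
      using f by (intro maximum_modulus_principle[of "f n" "ball 0 1" "ball 0 1" 0]) auto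
    then have "f n z = f n 0"
      using z by (auto simp: constant_on_def)
    then show ?thesis
      by (simp add: f0)
  qed
qed

end

section \<open>Deleting rows and columns\<close>

lemma cmv_index_shift: "i \<ge> 1 \<Longrightarrow> i + k \<in> cmv_index N \<longleftrightarrow> i \<in> cmv_index (N - enat k)"
  by (cases N) (auto simp: cmv_index_def)

lemma rho_shift: "rho (\<lambda>n. \<alpha> (n + k)) j = rho \<alpha> (j + k)"
  by (simp add: rho_def)

text \<open>
  Up to the indices of the coefficients, the entry in row \<open>i\<close> and column \<open>j\<close> depends on the parity of \<open>min i j\<close>
  only, and the formulas for the two parities are each other's transposes. An odd shift exchanges
  the parities.
\<close>

lemma delete_first_trunc_cmv:
  "delete_first k (trunc_cmv N \<alpha>) =
    (if even k then trunc_cmv (N - enat k) (\<lambda>n. \<alpha> (n + k))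
     else trunc_cmv_transpose (N - enat k) (\<lambda>n. \<alpha> (n + k)))"
proof (intro ext)
  fix i j
  show "delete_first k (trunc_cmv N \<alpha>) i j =
    (if even k then trunc_cmv (N - enat k) (\<lambda>n. \<alpha> (n + k))
     else trunc_cmv_transpose (N - enat k) (\<lambda>n. \<alpha> (n + k))) i j"
  proof (cases "1 \<le> i \<and> 1 \<le> j")
    case True
    then have idx: "i + k \<in> cmv_index N \<longleftrightarrow> i \<in> cmv_index (N - enat k)"
      "j + k \<in> cmv_index N \<longleftrightarrow> j \<in> cmv_index (N - enat k)"
      by (auto intro!: cmv_index_shift)
    have "i + k - 1 = i - 1 + k" "j + k - 1 = j - 1 + k"
      using True by auto
    then show ?thesis
      using True
      by (auto simp: delete_first_def trunc_cmv_transpose_def trunc_cmv_def idx rho_shift add_ac)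
  next
    case False
    then have "i \<notin> cmv_index M \<or> j \<notin> cmv_index M" for M
      by (auto simp: cmv_index_def)
    then show ?thesis
      using False by (auto simp: delete_first_def trunc_cmv_transpose_def trunc_cmv_def)
  qed
qed

lemma delete_first_trunc_cmv_transpose:
  "delete_first k (trunc_cmv_transpose N \<alpha>) =
    (if odd k then trunc_cmv (N - enat k) (\<lambda>n. \<alpha> (n + k))
     else trunc_cmv_transpose (N - enat k) (\<lambda>n. \<alpha> (n + k)))"
proof (intro ext)
  fix i j
  have "delete_first k (trunc_cmv_transpose N \<alpha>) i j = delete_first k (trunc_cmv N \<alpha>) j i"
    by (simp add: delete_first_def trunc_cmv_transpose_def)
  then show "delete_first k (trunc_cmv_transpose N \<alpha>) i j =
    (if odd k then trunc_cmv (N - enat k) (\<lambda>n. \<alpha> (n + k))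
     else trunc_cmv_transpose (N - enat k) (\<lambda>n. \<alpha> (n + k))) i j"
    unfolding delete_first_trunc_cmv by (simp add: trunc_cmv_transpose_def)
qed

lemma trunc_cmv_cong:
  assumes "\<And>n. enat n \<le> M \<Longrightarrow> \<alpha> n = \<beta> n"
  shows "trunc_cmv M \<alpha> = trunc_cmv M \<beta>"
proof (intro ext)
  fix i j
  show "trunc_cmv M \<alpha> i j = trunc_cmv M \<beta> i j"
  proof (cases "i \<in> cmv_index M \<and> j \<in> cmv_index M")
    case True
    have "\<alpha> n = \<beta> n \<and> rho \<alpha> n = rho \<beta> n" if "n \<le> i \<or> n \<le> j" for n
    proof -
      have "enat n \<le> M"
        using that True by (cases M) (auto simp: cmv_index_def)
      then show ?thesis
        using assms by (simp add: rho_def)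
    qed
    then show ?thesis
      by (auto simp: trunc_cmv_def)
  next
    case False
    then show ?thesis
      by (auto simp: trunc_cmv_def)
  qed
qed

section \<open>Schur iterates as characteristic functions\<close>

context truncated_seq
begin

lemma truncated_cmv_matrix:
  defines "A \<equiv> \<lambda>s. if s then trunc_cmv M \<alpha> else trunc_cmv_transpose M \<alpha>"
  shows "defines_matrix_op (cmv_index M) (A s)"
    and "x \<in> H \<Longrightarrow> matrix_op (cmv_index M) (A s) x = trunc_op s x"
proof -
  have maps: "matrix_maps (cmv_index M) (A s) x (trunc_op s x)" if "x \<in> H" for x
    using matrix_maps_trunc_op[OF that] by (auto simp: A_def)
  then show "defines_matrix_op (cmv_index M) (A s)"
    by (auto simp: defines_matrix_op_def)
  show "x \<in> H \<Longrightarrow> matrix_op (cmv_index M) (A s) x = trunc_op s x"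
    by (intro matrix_op_eqI maps)
qed

end

theorem theorem6p6:
  fixes \<mu> :: "complex measure" and N :: enat and \<alpha> :: "nat \<Rightarrow> complex"
  assumes "circle_measure \<mu>"
    and "N = verblunsky_last \<mu>"
    and "\<And>n. enat n \<le> N \<Longrightarrow> \<alpha> n = verblunsky \<mu> n"
  shows "(\<forall>k\<ge>1. enat k < N \<longrightarrow>
      (\<forall>A\<in>{delete_first k (trunc_cmv N \<alpha>), delete_first k (trunc_cmv_transpose N \<alpha>)}.
        let I = cmv_index (N - enat k); T = matrix_op I A in
        defines_matrix_op I A \<and> contraction_op (ell2_on I) T \<and>
        completely_nonunitary (ell2_on I) T \<and> rank_one_defects (ell2_on I) T)) \<and>
    (\<forall>m\<ge>1. enat (2 * m - 1) < N \<longrightarrow>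
      delete_first (2 * m - 1) (trunc_cmv N \<alpha>) =
        trunc_cmv_transpose (N - enat (2 * m - 1)) (\<lambda>n. \<alpha> (n + (2 * m - 1)))) \<and>
    (\<forall>m\<ge>1. enat (2 * m) < N \<longrightarrow>
      delete_first (2 * m) (trunc_cmv N \<alpha>) =
        trunc_cmv (N - enat (2 * m)) (\<lambda>n. \<alpha> (n + 2 * m))) \<and>
    (\<forall>k\<ge>1. enat k < N \<longrightarrow>
      (let I = cmv_index (N - enat k) in
        char_fun_agrees (ell2_on I) (matrix_op I (delete_first k (trunc_cmv N \<alpha>)))
          (schur_iterate (schur_fun \<mu>) k)))"
proof -
  interpret circle_prob \<mu>
    using assms(1) unfolding circle_measure_def circle_prob_def circle_prob_axioms_def by simp
  have \<alpha>: "\<alpha> n = verblunsky \<mu> n" "cmod (\<alpha> n) \<le> 1" if "enat n \<le> N" for n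
  proof -
    show "\<alpha> n = verblunsky \<mu> n"
      by (rule assms(3)[OF that])
    then show "cmod (\<alpha> n) \<le> 1"
      using that cmod_szego_coeff_less[of n] cmod_szego_coeff_last[of n] verblunsky_eq[of n] assms(2)
      by (cases "enat n = N") (auto simp: less_le)
  qed
  have main: "defines_matrix_op I A \<and> contraction_op (ell2_on I) (matrix_op I A) \<and>
      completely_nonunitary (ell2_on I) (matrix_op I A) \<and>
      rank_one_defects (ell2_on I) (matrix_op I A) \<and>
      char_fun_agrees (ell2_on I) (matrix_op I A) (f k)"
    if k: "enat k < N" and I: "I = cmv_index (N - enat k)"
      and A: "A \<in> {delete_first k (trunc_cmv N \<alpha>), delete_first k (trunc_cmv_transpose N \<alpha>)}"
    for k I A
  proof -
    define M where "M = N - enat k"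
    \<comment> \<open>The matrix does not see the coefficients beyond \<open>M\<close>, so they can be chosen in the closed disk.\<close>
    define \<beta> where "\<beta> n = (if enat n \<le> M then \<alpha> (n + k) else 0)" for n
    have le: "enat (n + k) \<le> N \<longleftrightarrow> enat n \<le> M" and less: "enat (n + k) < N \<longleftrightarrow> enat n < M" for n
      using k unfolding M_def by (cases N; auto)+
    have last: "enat (n + k) = N \<longleftrightarrow> M = enat n" for n
      using k unfolding M_def by (cases N) auto
    interpret truncated_seq \<beta> M
    proof
      show "cmod (\<beta> n) \<le> 1" for n
        using \<alpha>(2)[of "n + k"] le[of n] by (simp add: \<beta>_def)
      show "1 \<le> M"
        using k unfolding M_def by (cases N) (auto simp: one_enat_def)
      show "cmod (\<beta> n) < 1" if "enat n < M" for n
        using that \<alpha>(1)[of "n + k"] less[of n] cmod_szego_coeff_less[of "n + k"]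
          verblunsky_eq[of "n + k"] assms(2) by (simp add: \<beta>_def less_imp_le)
      show "cmod (\<beta> m) = 1" if "M = enat m" for m
        using that \<alpha>(1)[of "m + k"] last[of m] cmod_szego_coeff_last[of "m + k"]
          verblunsky_eq[of "m + k"] assms(2) by (simp add: \<beta>_def)
    qed
    have "trunc_cmv M (\<lambda>n. \<alpha> (n + k)) = trunc_cmv M \<beta>"
      by (rule trunc_cmv_cong) (simp add: \<beta>_def)
    moreover from this have "trunc_cmv_transpose M (\<lambda>n. \<alpha> (n + k)) = trunc_cmv_transpose M \<beta>"
      by (simp add: fun_eq_iff trunc_cmv_transpose_def)
    ultimately have "A = (if even k then trunc_cmv M \<beta> else trunc_cmv_transpose M \<beta>) \<or>
        A = (if odd k then trunc_cmv M \<beta> else trunc_cmv_transpose M \<beta>)"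
      using A by (simp only: delete_first_trunc_cmv delete_first_trunc_cmv_transpose
          M_def[symmetric] insert_iff empty_iff simp_thms)
    then obtain s where A_eq: "A = (if s then trunc_cmv M \<beta> else trunc_cmv_transpose M \<beta>)"
      by blast
    have T: "matrix_op I A x = trunc_op s x" if "x \<in> H" for x
      unfolding A_eq I M_def[symmetric] by (rule truncated_cmv_matrix(2)[OF that])
    have "char_fun_agrees H (matrix_op I A) (f (0 + k))"
    proof (rule char_fun_trunc_op[OF T, where G = "\<lambda>n. f (n + k)"])
      fix z :: complex and n assume z: "z \<noteq> 0" "cmod z < 1"
      show "cmod (f (n + k) z) \<le> 1" if "enat n \<le> M"
        using schur_iterate_properties(2)[of "n + k" z] that le[of n] z assms(2) by simp
      show "f (n + k) z - \<beta> n = z * f (Suc n + k) z * (1 - cnj (\<beta> n) * f (n + k) z)"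
        if "enat n < M"
        using schur_iterate_properties(3)[of "n + k" z] that less[of n] \<alpha>(1)[of "n + k"] z assms(2)
        by (simp add: \<beta>_def less_imp_le)
      show "f (n + k) z = \<beta> n" if "M = enat n"
        using schur_iterate_properties(4)[of "n + k" z] that last[of n] \<alpha>(1)[of "n + k"] z assms(2)
        by (simp add: \<beta>_def)
    next
      show "f (0 + k) 0 = \<beta> 0"
        using schur_iterate_properties(1)[of k] \<alpha>(1)[of k] k assms(2) le[of 0]
        by (simp add: \<beta>_def less_imp_le)
    qed
    then show ?thesis
      using rank_one_defect_pair.contraction[OF rank_one_defect_pair_cong[OF T]]
        rank_one_defect_pair.rank_one[OF rank_one_defect_pair_cong[OF T]]
        completely_nonunitary_trunc_op[OF T] truncated_cmv_matrix(1)[of s]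
      unfolding A_eq[symmetric] I M_def[symmetric] by simp
  qed
  show ?thesis
  proof (intro conjI allI impI ballI)
    fix k A assume "enat k < N"
      "A \<in> {delete_first k (trunc_cmv N \<alpha>), delete_first k (trunc_cmv_transpose N \<alpha>)}"
    then show "let I = cmv_index (N - enat k); T = matrix_op I A in
        defines_matrix_op I A \<and> contraction_op (ell2_on I) T \<and>
        completely_nonunitary (ell2_on I) T \<and> rank_one_defects (ell2_on I) T"
      using main[of k "cmv_index (N - enat k)" A] unfolding Let_def by blast
  next
    fix m :: nat assume "1 \<le> m"
    then have "odd (2 * m - 1)"
      by simp
    then show "delete_first (2 * m - 1) (trunc_cmv N \<alpha>) =
        trunc_cmv_transpose (N - enat (2 * m - 1)) (\<lambda>n. \<alpha> (n + (2 * m - 1)))"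
      unfolding delete_first_trunc_cmv by simp
  next
    fix m :: nat
    show "delete_first (2 * m) (trunc_cmv N \<alpha>) =
        trunc_cmv (N - enat (2 * m)) (\<lambda>n. \<alpha> (n + 2 * m))"
      unfolding delete_first_trunc_cmv by simp
  next
    fix k assume "enat k < N"
    then show "let I = cmv_index (N - enat k) in
        char_fun_agrees (ell2_on I) (matrix_op I (delete_first k (trunc_cmv N \<alpha>)))
          (schur_iterate (schur_fun \<mu>) k)"
      using main[of k "cmv_index (N - enat k)"] unfolding Let_def by blast
  qed
qed

end
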